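(* Let $0<\alpha<1$, $\beta>0$, $\mu>0$, and let $\mathcal{E}$ be a Gaussian white noise on $\mathbb{R}$ with intensity $\sigma^2$. Then a solution to the equation $$\left(\mu+\frac{d^\alpha}{d(-t)^\alpha}\right)^{\beta}X(t)=\mathcal{E}(t)$$ is represented by $$X(t)=\frac{1}{\Gamma(\beta)}\int_0^\infty dz\int_0^\infty ds\; s^{\beta-1}e^{-s\mu}\,h_\alpha(z,s)\,\mathcal{E}(t+z).$$
   Context: Fractional derivative: for $0<\alpha<1$, the upper-Weyl (Marchaud) derivative is $$\frac{d^\alpha}{d(-t)^\alpha}f(t)=-\frac{1}{\Gamma(1-\alpha)}\frac{d}{dt}\int_t^\infty\frac{f(s)}{(s-t)^\alpha}ds=\frac{\alpha}{\Gamma(1-\alpha)}\int_0^\infty\frac{f(t)-f(t+w)}{w^{\alpha+1}}dw .$$ Stable subordinator density: $h_\alpha(z,s)$, $z,s\ge 0$, is the probability density in $z$ of the positively skewed stable process (stable subordinator) $H^\alpha(s)$ of order $\alpha$, i.e. $\int_0^\infty e^{-\xi z}h_\alpha(z,s)\,dz=e^{-s\xi^\alpha}$ for $\xi\ge 0$. White noise: $\mathcal{E}$ is a centered Gaussian linear family $\{\mathcal{E}(\varphi):\varphi\in L^2(\mathbb{R})\}$ with $\mathbb{E}[\mathcal{E}(\varphi)\mathcal{E}(\psi)]=\sigma^2\int_{\mathbb{R}}\varphi\psi\,dt$; formally $\mathcal{E}(\varphi)=\int\varphi(t)\mathcal{E}(t)dt$ and $\mathbb{E}\,\mathcal{E}(t)\mathcal{E}(s)=\sigma^2\delta(t-s)$.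 For a kernel $K\in L^1(\mathbb{R})$, the expression $X(t)=\int K(x)\mathcal{E}(t+x)\,dx$ denotes the generalized process $X(\varphi)=\mathcal{E}(K*\varphi)$, $\varphi\in L^2(\mathbb{R})$. In an iterated integral such as the one in the claim, $K$ is the function obtained by carrying out the other integration ($K(z)=0$ for $z<0$). Meaning of solution: with $A=\frac{d^\alpha}{d(-t)^\alpha}$, a solution of $(\mu+A)^\beta X=\mathcal{E}$ is $X=(\mu+A)^{-\beta}\mathcal{E}$, where $$(\mu+A)^{-\beta}=\frac{1}{\Gamma(\beta)}\int_0^\infty s^{\beta-1}e^{-s\mu}e^{-sA}\,ds$$ and $(e^{-sA})_{s\ge 0}$ is the semigroup generated by $-A$ on $L^2(\mathbb{R})$. A bounded operator $T$ on $L^2(\mathbb{R})$ acts on $\mathcal{E}$ by duality, $(T\mathcal{E})(\varphi)=\mathcal{E}(T^*\varphi)$. *)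

theory Defs
  imports "HOL-Probability.Probability"
begin

section \<open>The Hilbert space of square-integrable functions on the real line\<close>

definition square_integrable :: "(real \<Rightarrow> real) \<Rightarrow> bool" where
  "square_integrable f \<longleftrightarrow> f \<in> borel_measurable borel \<and> integrable lborel (\<lambda>x. (f x)\<^sup>2)"

definition l2_rel :: "(real \<Rightarrow> real) \<Rightarrow> (real \<Rightarrow> real) \<Rightarrow> bool" where
  "l2_rel f g \<longleftrightarrow> square_integrable f \<and> square_integrable g \<and> (AE x in lborel. f x = g x)"

lemma square_integrable_measurable [measurable_dest]:
  "square_integrable f \<Longrightarrow> f \<in> borel_measurable borel"
  by (simp add: square_integrable_def)

lemma square_integrable_zero: "square_integrable (\<lambda>x. 0)"
  by (simp add: square_integrable_def)

lemma square_integrable_mult_integrable: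
  assumes "square_integrable f" "square_integrable g"
  shows "integrable lborel (\<lambda>x. f x * g x)"
proof (rule Bochner_Integration.integrable_bound)
  show "integrable lborel (\<lambda>x. (f x)\<^sup>2 + (g x)\<^sup>2)"
    using assms by (simp add: square_integrable_def)
  show "(\<lambda>x. f x * g x) \<in> borel_measurable lborel"
    using assms by (auto simp: square_integrable_def)
  show "AE x in lborel. norm (f x * g x) \<le> norm ((f x)\<^sup>2 + (g x)\<^sup>2)"
  proof (rule AE_I2)
    fix x
    have "0 \<le> (\<bar>f x\<bar> - \<bar>g x\<bar>)\<^sup>2" by simp
    also have "\<dots> = (f x)\<^sup>2 + (g x)\<^sup>2 - 2 * \<bar>f x * g x\<bar>"
      by (simp add: power2_diff abs_mult)
    finally have "2 * \<bar>f x * g x\<bar> \<le> (f x)\<^sup>2 + (g x)\<^sup>2" by simp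
    then show "norm (f x * g x) \<le> norm ((f x)\<^sup>2 + (g x)\<^sup>2)" by simp
  qed
qed

lemma square_integrable_add:
  assumes "square_integrable f" "square_integrable g"
  shows "square_integrable (\<lambda>x. f x + g x)"
  using assms square_integrable_mult_integrable[OF assms]
  by (auto simp: square_integrable_def power2_sum mult.assoc)

lemma square_integrable_scale:
  "square_integrable f \<Longrightarrow> square_integrable (\<lambda>x. c * f x)"
  by (auto simp: square_integrable_def power_mult_distrib)

lemma square_integrable_uminus:
  "square_integrable f \<Longrightarrow> square_integrable (\<lambda>x. - f x)"
  using square_integrable_scale[of f "-1"] by simp

lemma square_integrable_diff:
  "square_integrable f \<Longrightarrow> square_integrable g \<Longrightarrow> square_integrable (\<lambda>x. f x - g x)"
  using square_integrable_add[of f "\<lambda>x. - g x"] square_integrable_uminus[of g] by simp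

lemma square_integrable_bound:
  assumes "square_integrable g" "f \<in> borel_measurable borel" "\<And>x. \<bar>f x\<bar> \<le> \<bar>g x\<bar>"
  shows "square_integrable f"
proof -
  have "integrable lborel (\<lambda>x. (f x)\<^sup>2)"
  proof (rule Bochner_Integration.integrable_bound)
    show "integrable lborel (\<lambda>x. (g x)\<^sup>2)" using assms by (simp add: square_integrable_def)
    show "(\<lambda>x. (f x)\<^sup>2) \<in> borel_measurable lborel" using assms by simp
    show "AE x in lborel. norm ((f x)\<^sup>2) \<le> norm ((g x)\<^sup>2)"
      using assms(3) by (auto simp: abs_le_square_iff)
  qed
  then show ?thesis using assms by (simp add: square_integrable_def)
qed

quotient_type l2 = "real \<Rightarrow> real" / partial: l2_rel
proof (rule part_equivpI)
  show "\<exists>x. l2_rel x x"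
    by (rule exI[of _ "\<lambda>x. 0"]) (simp add: l2_rel_def square_integrable_zero)
  show "symp l2_rel" by (rule sympI) (auto simp: l2_rel_def)
  show "transp l2_rel" by (rule transpI) (auto simp: l2_rel_def)
qed

instantiation l2 :: real_inner
begin

lift_definition zero_l2 :: l2 is "\<lambda>x. 0"
  by (simp add: l2_rel_def square_integrable_zero)

lift_definition plus_l2 :: "l2 \<Rightarrow> l2 \<Rightarrow> l2" is "\<lambda>f g x. f x + g x"
  by (auto simp: l2_rel_def square_integrable_add)

lift_definition uminus_l2 :: "l2 \<Rightarrow> l2" is "\<lambda>f x. - f x"
  by (auto simp: l2_rel_def square_integrable_uminus)

lift_definition minus_l2 :: "l2 \<Rightarrow> l2 \<Rightarrow> l2" is "\<lambda>f g x. f x - g x"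
  by (auto simp: l2_rel_def square_integrable_diff)

lift_definition scaleR_l2 :: "real \<Rightarrow> l2 \<Rightarrow> l2" is "\<lambda>c f x. c * f x"
  by (auto simp: l2_rel_def square_integrable_scale)

lift_definition inner_l2 :: "l2 \<Rightarrow> l2 \<Rightarrow> real" is "\<lambda>f g. LINT x|lborel. f x * g x"
proof -
  fix f f' g g' :: "real \<Rightarrow> real"
  assume "l2_rel f f'" "l2_rel g g'"
  then show "(LINT x|lborel. f x * g x) = (LINT x|lborel. f' x * g' x)"
    by (intro integral_cong_AE) (auto simp: l2_rel_def square_integrable_def)
qed

definition norm_l2 :: "l2 \<Rightarrow> real" where "norm_l2 f = sqrt (inner f f)"
definition dist_l2 :: "l2 \<Rightarrow> l2 \<Rightarrow> real" where "dist_l2 f g = norm (minus f g)"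
definition sgn_l2 :: "l2 \<Rightarrow> l2" where "sgn_l2 f = scaleR (inverse (norm f)) f"
definition uniformity_l2 :: "(l2 \<times> l2) filter" where
  "uniformity_l2 = (INF e\<in>{0<..}. principal {(x, y). dist x y < e})"
definition open_l2 :: "l2 set \<Rightarrow> bool" where
  "open_l2 U \<longleftrightarrow> (\<forall>x\<in>U. \<forall>\<^sub>F (x', y) in uniformity. x' = x \<longrightarrow> y \<in> U)"

instance
proof
  fix f g h :: l2 and a b :: real
  show "f + g + h = f + (g + h)"
    by transfer (simp add: l2_rel_def square_integrable_add add.assoc)
  show "f + g = g + f"
    by transfer (simp add: l2_rel_def square_integrable_add add.commute)
  show "0 + f = f"
    by transfer (simp add: l2_rel_def)
  show "- f + f = 0"
    by transfer (simp add: l2_rel_def square_integrable_zero)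
  show "f - g = f + - g"
    by transfer (simp add: l2_rel_def square_integrable_diff)
  show "a *\<^sub>R (f + g) = a *\<^sub>R f + a *\<^sub>R g"
    by transfer (simp add: l2_rel_def distrib_left square_integrable_add square_integrable_scale)
  show "(a + b) *\<^sub>R f = a *\<^sub>R f + b *\<^sub>R f"
    by transfer (simp add: l2_rel_def distrib_right square_integrable_add square_integrable_scale)
  show "a *\<^sub>R b *\<^sub>R f = (a * b) *\<^sub>R f"
    by transfer (simp add: l2_rel_def mult.assoc square_integrable_scale)
  show "1 *\<^sub>R f = f"
    by transfer (simp add: l2_rel_def)
  show "dist f g = norm (f - g)" by (simp add: dist_l2_def)
  show "sgn f = scaleR (inverse (norm f)) f" by (simp add: sgn_l2_def)
  show "(uniformity :: (l2 \<times> l2) filter) = (INF e\<in>{0<..}. principal {(x, y). dist x y < e})"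
    by (simp add: uniformity_l2_def)
  show "open U = (\<forall>x\<in>U. \<forall>\<^sub>F (x', y) in uniformity. x' = x \<longrightarrow> y \<in> U)" for U :: "l2 set"
    by (simp add: open_l2_def)
  show "inner f g = inner g f"
    by transfer (simp add: mult.commute)
  show "inner (f + g) h = inner f h + inner g h"
    by transfer (simp add: l2_rel_def distrib_right square_integrable_mult_integrable)
  show "inner (a *\<^sub>R f) g = a * inner f g"
    by transfer (simp add: mult.assoc)
  show "0 \<le> inner f f"
    by transfer simp
  show "inner f f = 0 \<longleftrightarrow> f = 0"
  proof transfer
    fix f :: "real \<Rightarrow> real" assume "l2_rel f f"
    then have f: "square_integrable f" by (simp add: l2_rel_def)
    then have "(LINT x|lborel. (f x)\<^sup>2) = 0 \<longleftrightarrow> (AE x in lborel. (f x)\<^sup>2 = 0)"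
      by (intro integral_nonneg_eq_0_iff_AE) (auto simp: square_integrable_def)
    then show "((LINT x|lborel. f x * f x) = 0) = l2_rel f (\<lambda>x. 0)"
      using f by (simp add: l2_rel_def square_integrable_zero power2_eq_square)
  qed
  show "norm f = sqrt (inner f f)" by (simp add: norm_l2_def)
qed

end

text \<open>
  The class of a function, and a Borel representative of a class.  A function that is not
  square-integrable is sent to \<open>0\<close>.
\<close>

definition to_l2 :: "(real \<Rightarrow> real) \<Rightarrow> l2" where
  "to_l2 f = (if square_integrable f then abs_l2 f else 0)"

definition l2_fun :: "l2 \<Rightarrow> real \<Rightarrow> real" where
  "l2_fun f = rep_l2 f"

lemma square_integrable_l2_fun [simp]: "square_integrable (l2_fun f)"
  using Quotient_rep_reflp[OF Quotient_l2, of f] by (simp add: l2_fun_def l2_rel_def)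

lemma l2_fun_measurable [measurable]: "l2_fun f \<in> borel_measurable borel"
  using square_integrable_l2_fun[of f] unfolding square_integrable_def by blast

lemma to_l2_l2_fun [simp]: "to_l2 (l2_fun f) = f"
proof -
  have "to_l2 (l2_fun f) = abs_l2 (l2_fun f)" by (simp add: to_l2_def)
  then show ?thesis
    using Quotient_abs_rep[OF Quotient_l2, of f] by (simp add: l2_fun_def)
qed

lemma to_l2_eq_iff:
  assumes "square_integrable f" "square_integrable g"
  shows "to_l2 f = to_l2 g \<longleftrightarrow> (AE x in lborel. f x = g x)"
  using Quotient_rel[OF Quotient_l2, of f g] assms
  by (simp add: to_l2_def l2_rel_def)

lemma l2_fun_to_l2:
  assumes "square_integrable f"
  shows "AE x in lborel. l2_fun (to_l2 f) x = f x"
  using to_l2_eq_iff[OF square_integrable_l2_fun assms, of "to_l2 f"] by simp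

lemma zero_eq_to_l2: "0 = to_l2 (\<lambda>x. 0)"
  by (simp add: to_l2_def square_integrable_zero zero_l2.abs_eq)

lemma to_l2_add:
  "square_integrable f \<Longrightarrow> square_integrable g \<Longrightarrow> to_l2 f + to_l2 g = to_l2 (\<lambda>x. f x + g x)"
  by (simp add: to_l2_def square_integrable_add plus_l2.abs_eq l2_rel_def)

lemma to_l2_diff:
  "square_integrable f \<Longrightarrow> square_integrable g \<Longrightarrow> to_l2 f - to_l2 g = to_l2 (\<lambda>x. f x - g x)"
  by (simp add: to_l2_def square_integrable_diff minus_l2.abs_eq l2_rel_def)

lemma to_l2_scale:
  "square_integrable f \<Longrightarrow> c *\<^sub>R to_l2 f = to_l2 (\<lambda>x. c * f x)"
  by (simp add: to_l2_def square_integrable_scale scaleR_l2.abs_eq l2_rel_def)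

lemma inner_to_l2:
  "square_integrable f \<Longrightarrow> square_integrable g \<Longrightarrow>
    inner (to_l2 f) (to_l2 g) = (LINT x|lborel. f x * g x)"
  by (simp add: to_l2_def inner_l2.abs_eq l2_rel_def)

lemma norm_to_l2:
  "square_integrable f \<Longrightarrow> (norm (to_l2 f))\<^sup>2 = (LINT x|lborel. (f x)\<^sup>2)"
  unfolding power2_norm_eq_inner by (simp add: inner_to_l2 power2_eq_square)

lemma inner_l2_fun: "inner f g = (LINT x|lborel. l2_fun f x * l2_fun g x)"
  using inner_to_l2[of "l2_fun f" "l2_fun g"] by simp

lemma norm_l2_fun: "(norm f)\<^sup>2 = (LINT x|lborel. (l2_fun f x)\<^sup>2)"
  using norm_to_l2[of "l2_fun f"] by simp

lemma dist_l2_fun: "(dist f g)\<^sup>2 = (LINT x|lborel. (l2_fun f x - l2_fun g x)\<^sup>2)"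
  using to_l2_diff[of "l2_fun f" "l2_fun g"]
    norm_to_l2[OF square_integrable_diff, of "l2_fun f" "l2_fun g"]
  by (simp add: dist_norm)

subsection \<open>Completeness and separability\<close>

lemma dist_l2_nn:
  "(\<integral>\<^sup>+x. ennreal ((l2_fun f x - l2_fun g x)\<^sup>2) \<partial>lborel) = ennreal ((dist f g)\<^sup>2)"
proof -
  have "square_integrable (\<lambda>x. l2_fun f x - l2_fun g x)"
    by (intro square_integrable_diff) simp_all
  then show ?thesis
    unfolding dist_l2_fun square_integrable_def by (intro nn_integral_eq_integral) auto
qed

instance l2 :: banach
proof
  fix X :: "nat \<Rightarrow> l2" assume X: "Cauchy X"
  have "\<exists>r. strict_mono r \<and> (\<forall>k. dist (X (r k)) (X (r (Suc k))) \<le> (1/2)^k)"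
  proof -
    have "\<exists>N. \<forall>m\<ge>N. \<forall>n\<ge>N. dist (X m) (X n) < (1/2)^k" for k :: nat
      using metric_CauchyD[OF X, of "(1/2)^k"] by auto
    then obtain N where N: "\<And>k m n. m \<ge> N k \<Longrightarrow> n \<ge> N k \<Longrightarrow> dist (X m) (X n) < (1/2)^k"
      by metis
    define r where "r k = (\<Sum>i\<le>k. Suc (N i))" for k
    have "strict_mono r"
      unfolding strict_mono_Suc_iff by (simp add: r_def)
    moreover have "N k \<le> r k" for k
    proof -
      have "Suc (N k) \<le> r k"
        unfolding r_def by (rule member_le_sum) auto
      then show ?thesis by simp
    qed
    moreover have "r k \<le> r (Suc k)" for k by (simp add: r_def)
    ultimately show ?thesis
      by (intro exI[of _ r]) (meson N less_imp_le order_trans)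
  qed
  then obtain r where r: "strict_mono r" "\<And>k. dist (X (r k)) (X (r (Suc k))) \<le> (1/2)^k"
    by blast
  define F where "F k = l2_fun (X (r k))" for k
  have [measurable]: "F k \<in> borel_measurable borel" for k by (simp add: F_def)
  have "(\<integral>\<^sup>+x. (\<Sum>k. ennreal (2^k * (F k x - F (Suc k) x)\<^sup>2)) \<partial>lborel)
      = (\<Sum>k. \<integral>\<^sup>+x. ennreal (2^k * (F k x - F (Suc k) x)\<^sup>2) \<partial>lborel)"
    by (rule nn_integral_suminf) simp
  also have "\<dots> \<le> (\<Sum>k. ennreal ((1/2)^k))"
  proof (rule suminf_le)
    fix k
    have "(\<integral>\<^sup>+x. ennreal (2^k * (F k x - F (Suc k) x)\<^sup>2) \<partial>lborel)
        = ennreal (2^k) * ennreal ((dist (X (r k)) (X (r (Suc k))))\<^sup>2)"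
      by (simp add: ennreal_mult nn_integral_cmult F_def dist_l2_nn)
    also have "\<dots> = ennreal (2^k * (dist (X (r k)) (X (r (Suc k))))\<^sup>2)"
      by (simp add: ennreal_mult)
    also have "\<dots> \<le> ennreal (2^k * ((1/2)^k)\<^sup>2)"
      by (intro ennreal_leI mult_left_mono power_mono r) auto
    also have "2^k * ((1/2)^k)\<^sup>2 = ((1/2)^k :: real)"
      by (simp add: power2_eq_square power_one_over field_simps)
    finally show "(\<integral>\<^sup>+x. ennreal (2^k * (F k x - F (Suc k) x)\<^sup>2) \<partial>lborel) \<le> ennreal ((1/2)^k)" .
  qed auto
  also have "\<dots> < \<infinity>"
  proof -
    have "(\<Sum>k. ennreal ((1/2)^k)) = ennreal (\<Sum>k. (1/2)^k)"
      by (intro suminf_ennreal2) (auto intro: summable_geometric)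
    then show ?thesis by simp
  qed
  finally have "AE x in lborel. (\<Sum>k. ennreal (2^k * (F k x - F (Suc k) x)\<^sup>2)) \<noteq> \<infinity>"
    by (intro nn_integral_PInf_AE) auto
  then have conv: "AE x in lborel. convergent (\<lambda>k. F k x)"
  proof eventually_elim
    fix x assume "(\<Sum>k. ennreal (2^k * (F k x - F (Suc k) x)\<^sup>2)) \<noteq> \<infinity>"
    then have s: "summable (\<lambda>k. 2^k * (F k x - F (Suc k) x)\<^sup>2)"
      by (intro summable_suminf_not_top) auto
    have "summable (\<lambda>k. (1/2)^k + 2^k * (F k x - F (Suc k) x)\<^sup>2)"
      by (intro summable_add s) (auto intro: summable_geometric)
    then have "summable (\<lambda>k. F (Suc k) x - F k x)"
    proof (rule summable_comparison_test')
      fix k :: nat assume "k \<ge> 0"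
      let ?d = "\<bar>F k x - F (Suc k) x\<bar>"
      have "0 \<le> 2^k * ((1/2)^k - ?d)\<^sup>2" by simp
      also have "\<dots> = (1/2)^k - 2 * ?d + 2^k * ?d\<^sup>2"
        by (simp add: power2_diff power2_eq_square power_one_over field_simps)
      finally have "2 * ?d \<le> (1/2)^k + 2^k * (F k x - F (Suc k) x)\<^sup>2" by simp
      moreover have "norm (F (Suc k) x - F k x) = ?d" by (simp add: abs_minus_commute)
      moreover have "0 \<le> ?d" by simp
      moreover have "?d \<le> 2 * ?d" by simp
      ultimately show "norm (F (Suc k) x - F k x) \<le> (1/2)^k + 2^k * (F k x - F (Suc k) x)\<^sup>2"
        by (metis order_trans)
    qed
    then have "summable (\<lambda>k. F (Suc k) x - F k x)" .
    then have "(\<lambda>n. \<Sum>k<n. F (Suc k) x - F k x) \<longlonglongrightarrow> (\<Sum>k. F (Suc k) x - F k x)"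
      by (rule summable_LIMSEQ)
    then have "(\<lambda>n. (F n x - F 0 x) + F 0 x) \<longlonglongrightarrow> (\<Sum>k. F (Suc k) x - F k x) + F 0 x"
      using sum_lessThan_telescope[of "\<lambda>k. F k x"] by (intro tendsto_add tendsto_const) simp
    then show "convergent (\<lambda>k. F k x)"
      by (auto simp: convergent_def)
  qed
  define f where "f x = lim (\<lambda>k. F k x)" for x
  have [measurable]: "f \<in> borel_measurable borel"
    unfolding f_def[abs_def] by (rule borel_measurable_lim_metric) simp
  have F_f: "AE x in lborel. (\<lambda>k. F k x) \<longlonglongrightarrow> f x"
    using conv by eventually_elim (simp add: f_def convergent_LIMSEQ_iff)
  have fatou: "(\<integral>\<^sup>+x. ennreal ((f x - l2_fun (X n) x)\<^sup>2) \<partial>lborel) \<le> ennreal (e\<^sup>2)"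
    if e: "e > 0" and N: "\<And>m. m \<ge> N \<Longrightarrow> dist (X m) (X n) \<le> e" for e N n
  proof -
    have "(\<integral>\<^sup>+x. ennreal ((f x - l2_fun (X n) x)\<^sup>2) \<partial>lborel)
        = (\<integral>\<^sup>+x. liminf (\<lambda>k. ennreal ((F k x - l2_fun (X n) x)\<^sup>2)) \<partial>lborel)"
    proof (rule nn_integral_cong_AE)
      show "AE x in lborel. ennreal ((f x - l2_fun (X n) x)\<^sup>2)
          = liminf (\<lambda>k. ennreal ((F k x - l2_fun (X n) x)\<^sup>2))"
        using F_f
      proof eventually_elim
        fix x assume "(\<lambda>k. F k x) \<longlonglongrightarrow> f x"
        then have "(\<lambda>k. ennreal ((F k x - l2_fun (X n) x)\<^sup>2))
            \<longlonglongrightarrow> ennreal ((f x - l2_fun (X n) x)\<^sup>2)"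
          by (intro tendsto_ennrealI tendsto_intros)
        then show "ennreal ((f x - l2_fun (X n) x)\<^sup>2)
            = liminf (\<lambda>k. ennreal ((F k x - l2_fun (X n) x)\<^sup>2))"
          using lim_imp_Liminf[OF sequentially_bot] by metis
      qed
    qed
    also have "\<dots> \<le> liminf (\<lambda>k. \<integral>\<^sup>+x. ennreal ((F k x - l2_fun (X n) x)\<^sup>2) \<partial>lborel)"
      by (rule nn_integral_liminf) simp
    also have "\<dots> = liminf (\<lambda>k. ennreal ((dist (X (r k)) (X n))\<^sup>2))"
      by (simp add: F_def dist_l2_nn)
    also have "\<dots> \<le> ennreal (e\<^sup>2)"
    proof (rule order_trans[OF Liminf_mono])
      show "\<forall>\<^sub>F k in sequentially. ennreal ((dist (X (r k)) (X n))\<^sup>2) \<le> ennreal (e\<^sup>2)"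
      proof (rule eventually_sequentiallyI[of N])
        fix k assume "k \<ge> N"
        then have "r k \<ge> N" using seq_suble[OF r(1), of k] by simp
        then show "ennreal ((dist (X (r k)) (X n))\<^sup>2) \<le> ennreal (e\<^sup>2)"
          by (intro ennreal_leI power_mono N) auto
      qed
      show "liminf (\<lambda>k. ennreal (e\<^sup>2)) \<le> ennreal (e\<^sup>2)"
        by (simp add: Liminf_const)
    qed
    finally show ?thesis .
  qed
  have cau: "\<exists>N. \<forall>m\<ge>N. \<forall>n\<ge>N. dist (X m) (X n) \<le> e" if "e > 0" for e
    using metric_CauchyD[OF X that] by (meson less_imp_le)
  have f: "square_integrable f"
  proof -
    obtain N where N: "\<forall>m\<ge>N. \<forall>n\<ge>N. dist (X m) (X n) \<le> 1" using cau[of 1] by auto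
    then have "(\<integral>\<^sup>+x. ennreal ((f x - l2_fun (X N) x)\<^sup>2) \<partial>lborel) \<le> ennreal (1\<^sup>2)"
      by (intro fatou[of 1 N]) auto
    then have "(\<integral>\<^sup>+x. ennreal ((f x - l2_fun (X N) x)\<^sup>2) \<partial>lborel) < \<infinity>"
      by (rule le_less_trans) simp
    then have "square_integrable (\<lambda>x. f x - l2_fun (X N) x)"
      unfolding square_integrable_def by (auto simp: integrable_iff_bounded)
    from square_integrable_add[OF this square_integrable_l2_fun[of "X N"]]
    show ?thesis by simp
  qed
  have "X \<longlonglongrightarrow> to_l2 f"
  proof (rule metric_LIMSEQ_I)
    fix e :: real assume "e > 0"
    then obtain N where N: "\<forall>m\<ge>N. \<forall>n\<ge>N. dist (X m) (X n) \<le> e/2" using cau[of "e/2"] by auto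
    show "\<exists>N. \<forall>n\<ge>N. dist (X n) (to_l2 f) < e"
    proof (intro exI allI impI)
      fix n assume n: "n \<ge> N"
      have "ennreal ((dist (to_l2 f) (X n))\<^sup>2)
          = (\<integral>\<^sup>+x. ennreal ((l2_fun (to_l2 f) x - l2_fun (X n) x)\<^sup>2) \<partial>lborel)"
        by (simp add: dist_l2_nn)
      also have "\<dots> = (\<integral>\<^sup>+x. ennreal ((f x - l2_fun (X n) x)\<^sup>2) \<partial>lborel)"
        using l2_fun_to_l2[OF f] by (intro nn_integral_cong_AE) auto
      also have "\<dots> \<le> ennreal ((e/2)\<^sup>2)"
        using \<open>e > 0\<close> N n by (intro fatou[of _ N]) auto
      finally have "(dist (to_l2 f) (X n))\<^sup>2 \<le> (e/2)\<^sup>2"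
        by (subst (asm) ennreal_le_iff) (rule zero_le_power2)
      then have "dist (to_l2 f) (X n) \<le> e/2"
        by (rule power2_le_imp_le) (use \<open>e > 0\<close> in simp)
      then show "dist (X n) (to_l2 f) < e"
        using \<open>e > 0\<close> by (simp add: dist_commute)
    qed
  qed
  then show "convergent X" by (auto simp: convergent_def)
qed

lemma to_l2_dominated_convergence:
  assumes f: "\<And>n. f n \<in> borel_measurable borel" "g \<in> borel_measurable borel"
    and h: "square_integrable h" "\<And>n x. \<bar>f n x\<bar> \<le> h x"
    and lim: "\<And>x. (\<lambda>n. f n x) \<longlonglongrightarrow> g x"
  shows "(\<lambda>n. to_l2 (f n)) \<longlonglongrightarrow> to_l2 g"
proof -
  have h0: "\<bar>h x\<bar> = h x" for x using h(2)[of 0 x] by simp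
  have sf: "square_integrable (f n)" for n
    by (rule square_integrable_bound[OF h(1) f(1)]) (simp add: h0 h)
  have gh: "\<bar>g x\<bar> \<le> h x" for x
    by (rule LIMSEQ_le_const2[OF tendsto_rabs[OF lim]]) (auto intro: h)
  have sg: "square_integrable g"
    by (rule square_integrable_bound[OF h(1) f(2)]) (simp add: h0 gh)
  have "(\<lambda>n. LINT x|lborel. (f n x - g x)\<^sup>2) \<longlonglongrightarrow> (LINT x::real|lborel. (0::real))"
  proof (rule integral_dominated_convergence[where w = "\<lambda>x. 4 * (h x)\<^sup>2"
        and s = "\<lambda>n x. (f n x - g x)\<^sup>2" and f = "\<lambda>x. 0"])
    show "integrable lborel (\<lambda>x. 4 * (h x)\<^sup>2)"
      using h(1) by (simp add: square_integrable_def)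
    show "AE x in lborel. (\<lambda>n. (f n x - g x)\<^sup>2) \<longlonglongrightarrow> 0"
    proof (rule AE_I2)
      fix x
      have "(\<lambda>n. (f n x - g x)\<^sup>2) \<longlonglongrightarrow> (g x - g x)\<^sup>2" by (intro tendsto_intros lim)
      then show "(\<lambda>n. (f n x - g x)\<^sup>2) \<longlonglongrightarrow> 0" by simp
    qed
    show "AE x in lborel. norm ((f n x - g x)\<^sup>2) \<le> 4 * (h x)\<^sup>2" for n
    proof (rule AE_I2)
      fix x
      have "\<bar>f n x - g x\<bar> \<le> \<bar>2 * h x\<bar>" using h(2)[of n x] gh[of x] by simp
      then have "(f n x - g x)\<^sup>2 \<le> (2 * h x)\<^sup>2" by (simp only: abs_le_square_iff)
      then show "norm ((f n x - g x)\<^sup>2) \<le> 4 * (h x)\<^sup>2" by (simp add: power_mult_distrib)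
    qed
  qed (use f in auto)
  then have "(\<lambda>n. (norm (to_l2 (f n) - to_l2 g))\<^sup>2) \<longlonglongrightarrow> 0"
    by (simp add: to_l2_diff sf sg norm_to_l2 square_integrable_diff)
  then have "(\<lambda>n. sqrt ((norm (to_l2 (f n) - to_l2 g))\<^sup>2)) \<longlonglongrightarrow> sqrt 0"
    by (rule tendsto_real_sqrt)
  then have "(\<lambda>n. norm (to_l2 (f n) - to_l2 g)) \<longlonglongrightarrow> 0" by simp
  then have "(\<lambda>n. to_l2 (f n) - to_l2 g) \<longlonglongrightarrow> 0" by (rule tendsto_norm_zero_cancel)
  then show ?thesis by (rule LIM_zero_cancel)
qed

lemma l2_separable: "\<exists>D :: l2 set. countable D \<and> closure D = UNIV"
proof -
  define G :: "rat \<times> rat \<times> rat \<Rightarrow> l2" where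
    "G = (\<lambda>(c, a, b). to_l2 (\<lambda>x. real_of_rat c * indicator {real_of_rat a<..real_of_rat b} x))"
  define D where "D = range (\<lambda>xs. sum_list (map G xs))"
  define C where "C = closure D"
  have sq_I: "square_integrable (\<lambda>x. c * indicator {a<..b} x)" for a b c :: real
  proof -
    have "(\<lambda>x. (c * indicator {a<..b} x)\<^sup>2) = (\<lambda>x. c\<^sup>2 * indicator {a<..b} x)"
      by (auto simp: indicator_def)
    moreover have "emeasure lborel {a<..b} < \<infinity>"
      by (cases "a \<le> b") auto
    then have "integrable lborel (\<lambda>x. c\<^sup>2 * indicator {a<..b} x)"
      using integrable_real_indicator[of "{a<..b}" lborel] by (intro integrable_mult_right) simp
    ultimately show ?thesis by (simp add: square_integrable_def)
  qed
  have sq_ind: "square_integrable (indicator A)" if "A \<in> sets borel" "A \<subseteq> {a<..b}" for A and a b :: real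
    by (rule square_integrable_bound[OF sq_I[of 1 a b]]) (use that in \<open>auto simp: indicator_def\<close>)
  have C_lim: "x \<in> C" if "\<And>n. u n \<in> C" "u \<longlonglongrightarrow> x" for u x
    using closed_sequentially[of C u x] that by (simp add: C_def)
  have D_add: "x + y \<in> D" if xy: "x \<in> D" "y \<in> D" for x y
  proof -
    obtain xs ys where "x = sum_list (map G xs)" "y = sum_list (map G ys)"
      using xy unfolding D_def by blast
    then have "x + y = sum_list (map G (xs @ ys))" by simp
    then show ?thesis unfolding D_def by blast
  qed
  have D_scale: "real_of_rat q *\<^sub>R x \<in> D" if x: "x \<in> D" for q x
  proof -
    obtain xs where xs: "x = sum_list (map G xs)" using x unfolding D_def by blast
    have G: "real_of_rat q *\<^sub>R G t = G ((\<lambda>(c, a, b). (q * c, a, b)) t)" for t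
      by (cases t) (simp add: G_def to_l2_scale sq_I of_rat_mult mult.assoc)
    have "real_of_rat q *\<^sub>R x = sum_list (map G (map (\<lambda>(c, a, b). (q * c, a, b)) xs))"
      unfolding xs by (induction xs) (simp_all add: scaleR_add_right G)
    then show ?thesis unfolding D_def by blast
  qed
  have C_add: "x + y \<in> C" if xy: "x \<in> C" "y \<in> C" for x y
  proof -
    obtain u v where uv: "\<And>n. u n \<in> D" "u \<longlonglongrightarrow> x" "\<And>n. v n \<in> D" "v \<longlonglongrightarrow> y"
      using xy unfolding C_def closure_sequential by blast
    have "(\<lambda>n. u n + v n) \<longlonglongrightarrow> x + y" by (intro tendsto_add uv)
    then show ?thesis
      unfolding C_def closure_sequential using D_add uv by (intro exI[of _ "\<lambda>n. u n + v n"]) auto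
  qed
  have C_scale: "c *\<^sub>R x \<in> C" if x: "x \<in> C" for c x
  proof -
    obtain u where u: "\<And>n. u n \<in> D" "u \<longlonglongrightarrow> x"
      using x unfolding C_def closure_sequential by blast
    have "\<exists>q. \<bar>real_of_rat q - c\<bar> < inverse (real (Suc n))" for n
    proof -
      obtain q where "c < real_of_rat q" "real_of_rat q < c + inverse (real (Suc n))"
        using of_rat_dense[of c "c + inverse (real (Suc n))"] by auto
      then have "\<bar>real_of_rat q - c\<bar> < inverse (real (Suc n))" by linarith
      then show ?thesis ..
    qed
    then obtain q where q: "\<And>n. \<bar>real_of_rat (q n) - c\<bar> < inverse (real (Suc n))" by metis
    have "(\<lambda>n. real_of_rat (q n) - c) \<longlonglongrightarrow> 0"
      by (rule Lim_null_comparison[OF _ LIMSEQ_inverse_real_of_nat])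
         (use q in \<open>auto intro!: always_eventually less_imp_le\<close>)
    then have "(\<lambda>n. real_of_rat (q n)) \<longlonglongrightarrow> c" by (rule LIM_zero_cancel)
    then have "(\<lambda>n. real_of_rat (q n) *\<^sub>R u n) \<longlonglongrightarrow> c *\<^sub>R x" by (intro tendsto_scaleR u)
    then show ?thesis
      unfolding C_def closure_sequential using D_scale u
      by (intro exI[of _ "\<lambda>n. real_of_rat (q n) *\<^sub>R u n"]) auto
  qed
  have C_diff: "x - y \<in> C" if "x \<in> C" "y \<in> C" for x y
    using C_add[OF that(1) C_scale[OF that(2), of "-1"]] by simp
  have "0 = sum_list (map G [])" by simp
  then have "0 \<in> D" unfolding D_def by blast
  then have C_0: "0 \<in> C" using closure_subset by (auto simp: C_def)
  have C_interval: "to_l2 (indicator {- real n<..b}) \<in> C" for n b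
  proof -
    have "\<exists>q. b < real_of_rat q \<and> real_of_rat q < b + inverse (real (Suc k))" for k
      using of_rat_dense[of b "b + inverse (real (Suc k))"] by simp
    then obtain q where q: "\<And>k. b < real_of_rat (q k)"
      "\<And>k. real_of_rat (q k) < b + inverse (real (Suc k))" by metis
    show ?thesis
    proof (rule C_lim[of "\<lambda>k. to_l2 (indicator {- real n<..real_of_rat (q k)})"])
      fix k
      have "to_l2 (indicator {- real n<..real_of_rat (q k)}) = sum_list (map G [(1, - of_nat n, q k)])"
        by (simp add: G_def of_rat_minus)
      then have "to_l2 (indicator {- real n<..real_of_rat (q k)}) \<in> D" unfolding D_def by blast
      then show "to_l2 (indicator {- real n<..real_of_rat (q k)}) \<in> C"
        using closure_subset by (auto simp: C_def)
    next
      show "(\<lambda>k. to_l2 (indicator {- real n<..real_of_rat (q k)})) \<longlonglongrightarrow> to_l2 (indicator {- real n<..b})"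
      proof (rule to_l2_dominated_convergence)
        show "square_integrable (indicator {- real n<..b + 1})" by (rule sq_ind) auto
        show "\<bar>indicator {- real n<..real_of_rat (q k)} x :: real\<bar> \<le> indicator {- real n<..b + 1} x" for k x
        proof -
          have "inverse (real (Suc k)) \<le> 1" by (simp add: field_simps)
          then have "real_of_rat (q k) \<le> b + 1" using q(2)[of k] by linarith
          then show ?thesis by (auto simp: indicator_def)
        qed
        fix x
        show "(\<lambda>k. indicator {- real n<..real_of_rat (q k)} x :: real) \<longlonglongrightarrow> indicator {- real n<..b} x"
        proof (cases "x \<le> b")
          case True
          then have "indicator {- real n<..real_of_rat (q k)} x = (indicator {- real n<..b} x :: real)" for k
            using q(1)[of k] by (auto simp: indicator_def)
          then show ?thesis by simp
        next
          case False
          then have "0 < x - b" by simp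
          then obtain K where K: "inverse (real (Suc K)) < x - b" using reals_Archimedean by blast
          have "\<forall>\<^sub>F k in sequentially. (indicator {- real n<..b} x :: real) = indicator {- real n<..real_of_rat (q k)} x"
          proof (rule eventually_sequentiallyI[of K])
            fix k assume "k \<ge> K"
            then have "inverse (real (Suc k)) \<le> inverse (real (Suc K))" by simp
            then have "real_of_rat (q k) < x" using K q(2)[of k] by linarith
            then show "(indicator {- real n<..b} x :: real) = indicator {- real n<..real_of_rat (q k)} x"
              using False by simp
          qed
          then show ?thesis by (rule Lim_transform_eventually[rotated]) simp
        qed
      qed auto
    qed
  qed
  have C_borel: "to_l2 (indicator (A \<inter> {- real n<..real n})) \<in> C" if "A \<in> sets borel" for A n
  proof -
    let ?I = "{- real n<..real n}"
    have borel: "sets borel = sigma_sets UNIV (range (\<lambda>a::real. {..a}))"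
      by (subst borel_eq_atMost) (simp add: sets_measure_of)
    have "Int_stable (range (\<lambda>a::real. {..a}))"
      by (auto simp: Int_stable_def)
    moreover have "range (\<lambda>a::real. {..a}) \<subseteq> Pow UNIV" by simp
    moreover have "A \<in> sigma_sets UNIV (range (\<lambda>a::real. {..a}))" using that borel by simp
    ultimately show ?thesis
    proof (induction rule: sigma_sets_induct_disjoint)
      case (basic A)
      then obtain a where "A = {..a}" by auto
      then have "A \<inter> ?I = {- real n<..min a (real n)}" by auto
      then show ?case by (simp add: C_interval)
    next
      case empty
      then show ?case using C_0 by (simp add: zero_eq_to_l2)
    next
      case (compl A)
      then have A: "A \<in> sets borel" by (simp add: borel)
      have "to_l2 (indicator ((UNIV - A) \<inter> ?I)) = to_l2 (\<lambda>x. indicator ?I x - indicator (A \<inter> ?I) x)"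
        by (rule arg_cong[of _ _ to_l2]) (auto simp: indicator_def)
      also have "\<dots> = to_l2 (indicator ?I) - to_l2 (indicator (A \<inter> ?I))"
        by (intro to_l2_diff[symmetric] sq_ind[of _ "- real n" "real n"]) (use A in auto)
      also have "\<dots> \<in> C" by (intro C_diff compl C_interval)
      finally show ?case .
    next
      case (union A)
      then have A: "A i \<in> sets borel" for i by (auto simp: borel)
      have part: "to_l2 (indicator ((\<Union>i<m. A i) \<inter> ?I)) \<in> C" for m
      proof (induction m)
        case 0
        then show ?case using C_0 by (simp add: zero_eq_to_l2)
      next
        case (Suc m)
        have "A m \<inter> (\<Union>i<m. A i) = {}"
        proof -
          have "A m \<inter> A i = {}" if "i < m" for i
            using disjoint_family_onD[OF union(1), of m i] that by simp
          then show ?thesis by blast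
        qed
        then have "to_l2 (indicator ((\<Union>i<Suc m. A i) \<inter> ?I))
            = to_l2 (\<lambda>x. indicator ((\<Union>i<m. A i) \<inter> ?I) x + indicator (A m \<inter> ?I) x)"
          by (intro arg_cong[of _ _ to_l2] ext) (auto simp: indicator_def lessThan_Suc)
        also have "\<dots> = to_l2 (indicator ((\<Union>i<m. A i) \<inter> ?I)) + to_l2 (indicator (A m \<inter> ?I))"
          by (intro to_l2_add[symmetric] sq_ind[of _ "- real n" "real n"]) (use A in auto)
        also have "\<dots> \<in> C" by (intro C_add Suc union)
        finally show ?case .
      qed
      show ?case
      proof (rule C_lim[OF part])
        show "(\<lambda>m. to_l2 (indicator ((\<Union>i<m. A i) \<inter> ?I))) \<longlonglongrightarrow> to_l2 (indicator (\<Union> (range A) \<inter> ?I))"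
        proof (rule to_l2_dominated_convergence)
          show "square_integrable (indicator ?I)" by (rule sq_ind) auto
          show "\<bar>indicator ((\<Union>i<m. A i) \<inter> ?I) x :: real\<bar> \<le> indicator ?I x" for m x
            by (auto simp: indicator_def)
          show "(\<lambda>m. indicator ((\<Union>i<m. A i) \<inter> ?I) x :: real) \<longlonglongrightarrow> indicator (\<Union> (range A) \<inter> ?I) x" for x
            unfolding indicator_inter_arith by (intro tendsto_mult tendsto_const LIMSEQ_indicator_UN)
        qed (use A in auto)
      qed
    qed
  qed
  have C_nonneg: "square_integrable f \<Longrightarrow> to_l2 f \<in> C"
    if "f \<in> borel_measurable borel" "\<And>x. 0 \<le> f x" for f
    using that
  proof (induction rule: borel_measurable_induct_real)
    case (set A)
    show ?case
    proof (rule C_lim[OF C_borel[OF set(1)]])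
      show "(\<lambda>n. to_l2 (indicator (A \<inter> {- real n<..real n}))) \<longlonglongrightarrow> to_l2 (indicator A)"
      proof (rule to_l2_dominated_convergence[OF _ _ set(2)])
        show "\<bar>indicator (A \<inter> {- real n<..real n}) x :: real\<bar> \<le> indicator A x" for n x
          by (auto simp: indicator_def)
        fix x
        obtain N :: nat where N: "\<bar>x\<bar> < real N" using reals_Archimedean2 by blast
        have "\<forall>\<^sub>F n in sequentially. (indicator A x :: real) = indicator (A \<inter> {- real n<..real n}) x"
          by (rule eventually_sequentiallyI[of N]) (use N in \<open>auto simp: indicator_def\<close>)
        then show "(\<lambda>n. indicator (A \<inter> {- real n<..real n}) x :: real) \<longlonglongrightarrow> indicator A x"
          by (rule Lim_transform_eventually[rotated]) simp
      qed (use set(1) in measurable)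
    qed
  next
    case (mult u c)
    show ?case
    proof (cases "c = 0")
      case True
      then show ?thesis using C_0 by (simp add: zero_eq_to_l2)
    next
      case False
      then have "square_integrable u"
        using square_integrable_scale[OF mult(5), of "1/c"] by simp
      then show ?thesis
        using C_scale[OF mult(4), of c] by (simp add: to_l2_scale)
    qed
  next
    case (add u v)
    have bound: "\<bar>u x\<bar> \<le> \<bar>v x + u x\<bar>" "\<bar>v x\<bar> \<le> \<bar>v x + u x\<bar>" for x
      using add(2)[of x] add(4)[of x] by linarith+
    have u: "square_integrable u"
      by (rule square_integrable_bound[OF add(8) add(1) bound(1)])
    have v: "square_integrable v"
      by (rule square_integrable_bound[OF add(8) add(3) bound(2)])
    show ?case
      unfolding to_l2_add[OF v u, symmetric] by (intro C_add add.IH u v)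
  next
    case (seq U)
    have f0: "U n x \<le> f x" for n x
      using incseq_le[of "\<lambda>i. U i x" "f x" n] seq(3,4) by (simp add: incseq_def le_fun_def)
    have U: "square_integrable (U n)" for n
    proof (rule square_integrable_bound[OF seq(6) seq(1)])
      show "\<bar>U n x\<bar> \<le> \<bar>f x\<bar>" for x
        using seq(2)[of n x] f0[of n x] by linarith
    qed
    show ?case
    proof (rule C_lim)
      show "to_l2 (U n) \<in> C" for n by (intro seq U)
      show "(\<lambda>n. to_l2 (U n)) \<longlonglongrightarrow> to_l2 f"
      proof (rule to_l2_dominated_convergence[OF _ _ seq(6)])
        show "\<bar>U n x\<bar> \<le> f x" for n x
          using seq(2)[of n x] f0[of n x] by linarith
        show "(\<lambda>n. U n x) \<longlonglongrightarrow> f x" for x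
          using seq(4) by simp
        show "f \<in> borel_measurable borel"
          by (rule square_integrable_measurable[OF seq(6)])
      qed (rule seq(1))
    qed
  qed
  have "f \<in> C" for f
  proof -
    let ?f = "l2_fun f"
    have p: "square_integrable (\<lambda>x. max 0 (?f x))"
      by (rule square_integrable_bound[OF square_integrable_l2_fun[of f]]) auto
    have m: "square_integrable (\<lambda>x. max 0 (- ?f x))"
      by (rule square_integrable_bound[OF square_integrable_l2_fun[of f]]) auto
    have "?f = (\<lambda>x. max 0 (?f x) - max 0 (- ?f x))"
      by (rule ext) (simp add: max_def)
    from arg_cong[OF this, of to_l2] have "f = to_l2 (\<lambda>x. max 0 (?f x) - max 0 (- ?f x))"
      by (simp only: to_l2_l2_fun)
    also have "\<dots> = to_l2 (\<lambda>x. max 0 (?f x)) - to_l2 (\<lambda>x. max 0 (- ?f x))"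
      by (rule to_l2_diff[OF p m, symmetric])
    also have "\<dots> \<in> C"
      by (intro C_diff C_nonneg p m) auto
    finally show ?thesis .
  qed
  then have "closure D = UNIV" by (auto simp: C_def)
  moreover have "countable D" by (simp add: D_def)
  ultimately show ?thesis by blast
qed

instance l2 :: second_countable_topology
proof
  obtain D :: "l2 set" where D: "countable D" "closure D = UNIV" using l2_separable by blast
  define B where "B = (\<lambda>(d, n). ball d (inverse (real (Suc n)))) ` (D \<times> (UNIV :: nat set))"
  have "topological_basis B"
  proof (rule topological_basisI)
    show "open b" if "b \<in> B" for b using that by (auto simp: B_def)
    fix U :: "l2 set" and x assume U: "open U" "x \<in> U"
    then obtain e where e: "e > 0" "ball x e \<subseteq> U" by (auto simp: open_contains_ball)
    then obtain n where n: "inverse (real (Suc n)) < e / 2"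
      using reals_Archimedean[of "e / 2"] by auto
    have "x \<in> closure D" using D by simp
    then obtain d where d: "d \<in> D" "dist d x < inverse (real (Suc n))"
      unfolding closure_approachable by (metis inverse_positive_iff_positive of_nat_0_less_iff zero_less_Suc)
    have "ball d (inverse (real (Suc n))) \<subseteq> ball x e"
    proof
      fix y assume "y \<in> ball d (inverse (real (Suc n)))"
      then have "dist d y < inverse (real (Suc n))" by simp
      moreover have "dist x y \<le> dist d x + dist d y"
        using dist_triangle2[of x y d] by (simp add: dist_commute)
      ultimately show "y \<in> ball x e" using d n by simp
    qed
    then have "x \<in> ball d (inverse (real (Suc n))) \<and> ball d (inverse (real (Suc n))) \<subseteq> U"
      using d e by auto
    then show "\<exists>B'\<in>B. x \<in> B' \<and> B' \<subseteq> U" using d unfolding B_def by blast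
  qed
  moreover have "countable B" using D by (auto simp: B_def)
  ultimately show "\<exists>B :: l2 set set. countable B \<and> open = generate_topology B"
    using topological_basis_imp_subbasis by blast
qed


section \<open>The fractional derivative and the semigroup it generates\<close>

text \<open>
  \<open>w\<close>-integration is cut off at \<open>\<epsilon>\<close>: for square-integrable \<open>f\<close> and \<open>\<epsilon> > 0\<close> the truncated integral
  converges absolutely for every \<open>t\<close> and is again square-integrable, whereas without the cut-off it
  need not converge.  The Marchaud derivative is the limit for \<open>\<epsilon> \<down> 0\<close> in the \<open>L\<^sup>2\<close>-norm, defined on
  all \<open>f\<close> for which this limit exists; it is given by its graph, since it is unbounded.
\<close>

definition truncated_marchaud :: "real \<Rightarrow> real \<Rightarrow> (real \<Rightarrow> real) \<Rightarrow> real \<Rightarrow> real" where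
  "truncated_marchaud \<alpha> \<epsilon> f t =
     \<alpha> / Gamma (1 - \<alpha>) * (LINT w:{\<epsilon><..}|lborel. (f t - f (t + w)) / w powr (\<alpha> + 1))"

definition has_marchaud_derivative :: "real \<Rightarrow> l2 \<Rightarrow> l2 \<Rightarrow> bool" where
  "has_marchaud_derivative \<alpha> f g \<longleftrightarrow>
     ((\<lambda>\<epsilon>. to_l2 (truncated_marchaud \<alpha> \<epsilon> (l2_fun f))) \<longlongrightarrow> g) (at_right 0)"

text \<open>Only the values \<open>S s\<close> with \<open>s \<ge> 0\<close> matter.\<close>

definition c0_semigroup :: "(real \<Rightarrow> 'a :: real_normed_vector \<Rightarrow>\<^sub>L 'a) \<Rightarrow> bool" where
  "c0_semigroup S \<longleftrightarrow>
     S 0 = id_blinfun \<and>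
     (\<forall>s\<ge>0. \<forall>t\<ge>0. S (s + t) = S s o\<^sub>L S t) \<and>
     (\<forall>f. ((\<lambda>s. blinfun_apply (S s) f) \<longlongrightarrow> f) (at_right 0))"

definition generator_graph :: "(real \<Rightarrow> 'a :: real_normed_vector \<Rightarrow>\<^sub>L 'a) \<Rightarrow> 'a \<Rightarrow> 'a \<Rightarrow> bool" where
  "generator_graph S f g \<longleftrightarrow>
     ((\<lambda>s. (blinfun_apply (S s) f - f) /\<^sub>R s) \<longlongrightarrow> g) (at_right 0)"

text \<open>
  The generator of \<open>S\<close> is \<open>- d\<^sup>\<alpha>/d(-t)\<^sup>\<alpha>\<close>, domains included; this determines \<open>S s\<close> for all \<open>s \<ge> 0\<close>.
\<close>

definition marchaud_semigroup :: "real \<Rightarrow> (real \<Rightarrow> l2 \<Rightarrow>\<^sub>L l2) \<Rightarrow> bool" where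
  "marchaud_semigroup \<alpha> S \<longleftrightarrow>
     c0_semigroup S \<and> (\<forall>f g. generator_graph S f g \<longleftrightarrow> has_marchaud_derivative \<alpha> f (- g))"

text \<open>\<open>(\<mu> + A)\<^bsup>-\<beta>\<^esup>\<close>, where \<open>- A\<close> is the generator of \<open>S\<close>; the integral is a Bochner integral in \<open>L\<^sup>2\<close>.\<close>

definition neg_fractional_power ::
  "(real \<Rightarrow> 'a :: {banach, second_countable_topology} \<Rightarrow>\<^sub>L 'a) \<Rightarrow> real \<Rightarrow> real \<Rightarrow> 'a \<Rightarrow> 'a" where
  "neg_fractional_power S \<mu> \<beta> f =
     (1 / Gamma \<beta>) *\<^sub>R
       (LINT s:{0<..}|lborel. (s powr (\<beta> - 1) * exp (- (s * \<mu>))) *\<^sub>R blinfun_apply (S s) f)"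


section \<open>White noise and generalized processes\<close>

text \<open>The second alternative is the degenerate case of variance \<open>0\<close>.\<close>

definition centered_gaussian :: "'a measure \<Rightarrow> ('a \<Rightarrow> real) \<Rightarrow> bool" where
  "centered_gaussian M X \<longleftrightarrow>
     X \<in> borel_measurable M \<and>
     ((\<exists>\<tau>>0. distributed M lborel X (normal_density 0 \<tau>)) \<or> (AE \<omega> in M. X \<omega> = 0))"

text \<open>
  By linearity, finite linear combinations of the variables \<open>E \<phi>\<close> are again of this form up to null
  sets, so Gaussianity of each \<open>E \<phi>\<close> makes the family jointly Gaussian.
\<close>

definition white_noise :: "'a measure \<Rightarrow> real \<Rightarrow> (l2 \<Rightarrow> 'a \<Rightarrow> real) \<Rightarrow> bool" where
  "white_noise M \<sigma> E \<longleftrightarrow>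
     prob_space M \<and>
     (\<forall>\<phi>. centered_gaussian M (E \<phi>)) \<and>
     (\<forall>a b \<phi> \<psi>. AE \<omega> in M. E (a *\<^sub>R \<phi> + b *\<^sub>R \<psi>) \<omega> = a * E \<phi> \<omega> + b * E \<psi> \<omega>) \<and>
     (\<forall>\<phi> \<psi>. (LINT \<omega>|M. E \<phi> \<omega> * E \<psi> \<omega>) = \<sigma>\<^sup>2 * inner \<phi> \<psi>)"

definition dual_action :: "(l2 \<Rightarrow> l2) \<Rightarrow> (l2 \<Rightarrow> 'a \<Rightarrow> real) \<Rightarrow> l2 \<Rightarrow> 'a \<Rightarrow> real" where
  "dual_action T E \<phi> = E (adjoint T \<phi>)"

definition l2_convolution :: "(real \<Rightarrow> real) \<Rightarrow> l2 \<Rightarrow> l2" where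
  "l2_convolution K \<phi> = to_l2 (\<lambda>x. LINT y|lborel. K y * l2_fun \<phi> (x - y))"

text \<open>The generalized process written \<open>X(t) = \<integral> K(x) E(t + x) dx\<close>, for integrable \<open>K\<close>.\<close>

definition moving_average :: "(real \<Rightarrow> real) \<Rightarrow> (l2 \<Rightarrow> 'a \<Rightarrow> real) \<Rightarrow> l2 \<Rightarrow> 'a \<Rightarrow> real" where
  "moving_average K E \<phi> = E (l2_convolution K \<phi>)"

definition solves_fractional_equation ::
  "real \<Rightarrow> real \<Rightarrow> real \<Rightarrow> (l2 \<Rightarrow> 'a \<Rightarrow> real) \<Rightarrow> (l2 \<Rightarrow> 'a \<Rightarrow> real) \<Rightarrow> bool" where
  "solves_fractional_equation \<alpha> \<beta> \<mu> E X \<longleftrightarrow>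
     (\<exists>S. marchaud_semigroup \<alpha> S \<and> X = dual_action (neg_fractional_power S \<mu> \<beta>) E)"


section \<open>The stable subordinator\<close>

text \<open>
  \<open>h z s\<close> is the density at \<open>z \<ge> 0\<close> of the subordinator at time \<open>s > 0\<close>; at \<open>s = 0\<close> its law is a point
  mass.  The Laplace transform at \<open>\<xi> = 0\<close> (where \<open>0 powr \<alpha> = 0\<close>) gives total mass \<open>1\<close>.  It fixes each
  \<open>h _ s\<close> only up to null sets; joint measurability, which the continuous version has, rules out
  versions that could not be integrated in \<open>s\<close>.
\<close>

definition stable_subordinator_density :: "real \<Rightarrow> (real \<Rightarrow> real \<Rightarrow> real) \<Rightarrow> bool" where
  "stable_subordinator_density \<alpha> h \<longleftrightarrow>
     set_borel_measurable (borel \<Otimes>\<^sub>M borel) ({0..} \<times> {0<..}) (\<lambda>(z, s). h z s) \<and>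
     (\<forall>z\<ge>0. \<forall>s>0. 0 \<le> h z s) \<and>
     (\<forall>s>0. \<forall>\<xi>\<ge>0.
        (LINT z:{0..}|lborel. exp (- (\<xi> * z)) * h z s) = exp (- (s * \<xi> powr \<alpha>)))"

end

theory Submission
  imports Defs
begin

text \<open>
  Write \<open>\<tau>\<^sub>z f = f(\<cdot> + z)\<close>.  Every integrable kernel \<open>k\<close> on the half-line gives a bounded operator
  \<open>\<integral> k(z) \<tau>\<^sub>z dz\<close> on \<open>L\<^sup>2\<close> (\<open>average\<close>), in such a way that convolution of kernels becomes composition
  of operators (\<open>average_kernel_conv\<close>), and the operator depends only on the Laplace transform of \<open>k\<close>
  (\<open>average_eqI_laplace\<close>).  Identities between such operators are therefore identities between
  functions of \<open>\<xi>\<close>, with \<open>\<xi>\<^sup>\<alpha>\<close> standing for the fractional derivative \<open>A\<close>.  The density \<open>h(\<cdot>, s)\<close> has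
  transform \<open>exp (- s \<xi>\<^sup>\<alpha>)\<close>, so its averages form a contraction semigroup, and integrating them against
  the Gamma weight gives \<open>(\<mu> + A)\<^bsup>-\<beta>\<^esup>\<close> as the average with kernel \<open>K\<close>
  (\<open>neg_fractional_power_eq_average\<close>).  The adjoint of that average is convolution with \<open>K\<close>
  (\<open>adjoint_average\<close>), and the action on white noise is by duality; this is the claimed
  representation, provided that the semigroup really is generated by \<open>- A\<close>.

  That the generator is \<open>- A\<close> with exactly the right domain (\<open>generator_iff_marchaud\<close>) is the core
  of the proof.  The Marchaud derivative \<open>A\<^sub>\<epsilon>\<close> truncated at \<open>\<epsilon>\<close> is bounded, with symbol
  \<open>\<psi>\<^sub>\<epsilon>(\<xi>) = \<alpha> / \<Gamma>(1 - \<alpha>) \<integral>\<^sub>\<epsilon>\<^sup>\<infinity> (1 - exp (- \<xi> w)) w\<^bsup>-\<alpha>-1\<^esup> dw\<close>.  The quotient \<open>\<psi>\<^sub>\<epsilon>(\<xi>) / \<xi>\<^sup>\<alpha>\<close> is the transform of an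
  explicit probability density that concentrates at \<open>0\<close> (\<open>laplace_jump_averaging\<close>); let \<open>Q\<^sub>\<epsilon>\<close> be its
  average.  With the resolvent \<open>R = (1 + A)\<^sup>-\<^sup>1\<close>, which has symbol \<open>1 / (1 + \<xi>\<^sup>\<alpha>)\<close>, this says
  \<open>A\<^sub>\<epsilon> R = Q\<^sub>\<epsilon> (1 - R)\<close>, and \<open>Q\<^sub>\<epsilon>\<close> converges strongly to the identity.  Hence \<open>A\<^sub>\<epsilon> f\<close> converges for \<open>f\<close> in
  the range of \<open>R\<close>, and since \<open>R\<close> commutes with \<open>A\<^sub>\<epsilon>\<close>, convergence of \<open>A\<^sub>\<epsilon> f\<close> puts \<open>f\<close> into that range.
\<close>

section \<open>Translations of square-integrable functions\<close>

lemma AE_lborel_translate: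
  fixes z :: real
  assumes "AE x in lborel. P x"
  shows "AE x in lborel. P (x + z)"
proof -
  have "AE x in distr lborel borel ((+) z). P x"
    using assms by (subst lborel_distr_plus)
  then have "AE x in lborel. P (z + x)"
    by (rule AE_distrD[rotated]) simp
  then show ?thesis by (simp add: add.commute)
qed

lemma integrable_lborel_translate:
  fixes f :: "real \<Rightarrow> 'a :: {banach, second_countable_topology}"
  assumes "integrable lborel f"
  shows "integrable lborel (\<lambda>x. f (x + z))"
  using lborel_integrable_real_affine[OF assms, of 1 z] by (simp add: add.commute)

lemma integral_lborel_translate:
  fixes f :: "real \<Rightarrow> 'a :: {banach, second_countable_topology}"
  shows "(LINT x|lborel. f (x + z)) = (LINT x|lborel. f x)"
  using lborel_integral_real_affine[of 1 f z] by (simp add: add.commute)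

text \<open>
  Translations are isometries of \<open>L\<^sup>1\<close>, so translating \<open>f\<close> costs at most what translating \<open>g\<close> costs
  plus \<open>2 \<parallel>g - f\<parallel>\<close>: the functions with continuous translates form a closed set.
\<close>

lemma L1_translation_approximation:
  fixes f :: "real \<Rightarrow> real"
  assumes f: "integrable lborel f"
    and approx: "\<And>e. e > 0 \<Longrightarrow> \<exists>g. integrable lborel g \<and> (LINT t|lborel. \<bar>g t - f t\<bar>) < e \<and>
      ((\<lambda>z. LINT t|lborel. \<bar>g (t + z) - g t\<bar>) \<longlongrightarrow> 0) (at 0)"
  shows "((\<lambda>z. LINT t|lborel. \<bar>f (t + z) - f t\<bar>) \<longlongrightarrow> 0) (at 0)"
proof (rule tendstoI)
  fix e :: real assume "e > 0"
  then obtain g where g: "integrable lborel g" "(LINT t|lborel. \<bar>g t - f t\<bar>) < e / 4"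
    "((\<lambda>z. LINT t|lborel. \<bar>g (t + z) - g t\<bar>) \<longlongrightarrow> 0) (at 0)"
    using approx[of "e / 4"] by auto
  note [intro] = f g(1) integrable_lborel_translate
  have "\<forall>\<^sub>F z in at 0. dist (LINT t|lborel. \<bar>g (t + z) - g t\<bar>) 0 < e / 2"
    using tendstoD[OF g(3), of "e / 2"] \<open>e > 0\<close> by simp
  then show "\<forall>\<^sub>F z in at 0. dist (LINT t|lborel. \<bar>f (t + z) - f t\<bar>) 0 < e"
  proof eventually_elim
    fix z assume z: "dist (LINT t|lborel. \<bar>g (t + z) - g t\<bar>) 0 < e / 2"
    have "(LINT t|lborel. \<bar>f (t + z) - f t\<bar>)
        \<le> (LINT t|lborel. \<bar>g (t + z) - f (t + z)\<bar> + \<bar>g (t + z) - g t\<bar> + \<bar>g t - f t\<bar>)"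
      by (rule integral_mono)
        (auto intro!: integrable_abs Bochner_Integration.integrable_diff Bochner_Integration.integrable_add)
    also have "\<dots> = (LINT t|lborel. \<bar>g (t + z) - f (t + z)\<bar>) + (LINT t|lborel. \<bar>g (t + z) - g t\<bar>)
        + (LINT t|lborel. \<bar>g t - f t\<bar>)"
      using f g(1) by (simp add: integrable_lborel_translate)
    also have "(LINT t|lborel. \<bar>g (t + z) - f (t + z)\<bar>) = (LINT t|lborel. \<bar>g t - f t\<bar>)"
      by (rule integral_lborel_translate[of "\<lambda>t. \<bar>g t - f t\<bar>"])
    finally show "dist (LINT t|lborel. \<bar>f (t + z) - f t\<bar>) 0 < e"
      using z g(2) by (simp add: dist_real_def)
  qed
qed

text \<open>
  A point of an open set stays in it under small translations, so the loss
  \<open>max 0 (1\<^bsub>U\<^esub>(t) - 1\<^bsub>U\<^esub>(t + z))\<close> tends to \<open>0\<close> pointwise and dominated by \<open>1\<^bsub>U\<^esub>\<close>.  The gain need not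
  vanish pointwise, but translations preserve the measure of \<open>U\<close>, so gain and loss have equal
  integrals.
\<close>

lemma L1_translation_continuous_open:
  fixes U :: "real set"
  assumes U: "open U" and fin: "emeasure lborel U < \<infinity>"
  shows "((\<lambda>z. LINT t|lborel. \<bar>indicator U (t + z) - indicator U t :: real\<bar>) \<longlongrightarrow> 0) (at 0)"
  unfolding tendsto_at_iff_sequentially comp_def
proof (intro allI impI)
  fix X :: "nat \<Rightarrow> real" assume X: "X \<longlonglongrightarrow> 0"
  let ?I = "indicator U :: real \<Rightarrow> real"
  have [measurable]: "U \<in> sets borel" using U by simp
  have I: "integrable lborel ?I"
    using fin by (intro integrable_real_indicator) auto
  then have J: "integrable lborel (\<lambda>t. ?I (t + z))" for z
    by (rule integrable_lborel_translate)
  have pos: "(\<lambda>n. LINT t|lborel. max 0 (?I t - ?I (t + X n))) \<longlonglongrightarrow> (LINT t::real|lborel. (0::real))"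
  proof (rule integral_dominated_convergence[where w = ?I])
    show "AE t in lborel. (\<lambda>n. max 0 (?I t - ?I (t + X n))) \<longlonglongrightarrow> 0"
    proof (rule AE_I2)
      fix t
      show "(\<lambda>n. max 0 (?I t - ?I (t + X n))) \<longlonglongrightarrow> 0"
      proof (cases "t \<in> U")
        case True
        have "(\<lambda>n. t + X n) \<longlonglongrightarrow> t"
          using tendsto_add[OF tendsto_const[of t] X] by simp
        then have "\<forall>\<^sub>F n in sequentially. t + X n \<in> U"
          using U True by (rule topological_tendstoD)
        then have "\<forall>\<^sub>F n in sequentially. max 0 (?I t - ?I (t + X n)) = 0"
          by eventually_elim (simp add: indicator_def)
        then show ?thesis by (rule tendsto_eventually)
      next
        case False
        then have "max 0 (?I t - ?I (t + X n)) = 0" for n by (simp add: indicator_def)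
        then show ?thesis by simp
      qed
    qed
    show "AE t in lborel. norm (max 0 (?I t - ?I (t + X n))) \<le> ?I t" for n
      by (rule AE_I2) (simp add: indicator_def)
  qed (use I in auto)
  have "(LINT t|lborel. \<bar>?I (t + X n) - ?I t\<bar>) = 2 * (LINT t|lborel. max 0 (?I t - ?I (t + X n)))" for n
  proof -
    have "(LINT t|lborel. \<bar>?I (t + X n) - ?I t\<bar>)
        = (LINT t|lborel. 2 * max 0 (?I t - ?I (t + X n)) + (?I (t + X n) - ?I t))"
      by (rule Bochner_Integration.integral_cong) (auto simp: indicator_def)
    also have "\<dots> = 2 * (LINT t|lborel. max 0 (?I t - ?I (t + X n))) + ((LINT t|lborel. ?I (t + X n)) - (LINT t|lborel. ?I t))"
      using I J by simp
    finally show ?thesis by (simp add: integral_lborel_translate[of ?I])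
  qed
  then show "(\<lambda>n. LINT t|lborel. \<bar>?I (t + X n) - ?I t\<bar>) \<longlonglongrightarrow> 0"
    using tendsto_mult_left[OF pos, of 2] by simp
qed

text \<open>
  Outer regularity passes from open sets to Borel sets of finite measure; linearity and
  \<open>L\<^sup>1\<close>-approximation by simple functions do the rest.
\<close>

lemma L1_translation_continuous:
  fixes f :: "real \<Rightarrow> real"
  assumes "integrable lborel f"
  shows "((\<lambda>z. LINT t|lborel. \<bar>f (t + z) - f t\<bar>) \<longlongrightarrow> 0) (at 0)"
  using assms
proof (induction rule: integrable_induct)
  case (base A c)
  have [measurable]: "A \<in> sets borel" using base by simp
  have A: "integrable lborel (indicator A :: real \<Rightarrow> real)"
    using base by (intro integrable_real_indicator) auto
  have "((\<lambda>z. LINT t|lborel. \<bar>indicator A (t + z) - indicator A t :: real\<bar>) \<longlongrightarrow> 0) (at 0)"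
  proof (rule L1_translation_approximation[OF A])
    fix e :: real assume "e > 0"
    then obtain U where U: "open U" "A \<subseteq> U" "emeasure lborel (U - A) < e"
      using outer_regular_lborel[of A e] by auto
    have [measurable]: "U \<in> sets borel" using U(1) by simp
    have "emeasure lborel U \<le> emeasure lborel (A \<union> (U - A))"
      using U(2) by (intro emeasure_mono) auto
    also have "\<dots> \<le> emeasure lborel A + emeasure lborel (U - A)"
      by (rule emeasure_subadditive) auto
    also have "\<dots> < \<infinity>"
      using base(2) less_trans[OF U(3) ennreal_less_top] by simp
    finally have fin: "emeasure lborel U < \<infinity>" .
    have "(LINT t|lborel. \<bar>indicator U t - indicator A t :: real\<bar>) = (LINT t|lborel. indicator (U - A) t)"
      using U(2) by (intro Bochner_Integration.integral_cong) (auto simp: indicator_def)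
    also have "\<dots> = measure lborel (U - A)" by simp
    also have "\<dots> < e"
      using U(3) \<open>e > 0\<close> by (simp add: measure_def enn2real_less_iff less_trans[OF U(3) ennreal_less_top])
    finally show "\<exists>g. integrable lborel g \<and> (LINT t|lborel. \<bar>g t - indicator A t :: real\<bar>) < e \<and>
      ((\<lambda>z. LINT t|lborel. \<bar>g (t + z) - g t\<bar>) \<longlongrightarrow> 0) (at 0)"
      using fin L1_translation_continuous_open[OF U(1) fin]
      by (intro exI[of _ "indicator U"]) auto
  qed
  from tendsto_mult_left[OF this, of "\<bar>c\<bar>"]
  show ?case by (simp flip: integral_mult_right_zero abs_mult add: algebra_simps)
next
  case (add f g)
  note [intro] = \<open>integrable lborel f\<close> \<open>integrable lborel g\<close> integrable_lborel_translate
  show ?case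
  proof (rule Lim_null_comparison)
    show "\<forall>\<^sub>F z in at 0. norm (LINT t|lborel. \<bar>f (t + z) + g (t + z) - (f t + g t)\<bar>)
      \<le> (LINT t|lborel. \<bar>f (t + z) - f t\<bar>) + (LINT t|lborel. \<bar>g (t + z) - g t\<bar>)"
    proof (rule always_eventually, rule allI)
      fix z
      have "(LINT t|lborel. \<bar>f (t + z) + g (t + z) - (f t + g t)\<bar>)
          \<le> (LINT t|lborel. \<bar>f (t + z) - f t\<bar> + \<bar>g (t + z) - g t\<bar>)"
        by (rule integral_mono)
          (auto intro!: integrable_abs Bochner_Integration.integrable_diff Bochner_Integration.integrable_add)
      also have "\<dots> = (LINT t|lborel. \<bar>f (t + z) - f t\<bar>) + (LINT t|lborel. \<bar>g (t + z) - g t\<bar>)"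
        using \<open>integrable lborel f\<close> \<open>integrable lborel g\<close>
        by (simp add: integrable_lborel_translate)
      finally show "norm (LINT t|lborel. \<bar>f (t + z) + g (t + z) - (f t + g t)\<bar>)
        \<le> (LINT t|lborel. \<bar>f (t + z) - f t\<bar>) + (LINT t|lborel. \<bar>g (t + z) - g t\<bar>)"
        by simp
    qed
    show "((\<lambda>z. (LINT t|lborel. \<bar>f (t + z) - f t\<bar>) + (LINT t|lborel. \<bar>g (t + z) - g t\<bar>)) \<longlongrightarrow> 0) (at 0)"
      using tendsto_add[OF add.IH] by simp
  qed
next
  case (lim f s)
  show ?case
  proof (rule L1_translation_approximation[OF lim(4)])
    fix e :: real assume "e > 0"
    have [measurable]: "f \<in> borel_measurable borel" "s i \<in> borel_measurable borel" for i
      using lim(1)[of i] lim(4) by (auto dest: borel_measurable_integrable)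
    have "(\<lambda>i. LINT t|lborel. \<bar>s i t - f t\<bar>) \<longlonglongrightarrow> (LINT t::real|lborel. (0::real))"
    proof (rule integral_dominated_convergence[where w = "\<lambda>t. 3 * \<bar>f t\<bar>"])
      show "AE t in lborel. (\<lambda>i. \<bar>s i t - f t\<bar>) \<longlonglongrightarrow> 0"
        using lim(2) by (intro AE_I2 tendsto_rabs_zero LIM_zero) auto
      show "AE t in lborel. norm \<bar>s i t - f t\<bar> \<le> 3 * \<bar>f t\<bar>" for i
      proof (rule AE_I2)
        show "norm \<bar>s i t - f t\<bar> \<le> 3 * \<bar>f t\<bar>" for t
          using lim(3)[of t i] by simp
      qed
    qed (use lim(4) in auto)
    then have "\<forall>\<^sub>F i in sequentially. dist (LINT t|lborel. \<bar>s i t - f t\<bar>) 0 < e"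
      using \<open>e > 0\<close> by (intro tendstoD) simp_all
    then obtain i where "(LINT t|lborel. \<bar>s i t - f t\<bar>) < e"
      by (auto simp: eventually_sequentially dist_real_def)
    then show "\<exists>g. integrable lborel g \<and> (LINT t|lborel. \<bar>g t - f t\<bar>) < e \<and>
      ((\<lambda>z. LINT t|lborel. \<bar>g (t + z) - g t\<bar>) \<longlongrightarrow> 0) (at 0)"
      using lim(1,5) by blast
  qed
qed

subsection \<open>The translation group\<close>

definition translate :: "real \<Rightarrow> l2 \<Rightarrow> l2" where
  "translate z f = to_l2 (\<lambda>t. l2_fun f (t + z))"

lemma square_integrable_translate:
  "square_integrable f \<Longrightarrow> square_integrable (\<lambda>t. f (t + z))"
  unfolding square_integrable_def
  using integrable_lborel_translate[of "\<lambda>x. (f x)\<^sup>2" z] by auto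

lemma translate_to_l2:
  assumes "square_integrable f"
  shows "translate z (to_l2 f) = to_l2 (\<lambda>t. f (t + z))"
  unfolding translate_def using AE_lborel_translate[OF l2_fun_to_l2[OF assms]] assms
  by (subst to_l2_eq_iff) (auto intro!: square_integrable_translate)

lemma translate_0 [simp]: "translate 0 f = f"
  by (simp add: translate_def)

lemma translate_translate: "translate y (translate z f) = translate (y + z) f"
proof -
  have "translate y (translate z f) = to_l2 (\<lambda>t. l2_fun f ((t + y) + z))"
    unfolding translate_def[of z]
    by (intro translate_to_l2 square_integrable_translate) simp
  then show ?thesis by (simp add: translate_def add.assoc)
qed

lemma translate_diff: "translate z (f - g) = translate z f - translate z g"
proof -
  have "f - g = to_l2 (\<lambda>t. l2_fun f t - l2_fun g t)"
    using to_l2_diff[of "l2_fun f" "l2_fun g"] by simp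
  then have "translate z (f - g) = to_l2 (\<lambda>t. l2_fun f (t + z) - l2_fun g (t + z))"
    using translate_to_l2[OF square_integrable_diff[of "l2_fun f" "l2_fun g"]] by simp
  then show ?thesis
    unfolding translate_def by (simp add: to_l2_diff square_integrable_translate)
qed

lemma norm_translate [simp]: "norm (translate z f) = norm f"
proof -
  have "(norm (translate z f))\<^sup>2 = (LINT t|lborel. (l2_fun f (t + z))\<^sup>2)"
    unfolding translate_def by (intro norm_to_l2 square_integrable_translate) simp
  also have "\<dots> = (norm f)\<^sup>2"
    unfolding norm_l2_fun by (rule integral_lborel_translate[of "\<lambda>t. (l2_fun f t)\<^sup>2"])
  finally show ?thesis by simp
qed

lemma bounded_linear_translate: "bounded_linear (translate z)"
proof (rule bounded_linear_intro[where K = 1])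
  show "translate z (f + g) = translate z f + translate z g" for f g
    using translate_diff[of z "f + g" g] by simp
  show "translate z (c *\<^sub>R f) = c *\<^sub>R translate z f" for c f
  proof -
    have "c *\<^sub>R f = to_l2 (\<lambda>t. c * l2_fun f t)"
      using to_l2_scale[of "l2_fun f" c] by simp
    then have "translate z (c *\<^sub>R f) = to_l2 (\<lambda>t. c * l2_fun f (t + z))"
      using translate_to_l2[OF square_integrable_scale[of "l2_fun f" c]] by simp
    then show ?thesis
      unfolding translate_def by (simp add: to_l2_scale square_integrable_translate)
  qed
  show "norm (translate z f) \<le> norm f * 1" for f by simp
qed

text \<open>
  This reduces \<open>L\<^sup>2\<close>-continuity of translations to the \<open>L\<^sup>1\<close> case: \<open>f \<in> L\<^sup>2\<close> gives \<open>f \<bar>f\<bar> \<in> L\<^sup>1\<close>, and this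
  map commutes with translations.
\<close>

lemma square_diff_le_signed_square:
  fixes a b :: real
  shows "(a - b)\<^sup>2 \<le> 2 * \<bar>a * \<bar>a\<bar> - b * \<bar>b\<bar>\<bar>"
proof -
  have same: "(x - y)\<^sup>2 \<le> 2 * \<bar>x * x - y * y\<bar>" if "x \<ge> 0" "y \<ge> 0" for x y :: real
  proof -
    have "(x - y)\<^sup>2 = \<bar>x - y\<bar> * \<bar>x - y\<bar>" by (simp add: power2_eq_square)
    also have "\<dots> \<le> \<bar>x - y\<bar> * (2 * (x + y))" using that by (intro mult_left_mono) auto
    also have "\<dots> = 2 * \<bar>x * x - y * y\<bar>"
      using that by (simp add: square_diff_square_factored abs_mult)
    finally show ?thesis .
  qed
  have opp: "(x + y)\<^sup>2 \<le> 2 * \<bar>x * x + y * y\<bar>" for x y :: real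
    using zero_le_power2[of "x - y"] by (simp add: power2_eq_square algebra_simps)
  consider "a \<ge> 0" "b \<ge> 0" | "a \<ge> 0" "b < 0" | "a < 0" "b \<ge> 0" | "a < 0" "b < 0" by linarith
  then show ?thesis
  proof cases
    case 1
    then show ?thesis using same[of a b] by simp
  next
    case 2
    then show ?thesis using opp[of a "- b"] by simp
  next
    case 3
    then have "\<bar>a * \<bar>a\<bar> - b * \<bar>b\<bar>\<bar> = \<bar>a * a + b * b\<bar>"
      using abs_minus_cancel[of "a * a + b * b"] by simp
    then show ?thesis using opp[of "- a" b] by (simp add: power2_commute[of a b])
  next
    case 4
    then have "\<bar>a * \<bar>a\<bar> - b * \<bar>b\<bar>\<bar> = \<bar>a * a - b * b\<bar>"
      by (simp add: abs_minus_commute)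
    then show ?thesis using same[of "- a" "- b"] 4 by (simp add: power2_commute[of a b])
  qed
qed

lemma tendsto_translate_0: "((\<lambda>z. translate z f) \<longlongrightarrow> f) (at 0)"
proof -
  define F where "F t = l2_fun f t * \<bar>l2_fun f t\<bar>" for t
  have F: "integrable lborel F"
    unfolding F_def
    by (rule square_integrable_mult_integrable) (auto simp: square_integrable_def intro!: square_integrable_l2_fun[unfolded square_integrable_def, THEN conjunct2])
  have "((\<lambda>z. 2 * (LINT t|lborel. \<bar>F (t + z) - F t\<bar>)) \<longlongrightarrow> 2 * 0) (at 0)"
    by (intro tendsto_mult_left L1_translation_continuous F)
  then have lim: "((\<lambda>z. 2 * (LINT t|lborel. \<bar>F (t + z) - F t\<bar>)) \<longlongrightarrow> 0) (at 0)" by simp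
  have "(norm (translate z f - f))\<^sup>2 \<le> 2 * (LINT t|lborel. \<bar>F (t + z) - F t\<bar>)" for z
  proof -
    have sq: "square_integrable (\<lambda>t. l2_fun f (t + z) - l2_fun f t)"
      by (intro square_integrable_diff square_integrable_translate) simp_all
    have "translate z f - f = to_l2 (\<lambda>t. l2_fun f (t + z) - l2_fun f t)"
      using to_l2_diff[of "\<lambda>t. l2_fun f (t + z)" "l2_fun f"] square_integrable_translate[of "l2_fun f" z]
      by (simp add: translate_def)
    then have "(norm (translate z f - f))\<^sup>2 = (LINT t|lborel. (l2_fun f (t + z) - l2_fun f t)\<^sup>2)"
      using norm_to_l2[OF sq] by simp
    also have "\<dots> \<le> (LINT t|lborel. 2 * \<bar>F (t + z) - F t\<bar>)"
    proof (rule integral_mono)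
      show "integrable lborel (\<lambda>t. (l2_fun f (t + z) - l2_fun f t)\<^sup>2)"
        using sq by (simp add: square_integrable_def)
      show "integrable lborel (\<lambda>t. 2 * \<bar>F (t + z) - F t\<bar>)"
        by (intro integrable_mult_right integrable_abs Bochner_Integration.integrable_diff
            integrable_lborel_translate F)
      show "(l2_fun f (t + z) - l2_fun f t)\<^sup>2 \<le> 2 * \<bar>F (t + z) - F t\<bar>" for t
        unfolding F_def by (rule square_diff_le_signed_square)
    qed
    finally show ?thesis by simp
  qed
  then have "((\<lambda>z. (norm (translate z f - f))\<^sup>2) \<longlongrightarrow> 0) (at 0)"
    by (intro Lim_null_comparison[OF _ lim]) (auto intro!: always_eventually)
  then have "((\<lambda>z. sqrt ((norm (translate z f - f))\<^sup>2)) \<longlongrightarrow> sqrt 0) (at 0)"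
    by (rule tendsto_real_sqrt)
  then show ?thesis
    by (simp add: tendsto_norm_zero_iff LIM_zero_iff)
qed

lemma continuous_on_translate: "continuous_on A (\<lambda>z. translate z f)"
proof -
  have "isCont (\<lambda>z. translate z f) x" for x
    unfolding isCont_def
    by (rule LIM_offset_zero_cancel)
      (use bounded_linear.tendsto[OF bounded_linear_translate tendsto_translate_0[of f], of x]
        in \<open>simp add: translate_translate\<close>)
  then show ?thesis by (simp add: continuous_at_imp_continuous_on)
qed

lemma borel_measurable_translate [measurable]: "(\<lambda>z. translate z f) \<in> borel_measurable borel"
  by (intro borel_measurable_continuous_onI continuous_on_translate)

section \<open>Averages of translations\<close>

lemma integrable_scaleR_bounded:
  fixes F :: "real \<Rightarrow> 'b :: {banach, second_countable_topology}"
  assumes "integrable lborel k" "F \<in> borel_measurable borel" "\<And>z. norm (F z) \<le> B"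
  shows "integrable lborel (\<lambda>z. k z *\<^sub>R F z)"
proof (rule Bochner_Integration.integrable_bound)
  show "integrable lborel (\<lambda>z. B * k z)" using assms(1) by simp
  show "(\<lambda>z. k z *\<^sub>R F z) \<in> borel_measurable lborel"
    using borel_measurable_integrable[OF assms(1)] assms(2) by measurable
  show "AE z in lborel. norm (k z *\<^sub>R F z) \<le> norm (B * k z)"
  proof (rule AE_I2)
    fix z
    have "0 \<le> B" using norm_ge_zero assms(3) by (rule order_trans)
    then show "norm (k z *\<^sub>R F z) \<le> norm (B * k z)"
      using mult_right_mono[OF assms(3)[of z], of "\<bar>k z\<bar>"] by (simp add: abs_mult mult.commute)
  qed
qed

text \<open>
  The value at \<open>k\<close> of the calculus \<open>k \<mapsto> \<integral> k(z) \<tau>\<^sub>z dz\<close> of the translation group \<open>\<tau>\<close>, as a Bochner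
  integral in \<open>L\<^sup>2\<close>.
\<close>

definition average :: "(real \<Rightarrow> real) \<Rightarrow> l2 \<Rightarrow> l2" where
  "average k f = (LINT z|lborel. k z *\<^sub>R translate z f)"

lemma integrable_average:
  "integrable lborel k \<Longrightarrow> integrable lborel (\<lambda>z. k z *\<^sub>R translate z f)"
  by (rule integrable_scaleR_bounded[where B = "norm f"]) simp_all

lemma norm_average_le:
  assumes "integrable lborel k"
  shows "norm (average k f) \<le> (LINT z|lborel. \<bar>k z\<bar>) * norm f"
proof -
  have "norm (average k f) \<le> (LINT z|lborel. norm (k z *\<^sub>R translate z f))"
    unfolding average_def by (rule integral_norm_bound)
  then show ?thesis by simp
qed

lemma bounded_linear_average:
  assumes k: "integrable lborel k"
  shows "bounded_linear (average k)"
proof (rule bounded_linear_intro)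
  interpret translate: bounded_linear "translate z" for z by (rule bounded_linear_translate)
  show "average k (f + g) = average k f + average k g" for f g
    unfolding average_def using integrable_average[OF k] by (simp add: translate.add scaleR_add_right)
  show "average k (c *\<^sub>R f) = c *\<^sub>R average k f" for c f
    unfolding average_def translate.scaleR scaleR_left_commute[of _ c] by (rule integral_scaleR_right)
  show "norm (average k f) \<le> norm f * (LINT z|lborel. \<bar>k z\<bar>)" for f
    using norm_average_le[OF k] by (simp add: mult.commute)
qed

lemma average_diff:
  "integrable lborel k \<Longrightarrow> integrable lborel l \<Longrightarrow>
    average (\<lambda>z. k z - l z) f = average k f - average l f"
  unfolding average_def by (simp add: scaleR_diff_left integrable_average)

lemma average_scale: "average (\<lambda>z. c * k z) f = c *\<^sub>R average k f"
  using integral_scaleR_right[where c = c and M = lborel and f = "\<lambda>z. k z *\<^sub>R translate z f"]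
  unfolding average_def scaleR_scaleR by simp

lemma translate_average:
  assumes "integrable lborel k"
  shows "translate y (average k f) = (LINT z|lborel. k z *\<^sub>R translate (y + z) f)"
proof -
  interpret translate: bounded_linear "translate y" by (rule bounded_linear_translate)
  show ?thesis
    unfolding average_def
    using integral_bounded_linear[OF bounded_linear_translate integrable_average[OF assms], of y f]
    by (simp add: translate.scaleR translate_translate)
qed

lemma inner_average:
  "integrable lborel k \<Longrightarrow> inner (average k f) g = (LINT z|lborel. k z * inner (translate z f) g)"
  unfolding average_def by (subst integral_inner_left[symmetric]) (simp_all add: integrable_average)

subsection \<open>Averages as pointwise integrals\<close>

text \<open>
  Young's inequality \<open>\<parallel>k * f\<parallel>\<^sub>2 \<le> \<parallel>k\<parallel>\<^sub>1 \<parallel>f\<parallel>\<^sub>2\<close> in qualitative form.  Cauchy-Schwarz for the measure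
  \<open>\<bar>k z\<bar> dz\<close> bounds the square of the integral at \<open>t\<close> by \<open>\<parallel>k\<parallel>\<^sub>1 \<integral> \<bar>k z\<bar> f(t + z)\<^sup>2 dz\<close>, and Tonelli
  integrates this over \<open>t\<close>.
\<close>

lemma young_inequality:
  assumes k: "integrable lborel k" and f: "square_integrable f"
  shows "AE t in lborel. integrable lborel (\<lambda>z. k z * f (t + z))"
    and "square_integrable (\<lambda>t. LINT z|lborel. k z * f (t + z))"
proof -
  have [measurable]: "k \<in> borel_measurable borel" "f \<in> borel_measurable borel"
    using borel_measurable_integrable[OF k] f by (simp_all add: square_integrable_def)
  define v where "v t = (\<integral>\<^sup>+z. ennreal \<bar>k z * f (t + z)\<bar> \<partial>lborel)" for t
  define N where "N = (\<integral>\<^sup>+z. ennreal \<bar>k z\<bar> \<partial>lborel)"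
  define Q where "Q = (\<integral>\<^sup>+t. ennreal ((f t)\<^sup>2) \<partial>lborel)"
  have N: "N < \<infinity>"
    using k unfolding N_def integrable_iff_bounded by simp
  have Q: "Q < \<infinity>"
    using f unfolding Q_def square_integrable_def integrable_iff_bounded by simp
  have [measurable]: "v \<in> borel_measurable borel"
    unfolding v_def[abs_def] by measurable
  have cs: "(v t)\<^sup>2 \<le> N * (\<integral>\<^sup>+z. ennreal \<bar>k z\<bar> * ennreal ((f (t + z))\<^sup>2) \<partial>lborel)" for t
  proof -
    have "v t = (\<integral>\<^sup>+z. ennreal (sqrt \<bar>k z\<bar>) * ennreal (sqrt \<bar>k z\<bar> * \<bar>f (t + z)\<bar>) \<partial>lborel)"
      unfolding v_def by (intro nn_integral_cong) (simp add: abs_mult flip: ennreal_mult mult.assoc)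
    also have "\<dots>\<^sup>2 \<le> (\<integral>\<^sup>+z. (ennreal (sqrt \<bar>k z\<bar>))\<^sup>2 \<partial>lborel)
        * (\<integral>\<^sup>+z. (ennreal (sqrt \<bar>k z\<bar> * \<bar>f (t + z)\<bar>))\<^sup>2 \<partial>lborel)"
      by (rule Cauchy_Schwarz_nn_integral) auto
    also have "(\<integral>\<^sup>+z. (ennreal (sqrt \<bar>k z\<bar>))\<^sup>2 \<partial>lborel) = N"
      unfolding N_def by (simp add: ennreal_power)
    also have "(\<integral>\<^sup>+z. (ennreal (sqrt \<bar>k z\<bar> * \<bar>f (t + z)\<bar>))\<^sup>2 \<partial>lborel)
        = (\<integral>\<^sup>+z. ennreal \<bar>k z\<bar> * ennreal ((f (t + z))\<^sup>2) \<partial>lborel)"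
      by (simp add: ennreal_power power_mult_distrib ennreal_mult)
    finally show ?thesis .
  qed
  have translate: "(\<integral>\<^sup>+t. ennreal ((f (t + z))\<^sup>2) \<partial>lborel) = Q" for z
    unfolding Q_def
    using nn_integral_real_affine[of "\<lambda>t. ennreal ((f t)\<^sup>2)" 1 z] by (simp add: add.commute)
  have "(\<integral>\<^sup>+t. (v t)\<^sup>2 \<partial>lborel)
      \<le> (\<integral>\<^sup>+t. N * (\<integral>\<^sup>+z. ennreal \<bar>k z\<bar> * ennreal ((f (t + z))\<^sup>2) \<partial>lborel) \<partial>lborel)"
    by (intro nn_integral_mono cs)
  also have "\<dots> = N * (\<integral>\<^sup>+t. (\<integral>\<^sup>+z. ennreal \<bar>k z\<bar> * ennreal ((f (t + z))\<^sup>2) \<partial>lborel) \<partial>lborel)"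
    by (intro nn_integral_cmult) measurable
  also have "(\<integral>\<^sup>+t. (\<integral>\<^sup>+z. ennreal \<bar>k z\<bar> * ennreal ((f (t + z))\<^sup>2) \<partial>lborel) \<partial>lborel)
      = (\<integral>\<^sup>+z. (\<integral>\<^sup>+t. ennreal \<bar>k z\<bar> * ennreal ((f (t + z))\<^sup>2) \<partial>lborel) \<partial>lborel)"
    by (rule lborel_pair.Fubini') measurable
  also have "\<dots> = (\<integral>\<^sup>+z. ennreal \<bar>k z\<bar> * Q \<partial>lborel)"
    by (simp add: nn_integral_cmult translate)
  also have "\<dots> = N * Q"
    unfolding N_def by (rule nn_integral_multc) simp
  finally have "(\<integral>\<^sup>+t. (v t)\<^sup>2 \<partial>lborel) \<le> N * (N * Q)" .
  also have "\<dots> < \<infinity>"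
    using N Q by (simp add: ennreal_mult_less_top)
  finally have v2: "(\<integral>\<^sup>+t. (v t)\<^sup>2 \<partial>lborel) < \<infinity>" .
  then have "AE t in lborel. (v t)\<^sup>2 \<noteq> \<infinity>"
    by (intro nn_integral_PInf_AE) auto
  then show "AE t in lborel. integrable lborel (\<lambda>z. k z * f (t + z))"
  proof eventually_elim
    fix t assume "(v t)\<^sup>2 \<noteq> \<infinity>"
    then have "v t < \<infinity>"
      by (auto simp: power_eq_top_ennreal less_top[symmetric])
    then show "integrable lborel (\<lambda>z. k z * f (t + z))"
      unfolding integrable_iff_bounded v_def by simp
  qed
  have "ennreal ((LINT z|lborel. k z * f (t + z))\<^sup>2) \<le> (v t)\<^sup>2" for t
  proof -
    have "ennreal \<bar>LINT z|lborel. k z * f (t + z)\<bar> \<le> v t"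
      unfolding v_def
      using integral_norm_bound_ennreal[of lborel "\<lambda>z. k z * f (t + z)"]
      by (cases "integrable lborel (\<lambda>z. k z * f (t + z))") (auto simp: not_integrable_integral_eq)
    then have "(ennreal \<bar>LINT z|lborel. k z * f (t + z)\<bar>)\<^sup>2 \<le> (v t)\<^sup>2"
      by (rule power_mono_ennreal)
    then show ?thesis by (simp add: ennreal_power)
  qed
  then have "(\<integral>\<^sup>+t. ennreal ((LINT z|lborel. k z * f (t + z))\<^sup>2) \<partial>lborel) < \<infinity>"
    by (intro le_less_trans[OF nn_integral_mono v2])
  then show "square_integrable (\<lambda>t. LINT z|lborel. k z * f (t + z))"
    unfolding square_integrable_def integrable_iff_bounded by simp
qed

lemma inner_average_to_l2:
  assumes k: "integrable lborel k" and f: "square_integrable f" and g: "square_integrable g"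
  shows "inner (average k (to_l2 f)) (to_l2 g)
    = (LINT t|lborel. (LINT z|lborel. k z * f (t + z)) * g t)"
proof -
  have [measurable]: "k \<in> borel_measurable borel" "f \<in> borel_measurable borel" "g \<in> borel_measurable borel"
    using borel_measurable_integrable[OF k] f g by (simp_all add: square_integrable_def)
  have sq_abs: "square_integrable (\<lambda>t. \<bar>f t\<bar>)" if "square_integrable f" for f
    using that by (auto simp: square_integrable_def)
  have pair: "integrable (lborel \<Otimes>\<^sub>M lborel) (\<lambda>(t, z). k z * f (t + z) * g t)"
  proof (rule lborel_pair.Fubini_integrable)
    have "integrable lborel (\<lambda>t. (LINT z|lborel. \<bar>k z\<bar> * \<bar>f (t + z)\<bar>) * \<bar>g t\<bar>)"
      by (intro square_integrable_mult_integrable young_inequality sq_abs f g integrable_abs k)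
    then show "integrable lborel (\<lambda>t. LINT z|lborel. norm (case (t, z) of (t, z) \<Rightarrow> k z * f (t + z) * g t))"
      by (simp add: abs_mult)
    show "AE t in lborel. integrable lborel (\<lambda>z. case (t, z) of (t, z) \<Rightarrow> k z * f (t + z) * g t)"
      using young_inequality(1)[OF k f] by eventually_elim simp
  qed simp
  have "inner (average k (to_l2 f)) (to_l2 g)
      = (LINT z|lborel. k z * (LINT t|lborel. f (t + z) * g t))"
    using k f g by (simp add: inner_average translate_to_l2 inner_to_l2 square_integrable_translate)
  also have "\<dots> = (LINT z|lborel. LINT t|lborel. k z * f (t + z) * g t)"
    by (simp add: mult.assoc)
  also have "\<dots> = (LINT t|lborel. LINT z|lborel. k z * f (t + z) * g t)"
    by (rule lborel_pair.Fubini_integral[OF pair])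
  finally show ?thesis by simp
qed

text \<open>
  The Bochner integral is characterized by its inner products, and those are computed by Fubini.
  This connects the operator calculus with the pointwise integrals that define the truncated
  Marchaud derivative and the convolution.
\<close>

lemma average_to_l2:
  assumes k: "integrable lborel k" and f: "square_integrable f"
  shows "average k (to_l2 f) = to_l2 (\<lambda>t. LINT z|lborel. k z * f (t + z))"
proof -
  have "inner (average k (to_l2 f)) g = inner (to_l2 (\<lambda>t. LINT z|lborel. k z * f (t + z))) g" for g
    using inner_average_to_l2[OF k f, of "l2_fun g"]
      inner_to_l2[OF young_inequality(2)[OF k f], of "l2_fun g"] by simp
  then show ?thesis using vector_eq_rdot by blast
qed

subsection \<open>Convolution of kernels\<close>

text \<open>
  Fubini for a kernel that is itself an integral of kernels; convolutions and subordination
  integrals are both of this form.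
\<close>

lemma
  fixes F :: "real \<Rightarrow> 'b :: {banach, second_countable_topology}"
  assumes pair: "integrable (lborel \<Otimes>\<^sub>M lborel) (\<lambda>(y, x). G y x)"
  shows integrable_mixture: "integrable lborel (\<lambda>x. LINT y|lborel. G y x)"
    and integral_mixture: "F \<in> borel_measurable borel \<Longrightarrow> (\<And>x. norm (F x) \<le> B) \<Longrightarrow>
      (LINT x|lborel. (LINT y|lborel. G y x) *\<^sub>R F x) = (LINT y|lborel. LINT x|lborel. G y x *\<^sub>R F x)"
proof -
  show "integrable lborel (\<lambda>x. LINT y|lborel. G y x)"
    using lborel_pair.integrable_snd[OF pair] .
  assume F [measurable]: "F \<in> borel_measurable borel" and B: "\<And>z. norm (F z) \<le> B"
  have G [measurable]: "(\<lambda>(y, x). G y x) \<in> borel_measurable (lborel \<Otimes>\<^sub>M lborel)"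
    using pair by (rule borel_measurable_integrable)
  have pairF: "integrable (lborel \<Otimes>\<^sub>M lborel) (\<lambda>(y, x). G y x *\<^sub>R F x)"
  proof (rule Bochner_Integration.integrable_bound)
    show "integrable (lborel \<Otimes>\<^sub>M lborel) (\<lambda>p. B * (case p of (y, x) \<Rightarrow> G y x))"
      by (intro integrable_mult_right pair)
    have "0 \<le> B" using norm_ge_zero B by (rule order_trans)
    then show "AE p in lborel \<Otimes>\<^sub>M lborel. norm (case p of (y, x) \<Rightarrow> G y x *\<^sub>R F x)
        \<le> norm (B * (case p of (y, x) \<Rightarrow> G y x))"
      by (intro AE_I2) (auto simp: abs_mult mult.commute[of B] intro!: mult_left_mono B)
  qed measurable
  have "(LINT x|lborel. (LINT y|lborel. G y x) *\<^sub>R F x) = (LINT x|lborel. LINT y|lborel. G y x *\<^sub>R F x)"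
  proof (rule integral_cong_AE)
    show "AE x in lborel. (LINT y|lborel. G y x) *\<^sub>R F x = (LINT y|lborel. G y x *\<^sub>R F x)"
      using lborel_pair.AE_integrable_snd[OF pair] by eventually_elim simp
  qed measurable
  also have "\<dots> = (LINT y|lborel. LINT x|lborel. G y x *\<^sub>R F x)"
    by (rule lborel_pair.Fubini_integral[OF pairF])
  finally show "(LINT x|lborel. (LINT y|lborel. G y x) *\<^sub>R F x) = (LINT y|lborel. LINT x|lborel. G y x *\<^sub>R F x)" .
qed

definition kernel_conv :: "(real \<Rightarrow> real) \<Rightarrow> (real \<Rightarrow> real) \<Rightarrow> real \<Rightarrow> real" where
  "kernel_conv k l x = (LINT y|lborel. k y * l (x - y))"

lemma
  fixes F :: "real \<Rightarrow> 'b :: {banach, second_countable_topology}"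
  assumes k: "integrable lborel k" and l: "integrable lborel l"
  shows integrable_kernel_conv: "integrable lborel (kernel_conv k l)"
    and integral_kernel_conv: "F \<in> borel_measurable borel \<Longrightarrow> (\<And>z. norm (F z) \<le> B) \<Longrightarrow>
      (LINT x|lborel. kernel_conv k l x *\<^sub>R F x) = (LINT y|lborel. k y *\<^sub>R (LINT z|lborel. l z *\<^sub>R F (y + z)))"
proof -
  have [measurable]: "k \<in> borel_measurable borel" "l \<in> borel_measurable borel"
    using borel_measurable_integrable[OF k] borel_measurable_integrable[OF l] by simp_all
  have pair: "integrable (lborel \<Otimes>\<^sub>M lborel) (\<lambda>(y, x). k y * l (x - y))"
  proof (rule lborel_pair.Fubini_integrable)
    have "(LINT x|lborel. \<bar>l (x - y)\<bar>) = (LINT x|lborel. \<bar>l x\<bar>)" for y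
      using integral_lborel_translate[of "\<lambda>x. \<bar>l x\<bar>" "- y"] by simp
    then show "integrable lborel (\<lambda>y. LINT x|lborel. norm (case (y, x) of (y, x) \<Rightarrow> k y * l (x - y)))"
      using k by (simp add: abs_mult)
    show "AE y in lborel. integrable lborel (\<lambda>x. case (y, x) of (y, x) \<Rightarrow> k y * l (x - y))"
      using integrable_lborel_translate[OF l, of "- y" for y] by simp
  qed simp
  show "integrable lborel (kernel_conv k l)"
    using integrable_mixture[OF pair] by (simp add: kernel_conv_def[abs_def])
  assume F: "F \<in> borel_measurable borel" and B: "\<And>z. norm (F z) \<le> B"
  have "(LINT x|lborel. (k y * l (x - y)) *\<^sub>R F x) = k y *\<^sub>R (LINT z|lborel. l z *\<^sub>R F (y + z))" for y
  proof -
    have "(LINT x|lborel. (k y * l (x - y)) *\<^sub>R F x) = k y *\<^sub>R (LINT x|lborel. l (x - y) *\<^sub>R F x)"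
      by (simp flip: scaleR_scaleR)
    also have "(LINT x|lborel. l (x - y) *\<^sub>R F x) = (LINT z|lborel. l z *\<^sub>R F (y + z))"
      using integral_lborel_translate[of "\<lambda>x. l (x - y) *\<^sub>R F x" y] by (simp add: add.commute)
    finally show ?thesis .
  qed
  then show "(LINT x|lborel. kernel_conv k l x *\<^sub>R F x)
      = (LINT y|lborel. k y *\<^sub>R (LINT z|lborel. l z *\<^sub>R F (y + z)))"
    unfolding kernel_conv_def integral_mixture[OF pair F B] by simp
qed

lemma average_kernel_conv:
  assumes "integrable lborel k" "integrable lborel l"
  shows "average (kernel_conv k l) f = average k (average l f)"
  unfolding average_def[of "kernel_conv k l"] average_def[of k] translate_average[OF assms(2)]
  by (rule integral_kernel_conv[OF assms, where B = "norm f"]) simp_all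

section \<open>Laplace transforms of kernels on the half-line\<close>

text \<open>
  The integrand of the Laplace transform, cut off to \<open>0\<close> on the negative half-line so that it is
  bounded for \<open>\<xi> \<ge> 0\<close>.
\<close>

definition damping :: "real \<Rightarrow> real \<Rightarrow> real" where
  "damping \<xi> z = indicator {0..} z * exp (- (\<xi> * z))"

definition laplace :: "(real \<Rightarrow> real) \<Rightarrow> real \<Rightarrow> real" where
  "laplace k \<xi> = (LINT z|lborel. k z * damping \<xi> z)"

definition half_line_kernel :: "(real \<Rightarrow> real) \<Rightarrow> bool" where
  "half_line_kernel k \<longleftrightarrow> integrable lborel k \<and> (\<forall>z<0. k z = 0)"

lemma half_line_kernel_integrable: "half_line_kernel k \<Longrightarrow> integrable lborel k"
  by (simp add: half_line_kernel_def)

lemma damping_measurable [measurable]: "damping \<xi> \<in> borel_measurable borel"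
  unfolding damping_def by measurable

lemma damping_nonneg [simp]: "0 \<le> damping \<xi> z"
  by (simp add: damping_def)

lemma abs_damping_le: "0 \<le> \<xi> \<Longrightarrow> \<bar>damping \<xi> z\<bar> \<le> 1"
  by (auto simp: damping_def indicator_def)

lemma integrable_damping:
  "integrable lborel k \<Longrightarrow> 0 \<le> \<xi> \<Longrightarrow> integrable lborel (\<lambda>z. k z * damping \<xi> z)"
  using integrable_scaleR_bounded[of k "damping \<xi>" 1] abs_damping_le[of \<xi>] by simp

lemma laplace_0:
  assumes "half_line_kernel k"
  shows "laplace k 0 = (LINT z|lborel. k z)"
  unfolding laplace_def using assms
  by (intro Bochner_Integration.integral_cong) (auto simp: damping_def indicator_def half_line_kernel_def)

lemma half_line_kernel_diff:
  "half_line_kernel k \<Longrightarrow> half_line_kernel l \<Longrightarrow> half_line_kernel (\<lambda>z. k z - l z)"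
  by (simp add: half_line_kernel_def)

lemma half_line_kernel_scale:
  "half_line_kernel k \<Longrightarrow> half_line_kernel (\<lambda>z. c * k z)"
  by (simp add: half_line_kernel_def)

lemma laplace_diff:
  "half_line_kernel k \<Longrightarrow> half_line_kernel l \<Longrightarrow> 0 \<le> \<xi> \<Longrightarrow>
    laplace (\<lambda>z. k z - l z) \<xi> = laplace k \<xi> - laplace l \<xi>"
  unfolding laplace_def by (simp add: left_diff_distrib integrable_damping half_line_kernel_integrable)

lemma laplace_scale: "laplace (\<lambda>z. c * k z) \<xi> = c * laplace k \<xi>"
  unfolding laplace_def by (simp add: mult.assoc)

lemma half_line_kernel_conv:
  assumes k: "half_line_kernel k" and l: "half_line_kernel l"
  shows "half_line_kernel (kernel_conv k l)"
proof -
  have "k y * l (z - y) = 0" if "z < 0" for y z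
    using k l that by (cases "y < 0") (auto simp: half_line_kernel_def)
  then have "kernel_conv k l z = 0" if "z < 0" for z
    unfolding kernel_conv_def using that
    by (intro integral_eq_zero_AE AE_I2)
  then show ?thesis
    using k l integrable_kernel_conv[of k l] by (simp add: half_line_kernel_def)
qed

lemma laplace_kernel_conv:
  assumes k: "half_line_kernel k" and l: "half_line_kernel l" and \<xi>: "0 \<le> \<xi>"
  shows "laplace (kernel_conv k l) \<xi> = laplace k \<xi> * laplace l \<xi>"
proof -
  have "laplace (kernel_conv k l) \<xi>
      = (LINT y|lborel. k y * (LINT z|lborel. l z * damping \<xi> (y + z)))"
    unfolding laplace_def
    using integral_kernel_conv[of k l "damping \<xi>" 1] k l abs_damping_le[OF \<xi>]
    by (simp add: half_line_kernel_integrable)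
  also have "\<dots> = (LINT y|lborel. k y * damping \<xi> y * laplace l \<xi>)"
  proof (rule Bochner_Integration.integral_cong[OF refl])
    fix y
    have "l z * damping \<xi> (y + z) = damping \<xi> y * (l z * damping \<xi> z)" if "0 \<le> y" for z
      using l that by (cases "z < 0")
        (auto simp: half_line_kernel_def damping_def indicator_def distrib_left simp flip: exp_add)
    then have "(LINT z|lborel. l z * damping \<xi> (y + z)) = (LINT z|lborel. damping \<xi> y * (l z * damping \<xi> z))"
      if "0 \<le> y"
      using that by (intro Bochner_Integration.integral_cong refl)
    then have "(LINT z|lborel. l z * damping \<xi> (y + z)) = damping \<xi> y * laplace l \<xi>" if "0 \<le> y"
      using that unfolding laplace_def by simp
    then show "k y * (LINT z|lborel. l z * damping \<xi> (y + z)) = k y * damping \<xi> y * laplace l \<xi>"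
      using k by (cases "y < 0") (auto simp: half_line_kernel_def)
  qed
  finally show ?thesis by (simp add: laplace_def)
qed

subsection \<open>Uniqueness\<close>

text \<open>
  In the variable \<open>u = exp (- z)\<close> the half-line becomes \<open>{0<..1}\<close>, and the transform at the natural
  number \<open>n\<close> is the \<open>n\<close>-th moment.  A test function vanishing for large \<open>z\<close> extends continuously
  to \<open>u = 0\<close>, so Weierstrass approximates it uniformly by polynomials in \<open>u\<close>, which integrate to \<open>0\<close>.
\<close>

lemma laplace_zero_imp_integral_zero_cutoff:
  assumes k: "half_line_kernel k" and zero: "\<And>n::nat. laplace k n = 0"
    and C: "continuous_on UNIV C" and cut: "\<And>z. N \<le> z \<Longrightarrow> C z = (0 :: real)"
    and bounded: "\<And>z. \<bar>C z\<bar> \<le> B"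
  shows "(LINT z|lborel. k z * C z) = 0"
proof -
  \<comment> \<open>Clamping \<open>u\<close> at \<open>exp (- N)\<close>, where \<open>C\<close> already vanishes, extends \<open>C (- ln u)\<close> to \<open>u \<le> 0\<close>.\<close>
  define c where "c u = C (- ln (max u (exp (- N))))" for u
  have c: "C z = c (exp (- z))" for z
    using cut[of z] cut[of N] by (cases "z \<le> N") (auto simp: c_def max_def)
  have "continuous_on {0..1} c"
    unfolding c_def
    by (intro continuous_on_compose2[OF C] continuous_intros) (auto simp: max_def less_le_not_le[of "exp _" 0])
  have k0: "k z = 0" if "z < 0" for z using k that by (simp add: half_line_kernel_def)
  have int: "integrable lborel k" using k by (rule half_line_kernel_integrable)
  have [measurable]: "C \<in> borel_measurable borel"
    by (rule borel_measurable_continuous_onI[OF C])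
  have kC: "integrable lborel (\<lambda>z. k z * C z)"
    using integrable_scaleR_bounded[OF int, of C B] bounded by simp
  have "\<bar>LINT z|lborel. k z * C z\<bar> \<le> e * (LINT z|lborel. \<bar>k z\<bar>)" if "e > 0" for e
  proof -
    obtain g where "real_polynomial_function g" and g: "\<And>u. u \<in> {0..1} \<Longrightarrow> \<bar>c u - g u\<bar> < e"
      using Stone_Weierstrass_real_polynomial_function[OF _ \<open>continuous_on {0..1} c\<close> \<open>e > 0\<close>] by auto
    then obtain a n where a: "g = (\<lambda>u. \<Sum>i\<le>n. a i * u ^ i)"
      unfolding real_polynomial_function_iff_sum by blast
    define G where "G z = (\<Sum>i\<le>n. a i * (k z * damping (real i) z))" for z
    have G: "G z = k z * g (exp (- z))" for z
      using k0 by (cases "z < 0")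
        (auto simp: G_def a damping_def sum_distrib_left mult.left_commute simp flip: exp_of_nat_mult)
    have intG: "integrable lborel G"
      unfolding G_def by (intro Bochner_Integration.integrable_sum integrable_mult_right integrable_damping int) simp
    have "(LINT z|lborel. G z) = (\<Sum>i\<le>n. a i * laplace k (real i))"
      unfolding G_def laplace_def
      by (subst Bochner_Integration.integral_sum) (auto intro!: integrable_damping int)
    then have "(LINT z|lborel. k z * C z) = (LINT z|lborel. k z * C z - G z)"
      using kC intG zero by simp
    also have "\<bar>\<dots>\<bar> \<le> (LINT z|lborel. \<bar>k z * C z - G z\<bar>)"
      using integral_norm_bound[of lborel "\<lambda>z. k z * C z - G z"] by simp
    also have "\<dots> \<le> (LINT z|lborel. e * \<bar>k z\<bar>)"
    proof (rule integral_mono)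
      fix z
      show "\<bar>k z * C z - G z\<bar> \<le> e * \<bar>k z\<bar>"
      proof (cases "z < 0")
        case False
        then have "\<bar>c (exp (- z)) - g (exp (- z))\<bar> \<le> e"
          using g[of "exp (- z)"] by (simp add: less_imp_le)
        then have "\<bar>k z\<bar> * \<bar>c (exp (- z)) - g (exp (- z))\<bar> \<le> \<bar>k z\<bar> * e"
          by (rule mult_left_mono) simp
        then show ?thesis
          by (simp add: G c mult.commute flip: abs_mult right_diff_distrib)
      qed (simp add: k0 G)
    qed (use kC intG int in auto)
    finally show ?thesis by simp
  qed
  then have "((\<lambda>e. e * (LINT z|lborel. \<bar>k z\<bar>)) \<longlongrightarrow> 0 * (LINT z|lborel. \<bar>k z\<bar>)) (at_right 0) \<Longrightarrow>
      \<bar>LINT z|lborel. k z * C z\<bar> \<le> 0 * (LINT z|lborel. \<bar>k z\<bar>)"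
    by (intro tendsto_lowerbound) (auto simp: eventually_at_right_less elim: eventually_mono[OF eventually_at_right_less])
  moreover have "((\<lambda>e. e * (LINT z|lborel. \<bar>k z\<bar>)) \<longlongrightarrow> 0 * (LINT z|lborel. \<bar>k z\<bar>)) (at_right 0)"
    by (intro tendsto_intros)
  ultimately show ?thesis by simp
qed

text \<open>
  The test functions \<open>z \<mapsto> \<langle>\<tau>\<^sub>z f, g\<rangle>\<close> do not vanish for large \<open>z\<close>; they are cut off and recovered by
  dominated convergence.
\<close>

lemma laplace_zero_imp_integral_zero:
  assumes k: "half_line_kernel k" and zero: "\<And>n::nat. laplace k n = 0"
    and C: "continuous_on UNIV C" and bounded: "\<And>z. \<bar>C z\<bar> \<le> (B :: real)"
  shows "(LINT z|lborel. k z * C z) = 0"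
proof -
  have int: "integrable lborel k" using k by (rule half_line_kernel_integrable)
  have [measurable]: "C \<in> borel_measurable borel" "k \<in> borel_measurable borel"
    using borel_measurable_continuous_onI[OF C] borel_measurable_integrable[OF int] by simp_all
  define \<eta> where "\<eta> n z = max 0 (min 1 (real n - z))" for n z
  have \<eta>: "0 \<le> \<eta> n z" "\<eta> n z \<le> 1" for n z by (auto simp: \<eta>_def)
  have B: "\<bar>C z * \<eta> n z\<bar> \<le> B" for n z
    using mult_mono[OF bounded[of z] \<eta>(2)[of n z]] \<eta>(1)[of n z] bounded[of z]
    by (simp add: abs_mult)
  have "(LINT z|lborel. k z * (C z * \<eta> n z)) = 0" for n
  proof (rule laplace_zero_imp_integral_zero_cutoff[OF k zero _ _ B])
    show "continuous_on UNIV (\<lambda>z. C z * \<eta> n z)"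
      unfolding \<eta>_def by (intro continuous_intros C)
    show "C z * \<eta> n z = 0" if "real n \<le> z" for z
      using that by (simp add: \<eta>_def)
  qed
  moreover have "(\<lambda>n. LINT z|lborel. k z * (C z * \<eta> n z)) \<longlonglongrightarrow> (LINT z|lborel. k z * C z)"
  proof (rule integral_dominated_convergence[where w = "\<lambda>z. B * \<bar>k z\<bar>"])
    show "AE z in lborel. (\<lambda>n. k z * (C z * \<eta> n z)) \<longlonglongrightarrow> k z * C z"
    proof (rule AE_I2)
      fix z
      obtain m :: nat where m: "z + 1 \<le> real m" using real_arch_simple by blast
      have "\<forall>\<^sub>F n in sequentially. k z * (C z * \<eta> n z) = k z * C z"
      proof (rule eventually_sequentiallyI[of m])
        fix n assume "m \<le> n"
        then have "real m \<le> real n" by simp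
        with m have "1 \<le> real n - z" by linarith
        then show "k z * (C z * \<eta> n z) = k z * C z" by (simp add: \<eta>_def)
      qed
      then show "(\<lambda>n. k z * (C z * \<eta> n z)) \<longlonglongrightarrow> k z * C z" by (rule tendsto_eventually)
    qed
    show "AE z in lborel. norm (k z * (C z * \<eta> n z)) \<le> B * \<bar>k z\<bar>" for n
    proof (rule AE_I2)
      show "norm (k z * (C z * \<eta> n z)) \<le> B * \<bar>k z\<bar>" for z
        using mult_left_mono[OF B[of z n], of "\<bar>k z\<bar>"] by (simp add: abs_mult mult.commute)
    qed
  qed (use int in \<open>auto simp: \<eta>_def\<close>)
  ultimately show ?thesis by (simp add: LIMSEQ_const_iff)
qed

text \<open>
  The principle behind every operator identity below: it suffices to compare functions of \<open>\<xi>\<close>.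
\<close>

lemma average_eqI_laplace:
  assumes k: "half_line_kernel k" and l: "half_line_kernel l"
    and eq: "\<And>\<xi>. 0 \<le> \<xi> \<Longrightarrow> laplace k \<xi> = laplace l \<xi>"
  shows "average k f = average l f"
proof -
  let ?d = "\<lambda>z. k z - l z"
  have d: "half_line_kernel ?d" using k l by (rule half_line_kernel_diff)
  have "inner (average ?d f) g = 0" for g
  proof -
    have "(LINT z|lborel. ?d z * inner (translate z f) g) = 0"
    proof (rule laplace_zero_imp_integral_zero[OF d])
      show "laplace ?d (real n) = 0" for n
        using k l by (simp add: laplace_diff eq)
      show "continuous_on UNIV (\<lambda>z. inner (translate z f) g)"
        by (intro continuous_intros continuous_on_translate)
      show "\<bar>inner (translate z f) g\<bar> \<le> norm f * norm g" for z
        using Cauchy_Schwarz_ineq2[of "translate z f" g] by simp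
    qed
    then show ?thesis
      using d by (simp add: inner_average half_line_kernel_integrable)
  qed
  from this[of "average ?d f"] have "average ?d f = 0" by simp
  then show ?thesis
    using average_diff[of k l f] k l by (simp add: half_line_kernel_integrable)
qed

lemma average_commute:
  assumes "half_line_kernel k" "half_line_kernel l"
  shows "average k (average l f) = average l (average k f)"
  using assms
  by (simp flip: average_kernel_conv add: half_line_kernel_integrable)
    (intro average_eqI_laplace, auto simp: laplace_kernel_conv half_line_kernel_conv)

subsection \<open>Approximate identities\<close>

text \<open>
  Convergence of the transform at the single point \<open>1\<close> already forces the probability densities to
  concentrate at \<open>0\<close>: away from \<open>0\<close> the deviation \<open>\<parallel>\<tau>\<^sub>z f - f\<parallel> \<le> 2 \<parallel>f\<parallel>\<close> is at most a multiple of
  \<open>1 - exp (- z)\<close>, whose mean is \<open>1 - laplace k 1\<close>.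
\<close>

lemma average_tendsto_id:
  assumes kernel: "\<forall>\<^sub>F i in F. half_line_kernel (k i) \<and> (\<forall>z. 0 \<le> k i z) \<and> laplace (k i) 0 = 1"
    and lim: "((\<lambda>i. laplace (k i) 1) \<longlongrightarrow> 1) F"
  shows "((\<lambda>i. average (k i) f) \<longlongrightarrow> f) F"
proof (rule tendstoI)
  fix e :: real assume "e > 0"
  have "\<forall>\<^sub>F z in at 0. dist (translate z f) f < e / 2"
    using tendsto_translate_0[of f] \<open>e > 0\<close> by (intro tendstoD) simp_all
  then obtain d where d0: "d > 0" "\<And>z. z \<noteq> 0 \<Longrightarrow> \<bar>z\<bar> < d \<Longrightarrow> dist (translate z f) f < e / 2"
    unfolding eventually_at dist_real_def by auto
  have d: "d > 0" "\<And>z. \<bar>z\<bar> < d \<Longrightarrow> dist (translate z f) f < e / 2"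
    using d0 \<open>e > 0\<close> by (metis, metis dist_self half_gt_zero translate_0)
  \<comment> \<open>\<open>1 - exp (- z)\<close> is smallest on \<open>{d..}\<close> at \<open>d\<close>, where \<open>B\<close> times it equals \<open>2 \<parallel>f\<parallel>\<close>.\<close>
  define B where "B = 2 * norm f / (1 - exp (- d))"
  have "exp (- d) < 1" using d(1) by simp
  then have B: "0 \<le> B" by (simp add: B_def)
  have bound: "norm (translate z f - f) \<le> e / 2 + B * (1 - damping 1 z)" if "0 \<le> z" for z
  proof (cases "z < d")
    case True
    then have "norm (translate z f - f) < e / 2"
      using d(2)[of z] that by (simp add: dist_norm)
    moreover have "0 \<le> B * (1 - damping 1 z)"
      using B abs_damping_le[of 1 z] by simp
    ultimately show ?thesis by linarith
  next
    case False
    have "norm (translate z f - f) \<le> 2 * norm f"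
      using norm_triangle_ineq4[of "translate z f" f] by simp
    also have "\<dots> = B * (1 - exp (- d))"
      using \<open>exp (- d) < 1\<close> by (simp add: B_def)
    also have "\<dots> \<le> B * (1 - damping 1 z)"
      using False B that by (intro mult_left_mono) (auto simp: damping_def)
    finally show ?thesis using \<open>e > 0\<close> by simp
  qed
  have "((\<lambda>i. e / 2 + B * (1 - laplace (k i) 1)) \<longlongrightarrow> e / 2 + B * (1 - 1)) F"
    by (intro tendsto_intros lim)
  then have "\<forall>\<^sub>F i in F. e / 2 + B * (1 - laplace (k i) 1) < e"
    by (rule order_tendstoD(2)) (use \<open>e > 0\<close> in simp)
  with kernel show "\<forall>\<^sub>F i in F. dist (average (k i) f) f < e"
  proof eventually_elim
    fix i
    assume i: "half_line_kernel (k i) \<and> (\<forall>z. 0 \<le> k i z) \<and> laplace (k i) 0 = 1"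
      and less: "e / 2 + B * (1 - laplace (k i) 1) < e"
    then have int: "integrable lborel (k i)" and mass: "(LINT z|lborel. k i z) = 1"
      by (auto simp: half_line_kernel_def laplace_0)
    have int1: "integrable lborel (\<lambda>z. k i z * damping 1 z)"
      by (rule integrable_damping[OF int]) simp
    have intd: "integrable lborel (\<lambda>z. k i z *\<^sub>R (translate z f - f))"
      using integrable_average[OF int, of f] int by (simp add: scaleR_diff_right)
    have "average (k i) f - f = (LINT z|lborel. k i z *\<^sub>R translate z f) - (LINT z|lborel. k i z *\<^sub>R f)"
      using int mass by (simp add: average_def)
    also have "\<dots> = (LINT z|lborel. k i z *\<^sub>R (translate z f - f))"
      using integrable_average[OF int, of f] int by (simp add: scaleR_diff_right)
    finally have "norm (average (k i) f - f) \<le> (LINT z|lborel. norm (k i z *\<^sub>R (translate z f - f)))"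
      by (simp only: integral_norm_bound)
    also have "\<dots> \<le> (LINT z|lborel. e / 2 * k i z + B * (k i z - k i z * damping 1 z))"
    proof (rule integral_mono)
      show "integrable lborel (\<lambda>z. norm (k i z *\<^sub>R (translate z f - f)))"
        using intd by (rule integrable_norm)
      show "integrable lborel (\<lambda>z. e / 2 * k i z + B * (k i z - k i z * damping 1 z))"
        using int int1 by auto
      fix z
      show "norm (k i z *\<^sub>R (translate z f - f)) \<le> e / 2 * k i z + B * (k i z - k i z * damping 1 z)"
      proof (cases "z < 0")
        case True
        then show ?thesis using i by (simp add: half_line_kernel_def)
      next
        case False
        have "norm (k i z *\<^sub>R (translate z f - f)) = k i z * norm (translate z f - f)"
          using i by simp
        also have "\<dots> \<le> k i z * (e / 2 + B * (1 - damping 1 z))"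
          using i False by (intro mult_left_mono bound) auto
        also have "\<dots> = e / 2 * k i z + B * (k i z - k i z * damping 1 z)"
          by (simp add: algebra_simps)
        finally show ?thesis .
      qed
    qed
    also have "\<dots> = e / 2 + B * (1 - laplace (k i) 1)"
      using int int1 mass by (simp add: laplace_def)
    finally show "dist (average (k i) f) f < e" using less by (simp add: dist_norm)
  qed
qed

section \<open>Gamma integrals\<close>

text \<open>
  Euler's integral after the substitution \<open>t = p s\<close>.
\<close>

lemma nn_integral_Gamma:
  fixes a p :: real
  assumes a: "a > 0" and p: "p > 0"
  shows "(\<integral>\<^sup>+s. ennreal (indicator {0<..} s * (s powr (a - 1) * exp (- (s * p)))) \<partial>lborel)
    = ennreal (Gamma a / p powr a)"
proof -
  let ?J = "\<integral>\<^sup>+s. ennreal (indicator {0<..} s * (s powr (a - 1) * exp (- (s * p)))) \<partial>lborel"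
  have "ennreal (Gamma a) = (\<integral>\<^sup>+t. ennreal (indicator {0..} t * t powr (a - 1) / exp t) \<partial>lborel)"
    by (rule Gamma_conv_nn_integral_real[OF a])
  also have "\<dots> = ennreal \<bar>p\<bar> * (\<integral>\<^sup>+s. ennreal (indicator {0..} (0 + p * s) * (0 + p * s) powr (a - 1) / exp (0 + p * s)) \<partial>lborel)"
    using p by (intro nn_integral_real_affine) auto
  also have "(\<integral>\<^sup>+s. ennreal (indicator {0..} (0 + p * s) * (0 + p * s) powr (a - 1) / exp (0 + p * s)) \<partial>lborel)
      = (\<integral>\<^sup>+s. ennreal (p powr (a - 1)) * ennreal (indicator {0<..} s * (s powr (a - 1) * exp (- (s * p)))) \<partial>lborel)"
  proof (rule nn_integral_cong)
    fix s :: real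
    consider "s < 0" | "s = 0" | "s > 0" by linarith
    then show "ennreal (indicator {0..} (0 + p * s) * (0 + p * s) powr (a - 1) / exp (0 + p * s))
        = ennreal (p powr (a - 1)) * ennreal (indicator {0<..} s * (s powr (a - 1) * exp (- (s * p))))"
    proof cases
      case 1
      then have "p * s < 0" using p by (rule mult_pos_neg[rotated])
      then show ?thesis using 1 by simp
    next
      case 3
      then show ?thesis
        using p by (simp add: powr_mult exp_minus divide_inverse mult_ac flip: ennreal_mult)
    qed simp
  qed
  also have "\<dots> = ennreal (p powr (a - 1)) * ?J"
    by (rule nn_integral_cmult) simp
  also have "ennreal \<bar>p\<bar> * (ennreal (p powr (a - 1)) * ?J) = ennreal (p powr a) * ?J"
    using p by (simp add: powr_diff flip: mult.assoc ennreal_mult)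
  finally have J: "ennreal (Gamma a) = ennreal (p powr a) * ?J" .
  have "?J = (ennreal (1 / p powr a) * ennreal (p powr a)) * ?J"
    using p by (simp flip: ennreal_mult)
  also have "\<dots> = ennreal (1 / p powr a) * ennreal (Gamma a)"
    unfolding J by (simp add: mult.assoc)
  also have "\<dots> = ennreal (Gamma a / p powr a)"
    using Gamma_real_pos[OF a] by (simp flip: ennreal_mult add: less_imp_le)
  finally show ?thesis .
qed

lemma
  fixes a p :: real
  assumes a: "a > 0" and p: "p > 0"
  shows set_integrable_Gamma: "set_integrable lborel {0<..} (\<lambda>s. s powr (a - 1) * exp (- (s * p)))"
    and set_integral_Gamma: "(LINT s:{0<..}|lborel. s powr (a - 1) * exp (- (s * p))) = Gamma a / p powr a"
proof -
  have "has_bochner_integral lborel (\<lambda>s. indicator {0<..} s * (s powr (a - 1) * exp (- (s * p))))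
      (Gamma a / p powr a)"
    by (rule has_bochner_integral_nn_integral)
      (use nn_integral_Gamma[OF a p] Gamma_real_pos[OF a] in \<open>auto simp: less_imp_le\<close>)
  then show "set_integrable lborel {0<..} (\<lambda>s. s powr (a - 1) * exp (- (s * p)))"
    "(LINT s:{0<..}|lborel. s powr (a - 1) * exp (- (s * p))) = Gamma a / p powr a"
    by (auto simp: set_integrable_def set_lebesgue_integral_def has_bochner_integral_iff)
qed

section \<open>Resolvents of contraction semigroups\<close>

lemma set_average_tendsto:
  fixes F :: "real \<Rightarrow> 'a :: {banach, second_countable_topology}"
  assumes int: "\<And>t. set_integrable lborel {0<..t} F" and lim: "(F \<longlongrightarrow> L) (at_right 0)"
  shows "((\<lambda>t. (LINT s:{0<..t}|lborel. F s) /\<^sub>R t) \<longlongrightarrow> L) (at_right 0)"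
proof (rule tendstoI)
  fix e :: real assume "e > 0"
  have "\<forall>\<^sub>F s in at_right 0. dist (F s) L < e / 2"
    using lim \<open>e > 0\<close> by (intro tendstoD) simp_all
  then obtain d where d: "d > 0" "\<And>s. 0 < s \<Longrightarrow> s < d \<Longrightarrow> norm (F s - L) < e / 2"
    unfolding eventually_at_right_field dist_norm by auto
  have "\<forall>\<^sub>F t in at_right 0. 0 < t \<and> t < d"
    using d(1) unfolding eventually_at_right_field by auto
  then show "\<forall>\<^sub>F t in at_right 0. dist ((LINT s:{0<..t}|lborel. F s) /\<^sub>R t) L < e"
  proof eventually_elim
    fix t assume t: "0 < t \<and> t < d"
    have intL: "set_integrable lborel {0<..t} (\<lambda>s. L)"
      unfolding set_integrable_def using t
      by (intro integrable_scaleR_left integrable_real_indicator) auto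
    have L: "L = (LINT s:{0<..t}|lborel. L) /\<^sub>R t"
      using t by (subst set_integral_const) auto
    have "norm (LINT s:{0<..t}|lborel. F s - L) \<le> (LINT s:{0<..t}|lborel. norm (F s - L))"
      by (intro set_integral_norm_bound set_integral_diff int intL)
    also have "\<dots> \<le> (LINT s:{0<..t}|lborel. e / 2)"
      using t d(2)
      by (intro set_integral_mono set_integrable_norm set_integral_diff int intL)
        (auto simp: set_integrable_def less_imp_le)
    also have "\<dots> = t * (e / 2)"
      using t by (subst set_integral_const) auto
    also have "(LINT s:{0<..t}|lborel. F s - L) = (LINT s:{0<..t}|lborel. F s) - (LINT s:{0<..t}|lborel. L)"
      by (intro set_integral_diff int intL)
    finally have "norm ((LINT s:{0<..t}|lborel. F s) - (LINT s:{0<..t}|lborel. L)) / t \<le> e / 2"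
      using t by (simp add: field_simps)
    moreover have "norm ((LINT s:{0<..t}|lborel. F s) /\<^sub>R t - L)
        = norm ((LINT s:{0<..t}|lborel. F s) - (LINT s:{0<..t}|lborel. L)) / t"
      using t by (subst L) (simp add: divide_inverse mult.commute flip: scaleR_diff_right)
    ultimately show "dist ((LINT s:{0<..t}|lborel. F s) /\<^sub>R t) L < e"
      using \<open>e > 0\<close> unfolding dist_norm by linarith
  qed
qed

locale contraction_semigroup =
  fixes S :: "real \<Rightarrow> 'a :: {banach, second_countable_topology} \<Rightarrow>\<^sub>L 'a"
  assumes c0: "c0_semigroup S"
    and contraction: "\<And>s f. 0 \<le> s \<Longrightarrow> norm (S s f) \<le> norm f"
begin

lemma semigroup_add: "0 \<le> s \<Longrightarrow> 0 \<le> t \<Longrightarrow> S (s + t) f = S s (S t f)"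
  using c0 by (simp add: c0_semigroup_def)

lemma tendsto_0: "((\<lambda>s. S s f) \<longlongrightarrow> f) (at_right 0)"
  using c0 by (simp add: c0_semigroup_def)

lemma norm_diff_le:
  assumes "0 \<le> s" "0 \<le> t"
  shows "norm (S s f - S t f) \<le> norm (S \<bar>s - t\<bar> f - f)"
proof -
  have le: "norm (S b f - S a f) \<le> norm (S (b - a) f - f)" if "0 \<le> a" "a \<le> b" for a b
  proof -
    have "S b f - S a f = S a (S (b - a) f - f)"
      using semigroup_add[of a "b - a" f] that by (simp add: blinfun.diff_right)
    then show ?thesis using contraction[OF that(1)] by metis
  qed
  show ?thesis
    using le[of s t] le[of t s] assms by (cases "s \<le> t") (auto simp: norm_minus_commute)
qed

lemma continuous_on_orbit: "continuous_on {0..} (\<lambda>s. S s f)"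
  unfolding continuous_on_iff
proof (intro ballI allI impI)
  fix s :: real and e :: real assume s: "s \<in> {0..}" and "0 < e"
  have "\<forall>\<^sub>F u in at_right 0. dist (S u f) f < e"
    using tendsto_0 \<open>e > 0\<close> by (intro tendstoD) simp_all
  then obtain d where d: "d > 0" "\<And>u. 0 < u \<Longrightarrow> u < d \<Longrightarrow> norm (S u f - f) < e"
    unfolding eventually_at_right_field dist_norm by auto
  show "\<exists>d>0. \<forall>t\<in>{0..}. dist t s < d \<longrightarrow> dist (S t f) (S s f) < e"
  proof (intro exI[of _ d] conjI ballI impI d(1))
    fix t :: real assume t: "t \<in> {0..}" "dist t s < d"
    show "dist (S t f) (S s f) < e"
    proof (cases "t = s")
      case False
      then show ?thesis
        using norm_diff_le[of t s f] d(2)[of "\<bar>t - s\<bar>"] s t by (simp add: dist_norm)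
    qed (use \<open>0 < e\<close> in simp)
  qed
qed

lemma set_integrable_orbit:
  fixes w :: "real \<Rightarrow> real"
  assumes "set_integrable lborel A w" "A \<in> sets borel" "A \<subseteq> {0..}"
  shows "set_integrable lborel A (\<lambda>s. w s *\<^sub>R S s f)"
  unfolding set_integrable_def
proof (rule Bochner_Integration.integrable_bound)
  have w: "integrable lborel (\<lambda>s. indicator A s *\<^sub>R w s)"
    using assms(1) by (simp add: set_integrable_def)
  then show "integrable lborel (\<lambda>s. norm f * (indicator A s *\<^sub>R w s))"
    by (rule integrable_mult_right)
  have "(\<lambda>s. indicator A s *\<^sub>R S s f) \<in> borel_measurable borel"
    using assms(2,3) continuous_on_orbit
    by (intro borel_measurable_continuous_on_indicator) (auto intro: continuous_on_subset)
  then have "(\<lambda>s. (indicator A s *\<^sub>R w s) *\<^sub>R (indicator A s *\<^sub>R S s f)) \<in> borel_measurable borel"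
    using borel_measurable_integrable[OF w] by measurable
  also have "(\<lambda>s. (indicator A s *\<^sub>R w s) *\<^sub>R (indicator A s *\<^sub>R S s f)) = (\<lambda>s. indicator A s *\<^sub>R w s *\<^sub>R S s f)"
    by (auto simp: indicator_def)
  finally show "(\<lambda>s. indicator A s *\<^sub>R w s *\<^sub>R S s f) \<in> borel_measurable lborel" by simp
  show "AE s in lborel. norm (indicator A s *\<^sub>R w s *\<^sub>R S s f) \<le> norm (norm f * (indicator A s *\<^sub>R w s))"
  proof (rule AE_I2)
    fix s
    show "norm (indicator A s *\<^sub>R w s *\<^sub>R S s f) \<le> norm (norm f * (indicator A s *\<^sub>R w s))"
      using assms(3) mult_left_mono[OF contraction[of s f], of "\<bar>w s\<bar>"]
      by (auto simp: indicator_def abs_mult mult.commute)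
  qed
qed

definition resolvent :: "'a \<Rightarrow> 'a" where
  "resolvent f = (LINT s:{0<..}|lborel. exp (- s) *\<^sub>R S s f)"

lemma set_integrable_exp: "set_integrable lborel {0<..} (\<lambda>s::real. exp (- s))"
  using set_integrable_Gamma[of 1 1]
  by (rule set_integrable_cong[THEN iffD1, rotated 3]) auto

lemma set_integrable_resolvent: "set_integrable lborel {0<..} (\<lambda>s. exp (- s) *\<^sub>R S s f)"
  by (rule set_integrable_orbit[OF set_integrable_exp]) auto

lemma bounded_linear_resolvent: "bounded_linear resolvent"
proof (rule bounded_linear_intro)
  note int = set_integrable_resolvent
  show "resolvent (f + g) = resolvent f + resolvent g" for f g
    unfolding resolvent_def using set_integral_add(2)[OF int int, of f g]
    by (simp add: blinfun.add_right scaleR_add_right)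
  show "resolvent (c *\<^sub>R f) = c *\<^sub>R resolvent f" for c f
    unfolding resolvent_def by (simp add: blinfun.scaleR_right scaleR_left_commute[of _ c] del: scaleR_scaleR)
  have "norm (resolvent f) \<le> (LINT s:{0<..}|lborel. norm (exp (- s) *\<^sub>R S s f))" for f
    unfolding resolvent_def by (rule set_integral_norm_bound[OF int])
  moreover have "(LINT s:{0<..}|lborel. norm (exp (- s) *\<^sub>R S s f)) \<le> (LINT s:{0<..}|lborel. exp (- s) * norm f)" for f
  proof (rule set_integral_mono)
    show "set_integrable lborel {0<..} (\<lambda>s. norm (exp (- s) *\<^sub>R S s f))"
      by (rule set_integrable_norm[OF int])
    show "set_integrable lborel {0<..} (\<lambda>s. exp (- s) * norm f)"
      using set_integrable_exp by (rule set_integrable_mult_left)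
  qed (simp add: contraction)
  ultimately have "norm (resolvent f) \<le> (LINT s:{0<..}|lborel. exp (- s) * norm f)" for f
    by (rule order_trans)
  then show "norm (resolvent f) \<le> norm f * (LINT s:{0<..}|lborel. exp (- s))" for f
    by (simp add: mult.commute)
qed

lemma semigroup_resolvent:
  assumes t: "0 \<le> t"
  shows "S t (resolvent f) = (LINT s:{0<..}|lborel. exp (- s) *\<^sub>R S (t + s) f)"
proof -
  have "S t (resolvent f) = (LINT s|lborel. S t (indicator {0<..} s *\<^sub>R exp (- s) *\<^sub>R S s f))"
    unfolding resolvent_def set_lebesgue_integral_def
    using set_integrable_resolvent[of f, unfolded set_integrable_def]
    by (rule integral_bounded_linear[OF blinfun.bounded_linear_right, symmetric])
  also have "\<dots> = (LINT s:{0<..}|lborel. exp (- s) *\<^sub>R S (t + s) f)"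
    unfolding set_lebesgue_integral_def using t
    by (intro Bochner_Integration.integral_cong)
      (auto simp: blinfun.scaleR_right semigroup_add indicator_def)
  finally show ?thesis .
qed

lemma resolvent_commute:
  assumes "0 \<le> t"
  shows "resolvent (S t f) = S t (resolvent f)"
proof -
  have "S s (S t f) = S (t + s) f" if "0 < s" for s
    using semigroup_add[of s t f] assms that by (simp add: add.commute)
  then show ?thesis
    unfolding semigroup_resolvent[OF assms] unfolding resolvent_def
    by (intro set_lebesgue_integral_cong) auto
qed

text \<open>
  Translating the integral by \<open>t\<close> turns \<open>\<integral>\<^sub>0\<^sup>\<infinity> e\<^sup>-\<^sup>s S(t + s) f ds\<close> into \<open>e\<^sup>t\<close> times the tail of the
  resolvent integral.
\<close>

lemma semigroup_resolvent_difference: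
  assumes t: "0 < t"
  shows "S t (resolvent f) = exp t *\<^sub>R (resolvent f - (LINT s:{0<..t}|lborel. exp (- s) *\<^sub>R S s f))"
proof -
  have split: "resolvent f = (LINT s:{0<..t}|lborel. exp (- s) *\<^sub>R S s f) + (LINT s:{t<..}|lborel. exp (- s) *\<^sub>R S s f)"
  proof -
    have eq: "{0<..} = {0<..t} \<union> {t<..}" using t by auto
    show ?thesis
      unfolding resolvent_def eq
    proof (rule set_integral_Un)
      show "set_integrable lborel {0<..t} (\<lambda>s. exp (- s) *\<^sub>R S s f)"
        "set_integrable lborel {t<..} (\<lambda>s. exp (- s) *\<^sub>R S s f)"
        by (rule set_integrable_subset[OF set_integrable_resolvent]; use t in auto)+
    qed auto
  qed
  have "S t (resolvent f) = (LINT s|lborel. exp t *\<^sub>R (indicator {t<..} (s + t) *\<^sub>R exp (- (s + t)) *\<^sub>R S (s + t) f))"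
    unfolding semigroup_resolvent[OF less_imp_le[OF t]] set_lebesgue_integral_def
    by (intro Bochner_Integration.integral_cong refl)
      (auto simp: indicator_def add.commute simp flip: exp_add)
  also have "\<dots> = exp t *\<^sub>R (LINT s|lborel. indicator {t<..} (s + t) *\<^sub>R exp (- (s + t)) *\<^sub>R S (s + t) f)"
    by (rule integral_scaleR_right)
  also have "(LINT s|lborel. indicator {t<..} (s + t) *\<^sub>R exp (- (s + t)) *\<^sub>R S (s + t) f)
      = (LINT s:{t<..}|lborel. exp (- s) *\<^sub>R S s f)"
    unfolding set_lebesgue_integral_def
    by (rule integral_lborel_translate[of "\<lambda>s. indicator {t<..} s *\<^sub>R exp (- s) *\<^sub>R S s f"])
  finally show ?thesis using split by simp
qed

text \<open>
  This lemma and the next say that the resolvent is \<open>(1 - G)\<^sup>-\<^sup>1\<close> for the generator \<open>G\<close>: it maps into the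
  domain and is a right inverse; below it is shown to be a left inverse on the domain.
\<close>

lemma generator_resolvent: "generator_graph S (resolvent f) (resolvent f - f)"
  unfolding generator_graph_def
proof (rule Lim_transform_eventually)
  have "((\<lambda>t. (exp t - exp 0) / (t - 0)) \<longlongrightarrow> exp 0) (at (0::real))"
    using DERIV_exp[of "0::real"] unfolding has_field_derivative_iff by simp
  then have exp': "((\<lambda>t. (exp t - 1) / t) \<longlongrightarrow> 1) (at_right (0::real))"
    by (simp add: filterlim_at_split)
  have "((\<lambda>s. exp (- s) *\<^sub>R S s f) \<longlongrightarrow> exp (- 0) *\<^sub>R f) (at_right 0)"
    by (intro tendsto_intros tendsto_0)
  then have "((\<lambda>t. (LINT s:{0<..t}|lborel. exp (- s) *\<^sub>R S s f) /\<^sub>R t) \<longlongrightarrow> f) (at_right 0)"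
    by (intro set_average_tendsto set_integrable_subset[OF set_integrable_resolvent]) auto
  then have "((\<lambda>t. ((exp t - 1) / t) *\<^sub>R resolvent f
      - exp t *\<^sub>R ((LINT s:{0<..t}|lborel. exp (- s) *\<^sub>R S s f) /\<^sub>R t))
      \<longlongrightarrow> 1 *\<^sub>R resolvent f - exp 0 *\<^sub>R f) (at_right 0)"
    by (intro tendsto_intros exp')
  then show "((\<lambda>t. ((exp t - 1) / t) *\<^sub>R resolvent f
      - exp t *\<^sub>R ((LINT s:{0<..t}|lborel. exp (- s) *\<^sub>R S s f) /\<^sub>R t))
      \<longlongrightarrow> resolvent f - f) (at_right 0)" by simp
  show "\<forall>\<^sub>F t in at_right 0. ((exp t - 1) / t) *\<^sub>R resolvent f
      - exp t *\<^sub>R ((LINT s:{0<..t}|lborel. exp (- s) *\<^sub>R S s f) /\<^sub>R t)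
      = (S t (resolvent f) - resolvent f) /\<^sub>R t"
    using eventually_at_right_less[of "0::real"]
    by eventually_elim
      (simp add: semigroup_resolvent_difference algebra_simps divide_inverse)
qed

text \<open>
  The resolvent is bounded and commutes with the semigroup, so it may be applied inside the
  difference quotients of \<open>f\<close>, which turns them into those of \<open>resolvent f\<close>.
\<close>

lemma resolvent_generator:
  assumes "generator_graph S f g"
  shows "resolvent (f - g) = f"
proof -
  interpret R: bounded_linear resolvent by (rule bounded_linear_resolvent)
  have "((\<lambda>t. resolvent ((S t f - f) /\<^sub>R t)) \<longlongrightarrow> resolvent g) (at_right 0)"
    using assms unfolding generator_graph_def by (rule R.tendsto)
  moreover have "\<forall>\<^sub>F t in at_right 0. resolvent ((S t f - f) /\<^sub>R t) = (S t (resolvent f) - resolvent f) /\<^sub>R t"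
    using eventually_at_right_less[of "0::real"]
    by eventually_elim (simp add: R.scaleR R.diff resolvent_commute)
  ultimately have "((\<lambda>t. (S t (resolvent f) - resolvent f) /\<^sub>R t) \<longlongrightarrow> resolvent g) (at_right 0)"
    by (rule Lim_transform_eventually)
  then have "resolvent g = resolvent f - f"
    using generator_resolvent[of f] unfolding generator_graph_def
    by (intro tendsto_unique[OF trivial_limit_at_right_real])
  then show ?thesis by (simp add: R.diff)
qed

end

section \<open>Kernels of the truncated Marchaud derivative\<close>

locale fractional_order =
  fixes \<alpha> :: real
  assumes \<alpha>_pos: "0 < \<alpha>" and \<alpha>_less_1: "\<alpha> < 1"
begin

lemma nn_integral_powr_tail:
  assumes "0 < v"
  shows "(\<integral>\<^sup>+u. ennreal (u powr (- \<alpha> - 1)) * indicator {v..} u \<partial>lborel) = ennreal (v powr (- \<alpha>) / \<alpha>)"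
proof -
  have "((\<lambda>u. - (u powr (- \<alpha>) / \<alpha>)) \<longlongrightarrow> - (0 / \<alpha>)) at_top"
    using \<alpha>_pos by (intro tendsto_intros tendsto_neg_powr filterlim_ident) auto
  then have "(\<integral>\<^sup>+u. ennreal (u powr (- \<alpha> - 1)) * indicator {v..} u \<partial>lborel)
      = ennreal (- (0 / \<alpha>) - (- (v powr (- \<alpha>) / \<alpha>)))"
  proof (rule nn_integral_FTC_atLeast[rotated 3])
    fix u assume "v \<le> u"
    then have "0 < u" using assms by simp
    then show "DERIV (\<lambda>u. - (u powr (- \<alpha>) / \<alpha>)) u :> u powr (- \<alpha> - 1)"
      using \<alpha>_pos by (auto intro!: derivative_eq_intros simp: powr_diff)
  qed auto
  then show ?thesis by simp
qed

lemma nn_integral_exp_tail: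
  assumes "0 < x"
  shows "(\<integral>\<^sup>+u. ennreal (exp (- (u * x))) * indicator {\<xi>..} u \<partial>lborel) = ennreal (exp (- (\<xi> * x)) / x)"
proof -
  have "((\<lambda>u. - (exp (- (u * x)) / x)) \<longlongrightarrow> - (0 / x)) at_top"
  proof (intro tendsto_minus tendsto_divide tendsto_const)
    have "filterlim (\<lambda>u. u * x) at_top at_top"
      using filterlim_tendsto_pos_mult_at_top[OF tendsto_const assms filterlim_ident]
      by (simp add: mult.commute)
    then show "((\<lambda>u. exp (- (u * x))) \<longlongrightarrow> 0) at_top"
      by (intro filterlim_compose[OF exp_at_bot]) (simp add: filterlim_uminus_at_top)
  qed (use assms in simp)
  then have "(\<integral>\<^sup>+u. ennreal (exp (- (u * x))) * indicator {\<xi>..} u \<partial>lborel)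
      = ennreal (- (0 / x) - (- (exp (- (\<xi> * x)) / x)))"
    using assms by (intro nn_integral_FTC_atLeast) (auto intro!: derivative_eq_intros)
  then show ?thesis by simp
qed

text \<open>
  The Levy-Khintchine integral of \<open>p\<^sup>\<alpha>\<close>.  Writing \<open>1 - exp (- p u)\<close> as \<open>\<integral>\<^sub>0\<^sup>u p exp (- p v) dv\<close> and exchanging
  the integrals leaves the tail \<open>v powr (- \<alpha>) / \<alpha>\<close> under an Euler integral.
\<close>

lemma nn_integral_levy:
  assumes p: "0 < p"
  shows "(\<integral>\<^sup>+u. ennreal (indicator {0..} u * ((1 - exp (- (p * u))) * u powr (- \<alpha> - 1))) \<partial>lborel)
    = ennreal (p powr \<alpha> * Gamma (1 - \<alpha>) / \<alpha>)" (is "?lhs = _")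
proof -
  let ?G = "\<lambda>u v. ennreal (u powr (- \<alpha> - 1)) * (ennreal (p * exp (- (p * v))) * (if 0 \<le> v \<and> v \<le> u then 1 else 0))"
  have "?lhs = (\<integral>\<^sup>+u. \<integral>\<^sup>+v. ?G u v \<partial>lborel \<partial>lborel)"
  proof (rule nn_integral_cong)
    fix u :: real
    show "ennreal (indicator {0..} u * ((1 - exp (- (p * u))) * u powr (- \<alpha> - 1))) = (\<integral>\<^sup>+v. ?G u v \<partial>lborel)"
    proof (cases "0 \<le> u")
      case True
      have "(\<integral>\<^sup>+v. ?G u v \<partial>lborel) = ennreal (u powr (- \<alpha> - 1)) * (\<integral>\<^sup>+v. ennreal (p * exp (- (p * v))) * indicator {0..u} v \<partial>lborel)"
        by (subst nn_integral_cmult[symmetric]) (auto intro!: nn_integral_cong simp: indicator_def)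
      also have "(\<integral>\<^sup>+v. ennreal (p * exp (- (p * v))) * indicator {0..u} v \<partial>lborel)
          = ennreal (- exp (- (p * u)) - (- exp (- (p * 0))))"
        using True p by (intro nn_integral_FTC_Icc) (auto intro!: derivative_eq_intros)
      finally show ?thesis
        using True p by (simp add: mult.commute flip: ennreal_mult)
    next
      case False
      then have "(\<integral>\<^sup>+v. ?G u v \<partial>lborel) = nn_integral lborel (\<lambda>v::real. 0)"
        by (intro nn_integral_cong) auto
      then show ?thesis using False by simp
    qed
  qed
  also have "\<dots> = (\<integral>\<^sup>+v. \<integral>\<^sup>+u. ?G u v \<partial>lborel \<partial>lborel)"
    by (rule lborel_pair.Fubini') measurable
  also have "\<dots> = (\<integral>\<^sup>+v. ennreal (p / \<alpha>) * ennreal (indicator {0<..} v * (v powr ((1 - \<alpha>) - 1) * exp (- (v * p)))) \<partial>lborel)"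
  proof (rule nn_integral_cong_AE)
    show "AE v in lborel. (\<integral>\<^sup>+u. ?G u v \<partial>lborel)
        = ennreal (p / \<alpha>) * ennreal (indicator {0<..} v * (v powr ((1 - \<alpha>) - 1) * exp (- (v * p))))"
      using AE_lborel_singleton[of 0]
    proof eventually_elim
      fix v :: real assume "v \<noteq> 0"
      then consider "v < 0" | "0 < v" by linarith
      then show "(\<integral>\<^sup>+u. ?G u v \<partial>lborel)
        = ennreal (p / \<alpha>) * ennreal (indicator {0<..} v * (v powr ((1 - \<alpha>) - 1) * exp (- (v * p))))"
      proof cases
        case 2
        have "(\<integral>\<^sup>+u. ?G u v \<partial>lborel) = (\<integral>\<^sup>+u. ennreal (u powr (- \<alpha> - 1)) * indicator {v..} u * ennreal (p * exp (- (p * v))) \<partial>lborel)"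
          using 2 by (intro nn_integral_cong) (auto simp: indicator_def mult_ac)
        also have "\<dots> = ennreal (v powr (- \<alpha>) / \<alpha>) * ennreal (p * exp (- (p * v)))"
          by (subst nn_integral_multc) (simp_all add: nn_integral_powr_tail[OF 2])
        finally show ?thesis
          using 2 p \<alpha>_pos by (simp add: mult_ac flip: ennreal_mult)
      qed simp
    qed
  qed
  also have "\<dots> = ennreal (p / \<alpha>) * ennreal (Gamma (1 - \<alpha>) / p powr (1 - \<alpha>))"
    using p \<alpha>_less_1 by (subst nn_integral_cmult, simp, subst nn_integral_Gamma) simp_all
  also have "\<dots> = ennreal (p powr \<alpha> * Gamma (1 - \<alpha>) / \<alpha>)"
    using p \<alpha>_pos \<alpha>_less_1 Gamma_real_pos[of "1 - \<alpha>"]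
    by (subst ennreal_mult[symmetric]) (auto simp: powr_diff less_imp_le)
  finally show ?thesis .
qed

definition levy_const :: real where
  "levy_const = \<alpha> / Gamma (1 - \<alpha>)"

lemma levy_const_pos: "0 < levy_const"
  unfolding levy_const_def using \<alpha>_pos \<alpha>_less_1 by (intro divide_pos_pos Gamma_real_pos) auto

definition levy_density :: "real \<Rightarrow> real \<Rightarrow> real" where
  "levy_density p u = levy_const * ((1 - exp (- (p * u))) * u powr (- \<alpha> - 1))"

lemma levy_density_measurable [measurable]: "levy_density p \<in> borel_measurable borel"
  unfolding levy_density_def by measurable

lemma levy_density_nonneg: "0 \<le> p \<Longrightarrow> 0 \<le> u \<Longrightarrow> 0 \<le> levy_density p u"
  unfolding levy_density_def using levy_const_pos by (intro mult_nonneg_nonneg) auto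

lemma
  assumes p: "0 < p"
  shows set_integrable_levy_density: "set_integrable lborel {0..} (levy_density p)"
    and set_integral_levy_density: "(LINT u:{0..}|lborel. levy_density p u) = p powr \<alpha>"
proof -
  have nn: "(\<integral>\<^sup>+u. ennreal (indicator {0..} u * levy_density p u) \<partial>lborel) = ennreal (p powr \<alpha>)"
  proof -
    have "(\<integral>\<^sup>+u. ennreal (indicator {0..} u * levy_density p u) \<partial>lborel)
        = (\<integral>\<^sup>+u. ennreal levy_const * ennreal (indicator {0..} u * ((1 - exp (- (p * u))) * u powr (- \<alpha> - 1))) \<partial>lborel)"
      using levy_const_pos p
      by (intro nn_integral_cong) (auto simp: levy_density_def mult_ac indicator_def simp flip: ennreal_mult)
    also have "\<dots> = ennreal levy_const * ennreal (p powr \<alpha> * Gamma (1 - \<alpha>) / \<alpha>)"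
      using p by (subst nn_integral_cmult) (simp_all add: nn_integral_levy)
    also have "\<dots> = ennreal (p powr \<alpha>)"
      using \<alpha>_pos levy_const_pos less_imp_neq[OF Gamma_real_pos[of "1 - \<alpha>"]] \<alpha>_less_1
      by (subst ennreal_mult[symmetric]) (auto simp: levy_const_def less_imp_le)
    finally show ?thesis .
  qed
  have "has_bochner_integral lborel (\<lambda>u. indicator {0..} u * levy_density p u) (p powr \<alpha>)"
    by (rule has_bochner_integral_nn_integral[OF _ _ _ nn])
      (use p in \<open>auto simp: indicator_def levy_density_nonneg\<close>)
  then show "set_integrable lborel {0..} (levy_density p)"
    "(LINT u:{0..}|lborel. levy_density p u) = p powr \<alpha>"
    by (auto simp: set_integrable_def set_lebesgue_integral_def has_bochner_integral_iff)
qed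

subsection \<open>The jump kernel\<close>

definition jump_kernel :: "real \<Rightarrow> real \<Rightarrow> real" where
  "jump_kernel \<epsilon> w = levy_const * (indicator {\<epsilon><..} w * w powr (- \<alpha> - 1))"

lemma half_line_jump_kernel:
  assumes "0 < \<epsilon>"
  shows "half_line_kernel (jump_kernel \<epsilon>)"
proof -
  have "has_bochner_integral lborel (\<lambda>u. u powr (- \<alpha> - 1) * indicator {\<epsilon>..} u) (\<epsilon> powr (- \<alpha>) / \<alpha>)"
    using nn_integral_powr_tail[OF assms] \<alpha>_pos
    by (intro has_bochner_integral_nn_integral) (auto simp: ennreal_mult ennreal_indicator)
  then have "integrable lborel (\<lambda>u. u powr (- \<alpha> - 1) * indicator {\<epsilon>..} u)"
    by (simp add: has_bochner_integral_iff)
  then have "integrable lborel (\<lambda>w. indicator {\<epsilon><..} w * w powr (- \<alpha> - 1))"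
    by (rule Bochner_Integration.integrable_bound) (auto simp: indicator_def)
  then show ?thesis
    using assms by (auto simp: half_line_kernel_def jump_kernel_def[abs_def])
qed

lemma laplace_jump_kernel:
  assumes \<epsilon>: "0 < \<epsilon>" and \<xi>: "0 \<le> \<xi>"
  shows "laplace (jump_kernel \<epsilon>) 0 - laplace (jump_kernel \<epsilon>) \<xi> = (LINT w:{\<epsilon>..}|lborel. levy_density \<xi> w)"
proof -
  have int: "integrable lborel (jump_kernel \<epsilon>)"
    using half_line_jump_kernel[OF \<epsilon>] by (rule half_line_kernel_integrable)
  have "laplace (jump_kernel \<epsilon>) 0 - laplace (jump_kernel \<epsilon>) \<xi>
      = (LINT w|lborel. jump_kernel \<epsilon> w * damping 0 w - jump_kernel \<epsilon> w * damping \<xi> w)"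
    using integrable_damping[OF int] \<xi> by (simp add: laplace_def)
  also have "\<dots> = (LINT w:{\<epsilon>..}|lborel. levy_density \<xi> w)"
    unfolding set_lebesgue_integral_def
  proof (rule integral_cong_AE)
    show "AE w in lborel. jump_kernel \<epsilon> w * damping 0 w - jump_kernel \<epsilon> w * damping \<xi> w
        = indicator {\<epsilon>..} w *\<^sub>R levy_density \<xi> w"
      using AE_lborel_singleton[of \<epsilon>]
      by eventually_elim
        (use \<epsilon> in \<open>auto simp: jump_kernel_def damping_def levy_density_def indicator_def algebra_simps\<close>)
  qed (use int in auto)
  finally show ?thesis .
qed

subsection \<open>The averaging kernel\<close>

text \<open>
  The kernel whose transform \<open>q\<close> satisfies \<open>\<psi>(\<xi>) = \<xi>\<^sup>\<alpha> q(\<xi>)\<close>, where \<open>\<psi>(\<xi>)\<close> is the symbol of the Marchaud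
  derivative truncated at \<open>\<epsilon>\<close>.  It is the truncated derivative of the potential kernel
  \<open>x powr (\<alpha> - 1) / Gamma \<alpha>\<close>, which has transform \<open>\<xi>\<^sup>-\<^sup>\<alpha>\<close>, in closed form.
\<close>

definition averaging_kernel :: "real \<Rightarrow> real \<Rightarrow> real" where
  "averaging_kernel \<epsilon> x = levy_const / (Gamma (\<alpha> + 1) * \<epsilon> powr \<alpha>)
     * (indicator {0<..} x * (x powr \<alpha> - (max 0 (x - \<epsilon>)) powr \<alpha>) / x)"

lemma averaging_kernel_nonneg:
  assumes "0 < \<epsilon>"
  shows "0 \<le> averaging_kernel \<epsilon> x"
proof (cases "0 < x")
  case True
  then have "(max 0 (x - \<epsilon>)) powr \<alpha> \<le> x powr \<alpha>"
    using assms \<alpha>_pos by (intro powr_mono2) auto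
  then show ?thesis
    using True assms levy_const_pos \<alpha>_pos Gamma_real_pos[of "\<alpha> + 1"]
    by (auto simp: averaging_kernel_def intro!: mult_nonneg_nonneg divide_nonneg_nonneg less_imp_le)
qed (simp add: averaging_kernel_def)

text \<open>
  The second summand is the first one translated by \<open>\<epsilon>\<close>, so its transform carries the factor
  \<open>exp (- \<epsilon> u)\<close>.
\<close>

lemma
  assumes u: "0 < u" and \<epsilon>: "0 < \<epsilon>"
  defines "g \<equiv> \<lambda>x. indicator {0<..} x * (x powr \<alpha> - (max 0 (x - \<epsilon>)) powr \<alpha>) * exp (- (u * x))"
  shows integrable_powr_difference: "integrable lborel g"
    and integral_powr_difference: "(LINT x|lborel. g x) = Gamma (\<alpha> + 1) * ((1 - exp (- (\<epsilon> * u))) * u powr (- \<alpha> - 1))"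
proof -
  define f where "f x = indicator {0<..} x * (x powr ((\<alpha> + 1) - 1) * exp (- (x * u)))" for x
  have a: "0 < \<alpha> + 1" using \<alpha>_pos by simp
  have f: "integrable lborel f" "(LINT x|lborel. f x) = Gamma (\<alpha> + 1) / u powr (\<alpha> + 1)"
    using set_integrable_Gamma[OF a u] set_integral_Gamma[OF a u]
    by (simp_all add: f_def[abs_def] set_integrable_def set_lebesgue_integral_def)
  have g: "g x = f x - exp (- (\<epsilon> * u)) * f (x + - \<epsilon>)" for x
    using \<epsilon> \<alpha>_pos by (auto simp: g_def f_def indicator_def max_def algebra_simps simp flip: exp_add)
  show "integrable lborel g"
    unfolding g[abs_def] using f(1) integrable_lborel_translate[OF f(1), of "- \<epsilon>"] by simp
  have "(LINT x|lborel. g x) = (LINT x|lborel. f x) - exp (- (\<epsilon> * u)) * (LINT x|lborel. f (x + - \<epsilon>))"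
    unfolding g using f(1) integrable_lborel_translate[OF f(1), of "- \<epsilon>"] by simp
  also have "\<dots> = Gamma (\<alpha> + 1) / u powr (\<alpha> + 1) - exp (- (\<epsilon> * u)) * (Gamma (\<alpha> + 1) / u powr (\<alpha> + 1))"
    unfolding integral_lborel_translate f(2) ..
  also have "1 / u powr (\<alpha> + 1) = u powr (- \<alpha> - 1)"
    using powr_minus_divide[of u "\<alpha> + 1"] by simp
  then have "Gamma (\<alpha> + 1) / u powr (\<alpha> + 1) = Gamma (\<alpha> + 1) * u powr (- \<alpha> - 1)"
    by (simp add: divide_inverse)
  finally show "(LINT x|lborel. g x) = Gamma (\<alpha> + 1) * ((1 - exp (- (\<epsilon> * u))) * u powr (- \<alpha> - 1))"
    by (simp add: algebra_simps)
qed

text \<open>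
  Since \<open>exp (- \<xi> x) / x = \<integral>\<^sub>\<xi>\<^sup>\<infinity> exp (- u x) du\<close>, the awkward factor \<open>1 / x\<close> is absorbed by a second
  integration, and Tonelli leaves the elementary transform of a difference of powers.
\<close>

lemma nn_integral_averaging_kernel:
  assumes \<epsilon>: "0 < \<epsilon>" and \<xi>: "0 \<le> \<xi>"
  shows "(\<integral>\<^sup>+x. ennreal (averaging_kernel \<epsilon> x * damping \<xi> x) \<partial>lborel)
    = ennreal (\<epsilon> powr (- \<alpha>) * (LINT u:{\<xi>..}|lborel. levy_density \<epsilon> u))" (is "?lhs = _")
proof -
  define B where "B = levy_const / (Gamma (\<alpha> + 1) * \<epsilon> powr \<alpha>)"
  define D where "D x = indicator {0<..} x * (x powr \<alpha> - (max 0 (x - \<epsilon>)) powr \<alpha>)" for x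
  have [measurable]: "D \<in> borel_measurable borel" unfolding D_def[abs_def] by measurable
  have B: "0 \<le> B"
    unfolding B_def using levy_const_pos \<epsilon> \<alpha>_pos Gamma_real_pos[of "\<alpha> + 1"] by (simp add: less_imp_le)
  have D: "0 \<le> D x" for x
    using powr_mono2[of \<alpha> "max 0 (x - \<epsilon>)" x] \<epsilon> \<alpha>_pos by (auto simp: D_def indicator_def)
  let ?G = "\<lambda>x u. ennreal (B * D x) * (ennreal (exp (- (u * x))) * indicator {\<xi>..} u)"
  have "?lhs = (\<integral>\<^sup>+x. \<integral>\<^sup>+u. ?G x u \<partial>lborel \<partial>lborel)"
  proof (rule nn_integral_cong)
    fix x :: real
    show "ennreal (averaging_kernel \<epsilon> x * damping \<xi> x) = (\<integral>\<^sup>+u. ?G x u \<partial>lborel)"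
    proof (cases "0 < x")
      case True
      have "(\<integral>\<^sup>+u. ?G x u \<partial>lborel) = ennreal (B * D x) * ennreal (exp (- (\<xi> * x)) / x)"
        by (subst nn_integral_cmult) (simp_all add: nn_integral_exp_tail[OF True])
      also have "\<dots> = ennreal (averaging_kernel \<epsilon> x * damping \<xi> x)"
        using True B D[of x]
        by (subst ennreal_mult[symmetric])
          (simp_all add: averaging_kernel_def damping_def flip: B_def, simp add: D_def)
      finally show ?thesis ..
    qed (simp add: averaging_kernel_def D_def)
  qed
  also have "\<dots> = (\<integral>\<^sup>+u. \<integral>\<^sup>+x. ?G x u \<partial>lborel \<partial>lborel)"
    by (rule lborel_pair.Fubini') measurable
  also have "\<dots> = (\<integral>\<^sup>+u. ennreal (\<epsilon> powr (- \<alpha>) * (indicator {\<xi>..} u * levy_density \<epsilon> u)) \<partial>lborel)"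
  proof (rule nn_integral_cong_AE)
    show "AE u in lborel. (\<integral>\<^sup>+x. ?G x u \<partial>lborel) = ennreal (\<epsilon> powr (- \<alpha>) * (indicator {\<xi>..} u * levy_density \<epsilon> u))"
      using AE_lborel_singleton[of 0]
    proof eventually_elim
      fix u :: real assume "u \<noteq> 0"
      show "(\<integral>\<^sup>+x. ?G x u \<partial>lborel) = ennreal (\<epsilon> powr (- \<alpha>) * (indicator {\<xi>..} u * levy_density \<epsilon> u))"
      proof (cases "\<xi> \<le> u")
        case True
        then have u: "0 < u" using \<xi> \<open>u \<noteq> 0\<close> by simp
        have "(\<integral>\<^sup>+x. ?G x u \<partial>lborel) = (\<integral>\<^sup>+x. ennreal B * ennreal (D x * exp (- (u * x))) \<partial>lborel)"
          using True B D by (intro nn_integral_cong) (simp add: mult_ac flip: ennreal_mult)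
        also have "\<dots> = ennreal B * ennreal (LINT x|lborel. D x * exp (- (u * x)))"
          using integrable_powr_difference[OF u \<epsilon>] D
          by (subst nn_integral_cmult, simp, subst nn_integral_eq_integral) (auto simp: D_def)
        also have "(LINT x|lborel. D x * exp (- (u * x))) = Gamma (\<alpha> + 1) * ((1 - exp (- (\<epsilon> * u))) * u powr (- \<alpha> - 1))"
          unfolding D_def by (rule integral_powr_difference[OF u \<epsilon>])
        also have "ennreal B * ennreal (Gamma (\<alpha> + 1) * ((1 - exp (- (\<epsilon> * u))) * u powr (- \<alpha> - 1)))
            = ennreal (\<epsilon> powr (- \<alpha>) * levy_density \<epsilon> u)"
          using B u \<epsilon> \<alpha>_pos Gamma_real_pos[of "\<alpha> + 1"] less_imp_neq[OF Gamma_real_pos[of "\<alpha> + 1"]]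
          by (subst ennreal_mult[symmetric]) (auto simp: B_def levy_density_def powr_minus_divide less_imp_le)
        finally show ?thesis using True by simp
      qed simp
    qed
  qed
  also have "\<dots> = ennreal (LINT u|lborel. \<epsilon> powr (- \<alpha>) * (indicator {\<xi>..} u * levy_density \<epsilon> u))"
  proof (rule nn_integral_eq_integral)
    have "set_integrable lborel {\<xi>..} (levy_density \<epsilon>)"
      using set_integrable_levy_density[OF \<epsilon>] by (rule set_integrable_subset) (use \<xi> in auto)
    then show "integrable lborel (\<lambda>u. \<epsilon> powr (- \<alpha>) * (indicator {\<xi>..} u * levy_density \<epsilon> u))"
      by (simp add: set_integrable_def)
  qed (use \<epsilon> \<xi> in \<open>auto simp: indicator_def levy_density_nonneg\<close>)
  finally show ?thesis by (simp add: set_lebesgue_integral_def)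
qed

lemma
  assumes \<epsilon>: "0 < \<epsilon>" and \<xi>: "0 \<le> \<xi>"
  shows integrable_averaging_kernel_damping: "integrable lborel (\<lambda>x. averaging_kernel \<epsilon> x * damping \<xi> x)"
    and laplace_averaging_kernel:
      "laplace (averaging_kernel \<epsilon>) \<xi> = \<epsilon> powr (- \<alpha>) * (LINT u:{\<xi>..}|lborel. levy_density \<epsilon> u)"
proof -
  have [measurable]: "averaging_kernel \<epsilon> \<in> borel_measurable borel"
    unfolding averaging_kernel_def[abs_def] by measurable
  have "0 \<le> \<epsilon> powr (- \<alpha>) * (LINT u:{\<xi>..}|lborel. levy_density \<epsilon> u)"
    unfolding set_lebesgue_integral_def using \<epsilon> \<xi>
    by (intro mult_nonneg_nonneg Bochner_Integration.integral_nonneg) (auto simp: indicator_def levy_density_nonneg)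
  then have "has_bochner_integral lborel (\<lambda>x. averaging_kernel \<epsilon> x * damping \<xi> x)
      (\<epsilon> powr (- \<alpha>) * (LINT u:{\<xi>..}|lborel. levy_density \<epsilon> u))"
    by (intro has_bochner_integral_nn_integral nn_integral_averaging_kernel assms)
      (auto simp: averaging_kernel_nonneg[OF \<epsilon>])
  then show "integrable lborel (\<lambda>x. averaging_kernel \<epsilon> x * damping \<xi> x)"
    "laplace (averaging_kernel \<epsilon>) \<xi> = \<epsilon> powr (- \<alpha>) * (LINT u:{\<xi>..}|lborel. levy_density \<epsilon> u)"
    by (auto simp: has_bochner_integral_iff laplace_def)
qed

lemma half_line_averaging_kernel:
  assumes \<epsilon>: "0 < \<epsilon>"
  shows "half_line_kernel (averaging_kernel \<epsilon>)"
proof -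
  have "averaging_kernel \<epsilon> x * damping 0 x = averaging_kernel \<epsilon> x" for x
    by (auto simp: averaging_kernel_def damping_def indicator_def)
  with integrable_averaging_kernel_damping[OF \<epsilon>, of 0] have "integrable lborel (averaging_kernel \<epsilon>)"
    by simp
  then show ?thesis
    by (simp add: half_line_kernel_def) (simp add: averaging_kernel_def)
qed

lemma laplace_averaging_kernel_0:
  assumes \<epsilon>: "0 < \<epsilon>"
  shows "laplace (averaging_kernel \<epsilon>) 0 = 1"
  using \<epsilon> by (simp add: laplace_averaging_kernel set_integral_levy_density powr_minus)

text \<open>
  The factorization of the symbol of the truncated derivative.  Both sides are tails of the same
  integral up to the substitution \<open>u = (\<xi> / \<epsilon>) w\<close>.
\<close>

lemma laplace_jump_averaging:
  assumes \<epsilon>: "0 < \<epsilon>" and \<xi>: "0 \<le> \<xi>"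
  shows "laplace (jump_kernel \<epsilon>) 0 - laplace (jump_kernel \<epsilon>) \<xi>
    = \<xi> powr \<alpha> * laplace (averaging_kernel \<epsilon>) \<xi>"
proof (cases "\<xi> = 0")
  case False
  then have \<xi>: "0 < \<xi>" using \<xi> by simp
  define q where "q = \<xi> / \<epsilon>"
  have q: "0 < q" using \<xi> \<epsilon> by (simp add: q_def)
  have "(LINT u:{\<xi>..}|lborel. levy_density \<epsilon> u)
      = \<bar>q\<bar> *\<^sub>R (LINT w|lborel. indicator {\<xi>..} (0 + q * w) *\<^sub>R levy_density \<epsilon> (0 + q * w))"
    unfolding set_lebesgue_integral_def using q by (intro lborel_integral_real_affine) simp
  also have "(LINT w|lborel. indicator {\<xi>..} (0 + q * w) *\<^sub>R levy_density \<epsilon> (0 + q * w))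
      = (LINT w|lborel. q powr (- \<alpha> - 1) * (indicator {\<epsilon>..} w *\<^sub>R levy_density \<xi> w))"
  proof (rule Bochner_Integration.integral_cong[OF refl])
    fix w
    have "\<xi> \<le> q * w \<longleftrightarrow> \<epsilon> \<le> w"
      using \<xi> \<epsilon> by (simp add: q_def field_simps)
    moreover have "levy_density \<epsilon> (q * w) = q powr (- \<alpha> - 1) * levy_density \<xi> w" if "\<epsilon> \<le> w"
    proof -
      have "\<epsilon> * (q * w) = \<xi> * w" using \<epsilon> by (simp add: q_def)
      moreover have "(q * w) powr (- \<alpha> - 1) = q powr (- \<alpha> - 1) * w powr (- \<alpha> - 1)"
        by (rule powr_mult)
      ultimately show ?thesis by (simp add: levy_density_def mult_ac)
    qed
    ultimately show "indicator {\<xi>..} (0 + q * w) *\<^sub>R levy_density \<epsilon> (0 + q * w)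
        = q powr (- \<alpha> - 1) * (indicator {\<epsilon>..} w *\<^sub>R levy_density \<xi> w)"
      by (auto simp: indicator_def)
  qed
  also have "\<dots> = q powr (- \<alpha> - 1) * (LINT w:{\<epsilon>..}|lborel. levy_density \<xi> w)"
    by (simp add: set_lebesgue_integral_def)
  finally have "\<xi> powr \<alpha> * laplace (averaging_kernel \<epsilon>) \<xi>
      = (\<xi> powr \<alpha> * \<epsilon> powr (- \<alpha>) * (q * q powr (- \<alpha> - 1))) * (LINT w:{\<epsilon>..}|lborel. levy_density \<xi> w)"
    using q \<epsilon> \<xi> by (simp add: laplace_averaging_kernel)
  also have "q * q powr (- \<alpha> - 1) = q powr (- \<alpha>)"
    using q by (simp add: powr_diff)
  also have "\<xi> powr \<alpha> * \<epsilon> powr (- \<alpha>) * q powr (- \<alpha>) = 1"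
    using \<xi> \<epsilon> by (simp add: q_def powr_minus powr_divide field_simps)
  finally show ?thesis
    using laplace_jump_kernel[OF \<epsilon>, of \<xi>] \<xi> by simp
qed simp

text \<open>
  At \<open>\<xi> = 1\<close> the transform is the tail from \<open>\<epsilon>\<close> of an integral over the half-line with value \<open>1\<close>.
\<close>

lemma tendsto_laplace_averaging_kernel: "((\<lambda>\<epsilon>. laplace (averaging_kernel \<epsilon>) 1) \<longlongrightarrow> 1) (at_right 0)"
proof (rule Lim_transform_eventually)
  show "\<forall>\<^sub>F \<epsilon> in at_right 0. (LINT w:{\<epsilon>..}|lborel. levy_density 1 w) = laplace (averaging_kernel \<epsilon>) 1"
    using eventually_at_right_less[of "0::real"]
    by eventually_elim (use laplace_jump_averaging[of _ 1] laplace_jump_kernel[of _ 1] in simp)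
  show "((\<lambda>\<epsilon>. LINT w:{\<epsilon>..}|lborel. levy_density 1 w) \<longlongrightarrow> 1) (at_right 0)"
    unfolding tendsto_at_iff_sequentially comp_def
  proof (intro allI impI)
    fix X :: "nat \<Rightarrow> real"
    assume pos: "\<forall>i. X i \<in> {0<..} - {0}" and X: "X \<longlonglongrightarrow> 0"
    have "(\<lambda>i. LINT w|lborel. indicator {X i..} w *\<^sub>R levy_density 1 w)
        \<longlonglongrightarrow> (LINT w|lborel. indicator {0..} w *\<^sub>R levy_density 1 w)"
    proof (rule integral_dominated_convergence[where w = "\<lambda>w. indicator {0..} w *\<^sub>R levy_density 1 w"])
      show "integrable lborel (\<lambda>w. indicator {0..} w *\<^sub>R levy_density 1 w)"
        using set_integrable_levy_density[of 1] by (simp add: set_integrable_def)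
      show "AE w in lborel. norm (indicator {X i..} w *\<^sub>R levy_density 1 w) \<le> indicator {0..} w *\<^sub>R levy_density 1 w" for i
      proof (rule AE_I2)
        fix w :: real
        have "0 < X i" using pos by simp
        then show "norm (indicator {X i..} w *\<^sub>R levy_density 1 w) \<le> indicator {0..} w *\<^sub>R levy_density 1 w"
          by (auto simp: indicator_def levy_density_nonneg)
      qed
      show "AE w in lborel. (\<lambda>i. indicator {X i..} w *\<^sub>R levy_density 1 w) \<longlonglongrightarrow> indicator {0..} w *\<^sub>R levy_density 1 w"
        using AE_lborel_singleton[of 0]
      proof eventually_elim
        fix w :: real assume "w \<noteq> 0"
        then consider "w < 0" | "0 < w" by linarith
        then show "(\<lambda>i. indicator {X i..} w *\<^sub>R levy_density 1 w) \<longlonglongrightarrow> indicator {0..} w *\<^sub>R levy_density 1 w"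
        proof cases
          case 1
          have "w < X i" for i using pos 1 by (auto intro: less_trans)
          then have eq: "(indicator {X i..} w :: real) = indicator {0..} w" for i
            using 1 by (simp add: not_le)
          show ?thesis unfolding eq by (rule tendsto_const)
        next
          case 2
          have "\<forall>\<^sub>F i in sequentially. X i < w"
            using order_tendstoD(2)[OF X 2] .
          then have "\<forall>\<^sub>F i in sequentially. indicator {X i..} w *\<^sub>R levy_density 1 w = indicator {0..} w *\<^sub>R levy_density 1 w"
            by eventually_elim (use 2 in simp)
          then show ?thesis by (rule tendsto_eventually)
        qed
      qed
    qed simp_all
    then show "(\<lambda>i. LINT w:{X i..}|lborel. levy_density 1 w) \<longlonglongrightarrow> 1"
      using set_integral_levy_density[of 1] by (simp add: set_lebesgue_integral_def)
  qed
qed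

end

section \<open>The truncated Marchaud derivative as an operator\<close>

lemma square_integrable_cong_AE:
  assumes "square_integrable g" "f \<in> borel_measurable borel" "AE x in lborel. f x = g x"
  shows "square_integrable f"
proof -
  have "integrable lborel (\<lambda>x. (f x)\<^sup>2) \<longleftrightarrow> integrable lborel (\<lambda>x. (g x)\<^sup>2)"
    by (rule integrable_cong_AE) (use assms in \<open>auto simp: square_integrable_def\<close>)
  then show ?thesis using assms by (simp add: square_integrable_def)
qed

context fractional_order
begin

definition truncated_operator :: "real \<Rightarrow> l2 \<Rightarrow> l2" where
  "truncated_operator \<epsilon> f = laplace (jump_kernel \<epsilon>) 0 *\<^sub>R f - average (jump_kernel \<epsilon>) f"

lemma truncated_marchaud_eq:
  assumes \<epsilon>: "0 < \<epsilon>"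
  shows "to_l2 (truncated_marchaud \<alpha> \<epsilon> (l2_fun f)) = truncated_operator \<epsilon> f"
proof -
  let ?j = "jump_kernel \<epsilon>" and ?f = "l2_fun f"
  let ?g = "\<lambda>t. laplace ?j 0 * ?f t - (LINT w|lborel. ?j w * ?f (t + w))"
  have half: "half_line_kernel ?j" by (rule half_line_jump_kernel[OF \<epsilon>])
  then have j: "integrable lborel ?j" by (rule half_line_kernel_integrable)
  have trunc: "truncated_marchaud \<alpha> \<epsilon> ?f t = (LINT w|lborel. ?j w * ?f t - ?j w * ?f (t + w))" for t
  proof -
    have "truncated_marchaud \<alpha> \<epsilon> ?f t
        = (LINT w|lborel. levy_const * (indicator {\<epsilon><..} w *\<^sub>R ((?f t - ?f (t + w)) / w powr (\<alpha> + 1))))"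
      unfolding truncated_marchaud_def set_lebesgue_integral_def levy_const_def
      by (rule integral_mult_right_zero[symmetric])
    also have "\<dots> = (LINT w|lborel. ?j w * ?f t - ?j w * ?f (t + w))"
    proof (rule Bochner_Integration.integral_cong[OF refl])
      fix w
      have "w powr (- \<alpha> - 1) = 1 / w powr (\<alpha> + 1)"
        using powr_minus_divide[of w "\<alpha> + 1"] by simp
      then show "levy_const * (indicator {\<epsilon><..} w *\<^sub>R ((?f t - ?f (t + w)) / w powr (\<alpha> + 1)))
          = ?j w * ?f t - ?j w * ?f (t + w)"
        by (simp add: jump_kernel_def diff_divide_distrib right_diff_distrib)
    qed
    finally show ?thesis .
  qed
  have ae: "AE t in lborel. truncated_marchaud \<alpha> \<epsilon> ?f t = ?g t"
    using young_inequality(1)[OF j square_integrable_l2_fun[of f]]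
    by eventually_elim (simp add: trunc j laplace_0[OF half])
  have [measurable]: "?j \<in> borel_measurable borel"
    using borel_measurable_integrable[OF j] by simp
  have sq: "square_integrable (\<lambda>t. LINT w|lborel. ?j w * ?f (t + w))"
    by (rule young_inequality(2)[OF j square_integrable_l2_fun])
  have sq': "square_integrable ?g"
    by (intro square_integrable_diff square_integrable_scale sq) simp
  have meas: "truncated_marchaud \<alpha> \<epsilon> ?f \<in> borel_measurable borel"
    unfolding trunc[abs_def] by measurable
  have "to_l2 (truncated_marchaud \<alpha> \<epsilon> ?f) = to_l2 ?g"
    by (rule to_l2_eq_iff[THEN iffD2, OF square_integrable_cong_AE[OF sq' meas ae] sq' ae])
  also have "\<dots> = to_l2 (\<lambda>t. laplace ?j 0 * ?f t) - to_l2 (\<lambda>t. LINT w|lborel. ?j w * ?f (t + w))"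
    by (intro to_l2_diff[symmetric] square_integrable_scale sq) simp
  also have "\<dots> = laplace ?j 0 *\<^sub>R to_l2 ?f - average ?j (to_l2 ?f)"
    unfolding average_to_l2[OF j square_integrable_l2_fun] to_l2_scale[OF square_integrable_l2_fun] ..
  finally show ?thesis by (simp add: truncated_operator_def)
qed

lemma has_marchaud_derivative_iff:
  "has_marchaud_derivative \<alpha> f g \<longleftrightarrow> ((\<lambda>\<epsilon>. truncated_operator \<epsilon> f) \<longlongrightarrow> g) (at_right 0)"
  unfolding has_marchaud_derivative_def
  by (rule tendsto_cong)
    (use eventually_at_right_less[of "0::real"] in \<open>eventually_elim, simp add: truncated_marchaud_eq\<close>)

lemma averaging_kernel_tendsto:
  "((\<lambda>\<epsilon>. average (averaging_kernel \<epsilon>) f) \<longlongrightarrow> f) (at_right 0)"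
proof (rule average_tendsto_id[OF _ tendsto_laplace_averaging_kernel])
  show "\<forall>\<^sub>F \<epsilon> in at_right 0. half_line_kernel (averaging_kernel \<epsilon>) \<and> (\<forall>z. 0 \<le> averaging_kernel \<epsilon> z)
      \<and> laplace (averaging_kernel \<epsilon>) 0 = 1"
    using eventually_at_right_less[of "0::real"]
    by eventually_elim
      (simp add: half_line_averaging_kernel averaging_kernel_nonneg laplace_averaging_kernel_0)
qed

text \<open>
  The unbounded symbol \<open>\<xi>\<^sup>\<alpha>\<close> is compensated by the resolvent: with \<open>\<psi> = \<xi>\<^sup>\<alpha> q\<close> one has
  \<open>\<psi> / (1 + \<xi>\<^sup>\<alpha>) = q (1 - 1 / (1 + \<xi>\<^sup>\<alpha>))\<close>, and all operators involved are averages.  As \<open>\<epsilon>\<close>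
  tends to \<open>0\<close>, the right-hand side converges on all of \<open>L\<^sup>2\<close>.
\<close>

lemma
  assumes r: "half_line_kernel r" and laplace_r: "\<And>\<xi>. 0 \<le> \<xi> \<Longrightarrow> laplace r \<xi> = 1 / (1 + \<xi> powr \<alpha>)"
    and \<epsilon>: "0 < \<epsilon>"
  shows truncated_operator_resolvent:
      "truncated_operator \<epsilon> (average r f) = average (averaging_kernel \<epsilon>) (f - average r f)"
    and resolvent_truncated_operator:
      "average r (truncated_operator \<epsilon> f) = truncated_operator \<epsilon> (average r f)"
proof -
  let ?j = "jump_kernel \<epsilon>" and ?q = "averaging_kernel \<epsilon>"
  have j: "half_line_kernel ?j" and q: "half_line_kernel ?q"
    using \<epsilon> by (simp_all add: half_line_jump_kernel half_line_averaging_kernel)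
  interpret r: bounded_linear "average r"
    using r by (intro bounded_linear_average half_line_kernel_integrable)
  interpret q: bounded_linear "average ?q"
    using q by (intro bounded_linear_average half_line_kernel_integrable)
  note kernels = r j q half_line_kernel_conv half_line_kernel_scale half_line_kernel_diff
  have "truncated_operator \<epsilon> (average r f) = average (\<lambda>z. laplace ?j 0 * r z - kernel_conv ?j r z) f"
    unfolding truncated_operator_def
    by (simp add: average_diff average_scale average_kernel_conv kernels half_line_kernel_integrable)
  also have "\<dots> = average (\<lambda>z. ?q z - kernel_conv ?q r z) f"
  proof (rule average_eqI_laplace)
    fix \<xi> :: real assume \<xi>: "0 \<le> \<xi>"
    have "1 + \<xi> powr \<alpha> \<noteq> 0"
      using powr_ge_zero[of \<xi> \<alpha>] by linarith
    then have "(laplace ?j 0 - laplace ?j \<xi>) / (1 + \<xi> powr \<alpha>)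
        = laplace ?q \<xi> - laplace ?q \<xi> / (1 + \<xi> powr \<alpha>)"
      unfolding laplace_jump_averaging[OF \<epsilon> \<xi>] by (simp add: field_simps)
    then show "laplace (\<lambda>z. laplace ?j 0 * r z - kernel_conv ?j r z) \<xi>
        = laplace (\<lambda>z. ?q z - kernel_conv ?q r z) \<xi>"
      using \<xi> by (simp add: laplace_diff laplace_scale laplace_kernel_conv kernels laplace_r diff_divide_distrib)
  qed (intro kernels)+
  also have "\<dots> = average ?q (f - average r f)"
    by (simp add: average_diff average_kernel_conv kernels half_line_kernel_integrable q.diff)
  finally show "truncated_operator \<epsilon> (average r f) = average ?q (f - average r f)" .
  show "average r (truncated_operator \<epsilon> f) = truncated_operator \<epsilon> (average r f)"
    unfolding truncated_operator_def by (simp add: r.diff r.scaleR average_commute[OF r j])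
qed

end

section \<open>The stable semigroup\<close>

locale stable_subordinator = fractional_order \<alpha> for \<alpha> +
  fixes h :: "real \<Rightarrow> real \<Rightarrow> real"
  assumes density: "stable_subordinator_density \<alpha> h"
begin

text \<open>
  The hypotheses say nothing about \<open>h z s\<close> for \<open>z < 0\<close> or \<open>s \<le> 0\<close>; with value \<open>0\<close> there, measurability
  and nonnegativity hold everywhere.
\<close>

definition law :: "real \<Rightarrow> real \<Rightarrow> real" where
  "law s z = indicator ({0..} \<times> {0<..}) (z, s) * h z s"

lemma law_measurable: "(\<lambda>(z, s). law s z) \<in> borel_measurable (borel \<Otimes>\<^sub>M borel)"
proof -
  have "(\<lambda>(z, s). law s z) = (\<lambda>p. indicator ({0..} \<times> {0<..}) p *\<^sub>R (case p of (z, s) \<Rightarrow> h z s))"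
    by (auto simp: law_def)
  then show ?thesis
    using density by (simp add: stable_subordinator_density_def set_borel_measurable_def)
qed

lemma law_measurable_compose [measurable (raw)]:
  assumes [measurable]: "f \<in> borel_measurable N" "g \<in> borel_measurable N"
  shows "(\<lambda>x. law (f x) (g x)) \<in> borel_measurable N"
  using measurable_compose[OF measurable_Pair[OF assms(2,1)] law_measurable] by simp

lemma law_nonneg: "0 \<le> law s z"
  using density by (auto simp: law_def stable_subordinator_density_def indicator_def)

lemma laplace_law:
  assumes "0 < s" "0 \<le> \<xi>"
  shows "laplace (law s) \<xi> = exp (- (s * \<xi> powr \<alpha>))"
proof -
  have "laplace (law s) \<xi> = (LINT z:{0..}|lborel. exp (- (\<xi> * z)) * h z s)"
    unfolding laplace_def set_lebesgue_integral_def using assms(1)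
    by (intro Bochner_Integration.integral_cong) (auto simp: law_def damping_def indicator_def)
  then show ?thesis
    using density assms by (simp add: stable_subordinator_density_def)
qed

lemma half_line_law:
  assumes "0 < s"
  shows "half_line_kernel (law s)"
proof -
  \<comment> \<open>A non-integrable function has integral \<open>0\<close>, so a nonzero integral forces integrability.\<close>
  have "laplace (law s) 0 \<noteq> 0" using laplace_law[OF assms, of 0] by simp
  then have "integrable lborel (\<lambda>z. law s z * damping 0 z)"
    unfolding laplace_def by (metis not_integrable_integral_eq)
  moreover have "law s z * damping 0 z = law s z" for z
    by (auto simp: law_def damping_def indicator_def)
  ultimately show ?thesis by (simp add: half_line_kernel_def) (simp add: law_def)
qed

lemma integral_law: "0 < s \<Longrightarrow> (LINT z|lborel. law s z) = 1"
  using laplace_0[OF half_line_law] laplace_law[of s 0] by simp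

definition stable_semigroup :: "real \<Rightarrow> l2 \<Rightarrow>\<^sub>L l2" where
  "stable_semigroup s = (if 0 < s then Blinfun (average (law s)) else id_blinfun)"

lemma stable_semigroup_apply: "0 < s \<Longrightarrow> stable_semigroup s f = average (law s) f"
  by (simp add: stable_semigroup_def bounded_linear_Blinfun_apply bounded_linear_average
      half_line_law half_line_kernel_integrable)

text \<open>
  Stationary independent increments of the subordinator, read off from
  \<open>exp (- (s + t) \<xi>\<^sup>\<alpha>) = exp (- s \<xi>\<^sup>\<alpha>) exp (- t \<xi>\<^sup>\<alpha>)\<close>.
\<close>

lemma average_law_add:
  assumes "0 < s" "0 < t"
  shows "average (law (s + t)) f = average (law s) (average (law t) f)"
proof -
  have "average (law (s + t)) f = average (kernel_conv (law s) (law t)) f"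
    using assms
    by (intro average_eqI_laplace)
      (simp_all add: half_line_law half_line_kernel_conv laplace_kernel_conv laplace_law
        distrib_right exp_add[symmetric])
  then show ?thesis
    using assms by (simp add: average_kernel_conv half_line_law half_line_kernel_integrable)
qed

lemma c0_semigroup_stable: "c0_semigroup stable_semigroup"
  unfolding c0_semigroup_def
proof (intro conjI allI impI)
  show "stable_semigroup 0 = id_blinfun" by (simp add: stable_semigroup_def)
  show "stable_semigroup (s + t) = stable_semigroup s o\<^sub>L stable_semigroup t" if "0 \<le> s" "0 \<le> t" for s t
  proof (cases "s = 0 \<or> t = 0")
    case True
    then show ?thesis by (auto intro!: blinfun_eqI simp: stable_semigroup_def)
  next
    case False
    then have "0 < s" "0 < t" using that by auto
    then show ?thesis by (intro blinfun_eqI) (simp add: stable_semigroup_apply average_law_add)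
  qed
  show "((\<lambda>s. stable_semigroup s f) \<longlongrightarrow> f) (at_right 0)" for f
  proof (rule Lim_transform_eventually)
    have "((\<lambda>s. exp (- s)) \<longlongrightarrow> exp (- 0)) (at_right (0::real))"
      by (intro tendsto_intros)
    then have "((\<lambda>s. exp (- s)) \<longlongrightarrow> 1) (at_right (0::real))" by simp
    then have "((\<lambda>s. laplace (law s) 1) \<longlongrightarrow> 1) (at_right 0)"
      by (rule Lim_transform_eventually)
        (use eventually_at_right_less[of "0::real"] in \<open>eventually_elim, simp add: laplace_law\<close>)
    moreover have "\<forall>\<^sub>F s in at_right 0. half_line_kernel (law s) \<and> (\<forall>z. 0 \<le> law s z) \<and> laplace (law s) 0 = 1"
      using eventually_at_right_less[of "0::real"]
      by eventually_elim (simp add: half_line_law law_nonneg laplace_law)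
    ultimately show "((\<lambda>s. average (law s) f) \<longlongrightarrow> f) (at_right 0)"
      by (rule average_tendsto_id[rotated])
    show "\<forall>\<^sub>F s in at_right 0. average (law s) f = stable_semigroup s f"
      using eventually_at_right_less[of "0::real"] by eventually_elim (simp add: stable_semigroup_apply)
  qed
qed

sublocale contraction_semigroup stable_semigroup
proof
  show "c0_semigroup stable_semigroup" by (rule c0_semigroup_stable)
  show "norm (stable_semigroup s f) \<le> norm f" if "0 \<le> s" for s f
  proof (cases "s = 0")
    case False
    then have "0 < s" using that by simp
    then show ?thesis
      using norm_average_le[of "law s" f]
      by (simp add: stable_semigroup_apply half_line_law half_line_kernel_integrable law_nonneg integral_law)
  qed (simp add: stable_semigroup_def)
qed

subsection \<open>Negative fractional powers as averages\<close>

definition power_kernel :: "real \<Rightarrow> real \<Rightarrow> real \<Rightarrow> real" where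
  "power_kernel \<mu> \<beta> z = 1 / Gamma \<beta> *
     (LINT s:{0<..}|lborel. s powr (\<beta> - 1) * exp (- (s * \<mu>)) * law s z)"

lemma
  fixes F :: "real \<Rightarrow> 'b :: {banach, second_countable_topology}"
  assumes \<mu>: "0 < \<mu>" and \<beta>: "0 < \<beta>"
  shows half_line_power_kernel: "half_line_kernel (power_kernel \<mu> \<beta>)"
    and integral_power_kernel: "F \<in> borel_measurable borel \<Longrightarrow> (\<And>z. norm (F z) \<le> B) \<Longrightarrow>
      (LINT z|lborel. power_kernel \<mu> \<beta> z *\<^sub>R F z) = (1 / Gamma \<beta>) *\<^sub>R
        (LINT s:{0<..}|lborel. (s powr (\<beta> - 1) * exp (- (s * \<mu>))) *\<^sub>R (LINT z|lborel. law s z *\<^sub>R F z))"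
proof -
  define w where "w s = indicator {0<..} s * (s powr (\<beta> - 1) * exp (- (s * \<mu>)))" for s
  have w: "integrable lborel w"
    using set_integrable_Gamma[OF \<beta> \<mu>] by (simp add: w_def[abs_def] set_integrable_def)
  have [measurable]: "w \<in> borel_measurable borel"
    using borel_measurable_integrable[OF w] by simp
  have w0: "w s = 0" if "\<not> 0 < s" for s using that by (simp add: w_def)
  \<comment> \<open>Each \<open>law s\<close> has mass \<open>1\<close>, so integrating over \<open>z\<close> first leaves only the Gamma weight \<open>w\<close>.\<close>
  have pair: "integrable (lborel \<Otimes>\<^sub>M lborel) (\<lambda>(s, z). w s * law s z)"
  proof (rule lborel_pair.Fubini_integrable)
    have "(LINT z|lborel. norm (case (s, z) of (s, z) \<Rightarrow> w s * law s z)) = \<bar>w s\<bar>" for s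
      by (cases "0 < s") (simp_all add: w0 abs_mult law_nonneg integral_law)
    then show "integrable lborel (\<lambda>s. LINT z|lborel. norm (case (s, z) of (s, z) \<Rightarrow> w s * law s z))"
      using w by simp
    have "integrable lborel (\<lambda>z. w s * law s z)" for s
      by (cases "0 < s") (simp_all add: w0 half_line_law half_line_kernel_integrable)
    then show "AE s in lborel. integrable lborel (\<lambda>z. case (s, z) of (s, z) \<Rightarrow> w s * law s z)"
      by simp
  qed measurable
  have kernel: "power_kernel \<mu> \<beta> z = 1 / Gamma \<beta> * (LINT s|lborel. w s * law s z)" for z
    unfolding power_kernel_def set_lebesgue_integral_def w_def by (simp add: mult.assoc)
  have "law s z = 0" if "z < 0" for s z using that by (simp add: law_def)
  then show "half_line_kernel (power_kernel \<mu> \<beta>)"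
    unfolding half_line_kernel_def kernel[abs_def] using integrable_mixture[OF pair] by simp
  assume F: "F \<in> borel_measurable borel" "\<And>z. norm (F z) \<le> B"
  have "(LINT z|lborel. power_kernel \<mu> \<beta> z *\<^sub>R F z)
      = (1 / Gamma \<beta>) *\<^sub>R (LINT z|lborel. (LINT s|lborel. w s * law s z) *\<^sub>R F z)"
    unfolding kernel scaleR_scaleR[symmetric] by (rule integral_scaleR_right)
  also have "(LINT z|lborel. (LINT s|lborel. w s * law s z) *\<^sub>R F z)
      = (LINT s|lborel. LINT z|lborel. (w s * law s z) *\<^sub>R F z)"
    by (rule integral_mixture[OF pair F])
  also have "\<dots> = (LINT s:{0<..}|lborel. (s powr (\<beta> - 1) * exp (- (s * \<mu>))) *\<^sub>R (LINT z|lborel. law s z *\<^sub>R F z))"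
    unfolding set_lebesgue_integral_def w_def
    by (simp flip: scaleR_scaleR)
  finally show "(LINT z|lborel. power_kernel \<mu> \<beta> z *\<^sub>R F z) = (1 / Gamma \<beta>) *\<^sub>R
      (LINT s:{0<..}|lborel. (s powr (\<beta> - 1) * exp (- (s * \<mu>))) *\<^sub>R (LINT z|lborel. law s z *\<^sub>R F z))" .
qed

text \<open>
  Fubini: subordinating the translation group and then integrating over \<open>s\<close> is the same as averaging
  translations with the kernel integrated over \<open>s\<close>.
\<close>

lemma neg_fractional_power_eq_average:
  assumes "0 < \<mu>" "0 < \<beta>"
  shows "neg_fractional_power stable_semigroup \<mu> \<beta> f = average (power_kernel \<mu> \<beta>) f"
proof -
  have "average (power_kernel \<mu> \<beta>) f = (1 / Gamma \<beta>) *\<^sub>R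
      (LINT s:{0<..}|lborel. (s powr (\<beta> - 1) * exp (- (s * \<mu>))) *\<^sub>R average (law s) f)"
    unfolding average_def
    by (rule integral_power_kernel[OF assms, where B = "norm f"]) simp_all
  also have "\<dots> = neg_fractional_power stable_semigroup \<mu> \<beta> f"
    unfolding neg_fractional_power_def
    by (intro arg_cong[where f = "scaleR _"] set_lebesgue_integral_cong) (auto simp: stable_semigroup_apply)
  finally show ?thesis ..
qed

lemma laplace_power_kernel_1:
  assumes "0 \<le> \<xi>"
  shows "laplace (power_kernel 1 1) \<xi> = 1 / (1 + \<xi> powr \<alpha>)"
proof -
  have p: "0 < 1 + \<xi> powr \<alpha>"
    using powr_ge_zero[of \<xi> \<alpha>] by linarith
  have "laplace (power_kernel 1 1) \<xi>
      = (LINT s:{0<..}|lborel. (s powr (1 - 1) * exp (- (s * 1))) * laplace (law s) \<xi>)"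
    using integral_power_kernel[of 1 1 "damping \<xi>" 1] abs_damping_le[OF assms]
    by (simp add: laplace_def)
  also have "\<dots> = (LINT s:{0<..}|lborel. s powr (1 - 1) * exp (- (s * (1 + \<xi> powr \<alpha>))))"
    using assms
    by (intro set_lebesgue_integral_cong) (auto simp: laplace_law distrib_left simp flip: exp_add)
  also have "\<dots> = Gamma 1 / (1 + \<xi> powr \<alpha>) powr 1"
    using p by (intro set_integral_Gamma) simp_all
  finally show ?thesis using p by simp
qed

lemma resolvent_eq_average: "resolvent f = average (power_kernel 1 1) f"
proof -
  have "resolvent f = neg_fractional_power stable_semigroup 1 1 f"
    unfolding resolvent_def neg_fractional_power_def
    by (simp, intro set_lebesgue_integral_cong) auto
  then show ?thesis by (simp add: neg_fractional_power_eq_average)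
qed

subsection \<open>The generator\<close>

text \<open>
  Write \<open>R\<close> for the resolvent, \<open>A\<^sub>\<epsilon>\<close> for the truncated derivative and \<open>Q\<^sub>\<epsilon>\<close> for the averages with
  \<open>A\<^sub>\<epsilon> R = Q\<^sub>\<epsilon> (1 - R)\<close>.  An \<open>f\<close> in the domain of the generator is \<open>R (f - g)\<close>, hence
  \<open>A\<^sub>\<epsilon> f = Q\<^sub>\<epsilon> (- g)\<close>, which converges.  Conversely, if \<open>A\<^sub>\<epsilon> f\<close> converges to \<open>- g\<close>, then
  \<open>R A\<^sub>\<epsilon> f = Q\<^sub>\<epsilon> (f - R f)\<close> converges both to \<open>- R g\<close> and to \<open>f - R f\<close>, so that \<open>f = R (f - g)\<close>
  lies in the range of \<open>R\<close>, which is the domain.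
\<close>

lemma generator_iff_marchaud:
  "generator_graph stable_semigroup f g \<longleftrightarrow> has_marchaud_derivative \<alpha> f (- g)"
proof -
  let ?Q = "\<lambda>\<epsilon>. average (averaging_kernel \<epsilon>)"
  have half: "half_line_kernel (power_kernel 1 1)"
    by (rule half_line_power_kernel) simp_all
  note AR = truncated_operator_resolvent[OF half laplace_power_kernel_1, folded resolvent_eq_average]
  note RA = resolvent_truncated_operator[OF half laplace_power_kernel_1, folded resolvent_eq_average]
  interpret R: bounded_linear resolvent by (rule bounded_linear_resolvent)
  have pos: "\<forall>\<^sub>F \<epsilon> in at_right (0::real). 0 < \<epsilon>" by (rule eventually_at_right_less)
  show ?thesis
    unfolding has_marchaud_derivative_iff
  proof
    assume "generator_graph stable_semigroup f g"
    then have f: "resolvent (f - g) = f" by (rule resolvent_generator)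
    have "((\<lambda>\<epsilon>. ?Q \<epsilon> (- g)) \<longlongrightarrow> - g) (at_right 0)"
      by (rule averaging_kernel_tendsto)
    then show "((\<lambda>\<epsilon>. truncated_operator \<epsilon> f) \<longlongrightarrow> - g) (at_right 0)"
    proof (rule Lim_transform_eventually)
      show "\<forall>\<^sub>F \<epsilon> in at_right 0. ?Q \<epsilon> (- g) = truncated_operator \<epsilon> f"
        using pos by eventually_elim (use AR[of _ "f - g"] in \<open>simp add: f\<close>)
    qed
  next
    assume "((\<lambda>\<epsilon>. truncated_operator \<epsilon> f) \<longlongrightarrow> - g) (at_right 0)"
    then have "((\<lambda>\<epsilon>. resolvent (truncated_operator \<epsilon> f)) \<longlongrightarrow> resolvent (- g)) (at_right 0)"
      by (rule R.tendsto)
    moreover have "((\<lambda>\<epsilon>. resolvent (truncated_operator \<epsilon> f)) \<longlongrightarrow> f - resolvent f) (at_right 0)"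
    proof (rule Lim_transform_eventually)
      show "((\<lambda>\<epsilon>. ?Q \<epsilon> (f - resolvent f)) \<longlongrightarrow> f - resolvent f) (at_right 0)"
        by (rule averaging_kernel_tendsto)
      show "\<forall>\<^sub>F \<epsilon> in at_right 0. ?Q \<epsilon> (f - resolvent f) = resolvent (truncated_operator \<epsilon> f)"
        using pos by eventually_elim (simp add: RA AR)
    qed
    ultimately have "resolvent (- g) = f - resolvent f"
      by (rule tendsto_unique[OF trivial_limit_at_right_real])
    then have "resolvent (f - g) = f" by (simp add: R.diff R.neg algebra_simps)
    then show "generator_graph stable_semigroup f g"
      using generator_resolvent[of "f - g"] by simp
  qed
qed

lemma marchaud_semigroup_stable: "marchaud_semigroup \<alpha> stable_semigroup"
  by (simp add: marchaud_semigroup_def c0_semigroup_stable generator_iff_marchaud)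

end

section \<open>Duality with convolutions\<close>

lemma inner_translate_left: "inner (translate z f) g = inner f (translate (- z) g)"
proof -
  have "inner (translate z f) g = inner (translate (- z) (translate z f)) (translate (- z) g)"
  proof -
    have isometry: "inner (translate y f) (translate y g) = inner f g" for y f g
      using norm_translate[of y "f + g"] bounded_linear.linear[OF bounded_linear_translate[of y]]
      by (simp add: dot_norm linear_add)
    show ?thesis by (rule isometry[symmetric])
  qed
  then show ?thesis by (simp add: translate_translate)
qed

lemma l2_convolution_eq_average:
  assumes "integrable lborel K"
  shows "l2_convolution K f = average (\<lambda>z. K (- z)) f"
proof -
  have K: "integrable lborel (\<lambda>z. K (- z))"
    using lborel_integrable_real_affine[OF assms, of "-1" 0] by simp
  have "(LINT z|lborel. K (- z) * l2_fun f (t + z)) = (LINT y|lborel. K y * l2_fun f (t - y))" for t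
    using lborel_integral_real_affine[of "-1" "\<lambda>y. K y * l2_fun f (t - y)" 0] by simp
  then show ?thesis
    using average_to_l2[OF K square_integrable_l2_fun[of f]] by (simp add: l2_convolution_def)
qed

text \<open>
  The adjoint of a translation is the opposite translation, so averaging over \<open>\<tau>\<^sub>z\<close> is dual to
  averaging over \<open>\<tau>\<close> at \<open>- z\<close>, which is convolution.
\<close>

lemma adjoint_average:
  assumes K: "integrable lborel K"
  shows "adjoint (average K) = l2_convolution K"
proof (rule adjoint_unique, intro allI)
  fix f g
  have K': "integrable lborel (\<lambda>z. K (- z))"
    using lborel_integrable_real_affine[OF K, of "-1" 0] by simp
  have "inner f (l2_convolution K g) = (LINT z|lborel. K (- z) * inner (translate z g) f)"
    unfolding l2_convolution_eq_average[OF K] using inner_average[OF K', of g f]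
    by (simp add: inner_commute)
  also have "\<dots> = (LINT z|lborel. K z * inner (translate (- z) g) f)"
    using lborel_integral_real_affine[of "-1" "\<lambda>z. K z * inner (translate (- z) g) f" 0] by simp
  also have "inner (translate (- z) g) f = inner (translate z f) g" for z
    using inner_translate_left[of z f g] by (simp add: inner_commute)
  then have "(LINT z|lborel. K z * inner (translate (- z) g) f) = inner (average K f) g"
    by (simp add: inner_average[OF K])
  finally show "inner (average K f) g = inner f (l2_convolution K g)" ..
qed

theorem theorem2p1:
  fixes \<alpha> \<beta> \<mu> \<sigma> :: real
    and M :: "'a measure"
    and E :: "l2 \<Rightarrow> 'a \<Rightarrow> real"
    and h :: "real \<Rightarrow> real \<Rightarrow> real"
    and K :: "real \<Rightarrow> real"
  assumes "0 < \<alpha>" and "\<alpha> < 1" and "0 < \<beta>" and "0 < \<mu>"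
    and "white_noise M \<sigma> E"
    and "stable_subordinator_density \<alpha> h"
  defines "K \<equiv> \<lambda>z. if z < 0 then 0
      else 1 / Gamma \<beta> * (LINT s:{0<..}|lborel. s powr (\<beta> - 1) * exp (- (s * \<mu>)) * h z s)"
  shows "integrable lborel K \<and> solves_fractional_equation \<alpha> \<beta> \<mu> E (moving_average K E)"
proof -
  interpret stable_subordinator \<alpha> h
    using assms by unfold_locales
  have K: "K = power_kernel \<mu> \<beta>"
  proof
    fix z
    show "K z = power_kernel \<mu> \<beta> z"
    proof (cases "z < 0")
      case True
      then show ?thesis by (simp add: K_def power_kernel_def law_def)
    next
      case False
      then have "(LINT s:{0<..}|lborel. s powr (\<beta> - 1) * exp (- (s * \<mu>)) * h z s)
          = (LINT s:{0<..}|lborel. s powr (\<beta> - 1) * exp (- (s * \<mu>)) * law s z)"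
        by (intro set_lebesgue_integral_cong) (auto simp: law_def)
      then show ?thesis using False by (simp add: K_def power_kernel_def)
    qed
  qed
  have int: "integrable lborel K"
    unfolding K using \<open>0 < \<mu>\<close> \<open>0 < \<beta>\<close>
    by (intro half_line_kernel_integrable half_line_power_kernel)
  have "neg_fractional_power stable_semigroup \<mu> \<beta> = average K"
    unfolding K using \<open>0 < \<mu>\<close> \<open>0 < \<beta>\<close> by (intro ext neg_fractional_power_eq_average)
  then have "moving_average K E = dual_action (neg_fractional_power stable_semigroup \<mu> \<beta>) E"
    by (intro ext) (simp add: moving_average_def dual_action_def adjoint_average[OF int])
  then show ?thesis
    unfolding solves_fractional_equation_def using int marchaud_semigroup_stable by blast
qed

end
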